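(* Let $X$ be a Hilbert space, $(P,d)$ a metric space, $f\colon X\times P\to X$, and $g\colon X\times P\to(-\infty,\infty]$ lower semicontinuous. Let $\bar x\in S(\bar v,\bar p)$, put $\hat v:=\bar v-f(\bar x,\bar p)$, and suppose that the assumptions (A1), (A2), (A3) given in the context hold. Then $\bar x$ is a Lipschitzian fully stable solution of the parametric variational system $v\in f(x,p)+\partial_xg(x,p)$ corresponding to $(\bar v,\bar p)$ if and only if both of the following hold: (a) there exist $\eta,\kappa_0>0$ such that whenever $(u,p,v)\in\mathrm{gph}\,\partial_xg\cap\mathbb B_\eta(\bar x,\bar p,\hat v)$ we have $$\langle\nabla_xf(\bar x,\bar p)w,w\rangle+\langle z,w\rangle\ge\kappa_0\|w\|^2\quad\text{for all } z\in(\widehat D^*\partial g_p)(u,v)(w),\ w\in X;$$ (b) the set-valued mapping $K\colon P\rightrightarrows X\times X$, $K(p):=\mathrm{gph}\,\partial_xg(\cdot,p)$, is Lipschitz-like around $(\bar p,(\bar x,\hat v))$. Consequently, (a) and (b) imply that the solution map $S$ admits a Lipschitz continuous single-valued localization around $(\bar v,\bar p,\bar x)$.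
   Context: $X$ is a real Hilbert space identified with its dual. $\mathbb B$ is the closed unit ball; $\mathbb B_\eta(\cdot)$ denotes closed balls of radius $\eta$, and $\mathbb B_\eta(x,p,v)=\mathbb B_\eta(x)\times\mathbb B_\eta(p)\times\mathbb B_\eta(v)$. Subdifferentials. For lower semicontinuous $\varphi\colon X\to(-\infty,\infty]$ and $\varphi(\bar x)<\infty$: $\widehat\partial\varphi(\bar x)=\{v:\liminf_{x\to\bar x}[\varphi(x)-\varphi(\bar x)-\langle v,x-\bar x\rangle]/\|x-\bar x\|\ge0\}$; the limiting subdifferential $\partial\varphi(\bar x)$ is the set of $v$ for which there are sequences $x_k\to\bar x$ with $\varphi(x_k)\to\varphi(\bar x)$ and $v_k\in\widehat\partial\varphi(x_k)$ converging weakly to $v$. With $g_p:=g(\cdot,p)$, put $\partial_xg(x,p):=\partial g_p(x)$, $\mathrm{gph}\,\partial_xg=\{(x,p,v):v\in\partial_xg(x,p)\}$ and $\mathrm{gph}\,\partial_xg(\cdot,p)=\{(x,v):v\in\partial_xg(x,p)\}$. Regular coderivative. $\widehat N_\Omega(\bar z)=\{\zeta:\limsup_{z\to\bar z,\,z\in\Omega}\langle\zeta,z-\bar z\rangle/\|z-\bar z\|\le0\}$; for $F\colon X\rightrightarrows X$, $(u,v)\in\mathrm{gph}\,F$, $\widehat D^*F(u,v)(w)=\{z:(z,-w)\in\widehat N_{\mathrm{gph}F}(u,v)\}$. $(\widehat D^*\partial g_p)(u,v)$ is the regular coderivative of $\partial g_p\colon X\rightrightarrows X$ at $(u,v)$.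 Solution map. $S(v,p)=\{x\in X:v\in f(x,p)+\partial_xg(x,p)\}$. A single-valued localization of $S$ relative to a neighborhood $V\times Q\times U$ of $(\bar v,\bar p,\bar x)$ is a single-valued mapping $\vartheta\colon V\times Q\to U$, defined on all of $V\times Q$, with $\mathrm{gph}\,\vartheta=\mathrm{gph}\,S\cap(V\times Q\times U)$. Lipschitzian full stability. $\bar x\in S(\bar v,\bar p)$ is a Lipschitzian fully stable solution corresponding to $(\bar v,\bar p)$ if $S$ admits a single-valued localization $\vartheta$ relative to some neighborhood $V\times Q\times U$ of $(\bar v,\bar p,\bar x)$ such that for some constants $\kappa,\ell>0$ and all $(v_1,p_1),(v_2,p_2)\in V\times Q$: $\|(v_1-v_2)-2\kappa[\vartheta(v_1,p_1)-\vartheta(v_2,p_2)]\|\le\|v_1-v_2\|+\ell\,d(p_1,p_2)$. Lipschitz-like property. $F\colon P\rightrightarrows Y$ ($Y$ normed) is Lipschitz-like around $(\bar p,\bar y)\in\mathrm{gph}\,F$ if there are neighborhoods $Q$ of $\bar p$, $W$ of $\bar y$ and $\ell>0$ with $F(p)\cap W\subset F(q)+\ell d(p,q)\mathbb B$ for all $p,q\in Q$. Assumptions (with $\hat v=\bar v-f(\bar x,\bar p)\in\partial_xg(\bar x,\bar p)$): (A1) $f$ is differentiable with respect to $x$ at all points $(x,p)$ around $(\bar x,\bar p)$ and $\nabla_xf$ is continuous at $(\bar x,\bar p)$; moreover there are a neighborhood $U\times Q$ of $(\bar x,\bar p)$ and $L>0$ with $\|f(x,p_1)-f(x,p_2)\|\le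 Ld(p_1,p_2)$ for all $x\in U$, $p_1,p_2\in Q$. (A2) $g$ is parametrically continuously prox-regular at $(\bar x,\bar p)$ for $\hat v$, i.e.: there are neighborhoods $U$ of $\bar x$, $V$ of $\hat v$, $Q$ of $\bar p$ and $\varepsilon,r>0$ such that $g(x,p)\ge g(u,p)+\langle v,x-u\rangle-\frac r2\|x-u\|^2$ for all $x\in U$ whenever $v\in\partial_xg(u,p)\cap V$, $u\in U$, $p\in Q$, $g(u,p)\le g(\bar x,\bar p)+\varepsilon$; and the mapping $(x,p,v)\mapsto g(x,p)$ is continuous relative to $\mathrm{gph}\,\partial_xg$ at $(\bar x,\bar p,\hat v)$. (A3) The mapping $p\mapsto\mathrm{epi}\,g(\cdot,p)$ is Lipschitz-like around $(\bar p,(\bar x,g(\bar x,\bar p)))$. *)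

theory Defs
  imports "HOL-Analysis.Analysis"
begin

text \<open>
  Throughout, a Hilbert space is a type of sort \<open>{real_inner, complete_space}\<close>, identified with
  its dual. A neighbourhood of \<open>x\<close> is any set \<open>U\<close> with \<open>x \<in> interior U\<close>. Products of spaces carry
  the library's product structure, i.e. the Euclidean sum of the norms (metrics, inner products).
\<close>

definition lsc :: "('a::topological_space \<Rightarrow> ereal) \<Rightarrow> bool" where
  "lsc \<phi> \<longleftrightarrow> (\<forall>x. \<phi> x \<le> Liminf (nhds x) \<phi>)"

definition gph :: "('a \<Rightarrow> 'b set) \<Rightarrow> ('a \<times> 'b) set" where
  "gph F = {(x, y). y \<in> F x}"

definition epi :: "('a \<Rightarrow> ereal) \<Rightarrow> ('a \<times> real) set" where
  "epi \<phi> = {(x, \<alpha>). \<phi> x \<le> ereal \<alpha>}"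

subsection \<open>Subdifferentials\<close>

text \<open>Both subdifferentials are empty at points where the function is not finite.\<close>

definition reg_subdiff :: "('a::real_inner \<Rightarrow> ereal) \<Rightarrow> 'a \<Rightarrow> 'a set" where
  "reg_subdiff \<phi> x0 = {v. \<bar>\<phi> x0\<bar> \<noteq> \<infinity> \<and>
     0 \<le> Liminf (at x0) (\<lambda>x. (\<phi> x - \<phi> x0 - ereal (inner v (x - x0))) / ereal (norm (x - x0)))}"

text \<open>Since the space is identified with its dual, weak convergence is tested by inner products.\<close>

definition weakly_tendsto :: "(nat \<Rightarrow> 'a::real_inner) \<Rightarrow> 'a \<Rightarrow> bool" where
  "weakly_tendsto vs v \<longleftrightarrow> (\<forall>w. (\<lambda>k. inner (vs k) w) \<longlonglongrightarrow> inner v w)"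

definition lim_subdiff :: "('a::real_inner \<Rightarrow> ereal) \<Rightarrow> 'a \<Rightarrow> 'a set" where
  "lim_subdiff \<phi> x0 = {v. \<bar>\<phi> x0\<bar> \<noteq> \<infinity> \<and>
     (\<exists>xs vs. xs \<longlonglongrightarrow> x0 \<and> (\<lambda>k. \<phi> (xs k)) \<longlonglongrightarrow> \<phi> x0 \<and>
        (\<forall>k. vs k \<in> reg_subdiff \<phi> (xs k)) \<and> weakly_tendsto vs v)}"

definition subdiff_x :: "('a::real_inner \<times> 'p \<Rightarrow> ereal) \<Rightarrow> 'a \<Rightarrow> 'p \<Rightarrow> 'a set" where
  "subdiff_x g x p = lim_subdiff (\<lambda>x'. g (x', p)) x"

definition gph_subdiff_x :: "('a::real_inner \<times> 'p \<Rightarrow> ereal) \<Rightarrow> ('a \<times> 'p \<times> 'a) set" where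
  "gph_subdiff_x g = {(x, p, v). v \<in> subdiff_x g x p}"

subsection \<open>Regular coderivative\<close>

definition reg_normal :: "'a::real_inner set \<Rightarrow> 'a \<Rightarrow> 'a set" where
  "reg_normal \<Omega> z0 = {\<zeta>. z0 \<in> \<Omega> \<and>
     Limsup (at z0 within \<Omega>) (\<lambda>z. ereal (inner \<zeta> (z - z0) / norm (z - z0))) \<le> 0}"

definition reg_coderiv ::
    "('a::real_inner \<Rightarrow> 'b::real_inner set) \<Rightarrow> 'a \<times> 'b \<Rightarrow> 'b \<Rightarrow> 'a set" where
  "reg_coderiv F uv w = {z. (z, - w) \<in> reg_normal (gph F) uv}"

subsection \<open>Properties of set-valued mappings\<close>

definition lipschitz_like ::
    "('p::metric_space \<Rightarrow> 'y::real_normed_vector set) \<Rightarrow> 'p \<Rightarrow> 'y \<Rightarrow> bool" where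
  "lipschitz_like F p0 y0 \<longleftrightarrow> (p0, y0) \<in> gph F \<and>
     (\<exists>Q W l. p0 \<in> interior Q \<and> y0 \<in> interior W \<and> l > 0 \<and>
        (\<forall>p\<in>Q. \<forall>q\<in>Q. F p \<inter> W \<subseteq> {y + (l * dist p q) *\<^sub>R b | y b. y \<in> F q \<and> b \<in> cball 0 1}))"

definition sv_localization ::
    "('v::topological_space \<times> 'p::topological_space \<Rightarrow> 'x::topological_space set) \<Rightarrow>
     'v \<Rightarrow> 'p \<Rightarrow> 'x \<Rightarrow> 'v set \<Rightarrow> 'p set \<Rightarrow> 'x set \<Rightarrow> ('v \<times> 'p \<Rightarrow> 'x) \<Rightarrow> bool" where
  "sv_localization S v0 p0 x0 V Q U \<theta> \<longleftrightarrow>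
     v0 \<in> interior V \<and> p0 \<in> interior Q \<and> x0 \<in> interior U \<and>
     \<theta> ` (V \<times> Q) \<subseteq> U \<and>
     {((v, p), x). (v, p) \<in> V \<times> Q \<and> x = \<theta> (v, p)} = gph S \<inter> (V \<times> Q) \<times> U"

subsection \<open>Parametric variational systems\<close>

definition solution_map ::
    "('a::real_inner \<times> 'p \<Rightarrow> 'a) \<Rightarrow> ('a \<times> 'p \<Rightarrow> ereal) \<Rightarrow> 'a \<times> 'p \<Rightarrow> 'a set" where
  "solution_map f g = (\<lambda>(v, p). {x. v \<in> (\<lambda>w. f (x, p) + w) ` subdiff_x g x p})"

definition lipschitzian_fully_stable ::
    "('a::real_inner \<times> 'p::metric_space \<Rightarrow> 'a) \<Rightarrow> ('a \<times> 'p \<Rightarrow> ereal) \<Rightarrow> 'a \<Rightarrow> 'p \<Rightarrow> 'a \<Rightarrow> bool" where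
  "lipschitzian_fully_stable f g x0 p0 v0 \<longleftrightarrow> x0 \<in> solution_map f g (v0, p0) \<and>
     (\<exists>V Q U \<theta>. sv_localization (solution_map f g) v0 p0 x0 V Q U \<theta> \<and>
        (\<exists>\<kappa> l. \<kappa> > 0 \<and> l > 0 \<and>
           (\<forall>v1\<in>V. \<forall>p1\<in>Q. \<forall>v2\<in>V. \<forall>p2\<in>Q.
              norm ((v1 - v2) - (2 * \<kappa>) *\<^sub>R (\<theta> (v1, p1) - \<theta> (v2, p2)))
                \<le> norm (v1 - v2) + l * dist p1 p2)))"

text \<open>
  The partial gradient as a bounded linear operator, so that its continuity is meant in the
  operator norm. It is meaningful only where \<open>f\<close> is Frechet differentiable in \<open>x\<close>.
\<close>

definition grad_x ::
    "('a::real_normed_vector \<times> 'p \<Rightarrow> 'a) \<Rightarrow> 'a \<Rightarrow> 'p \<Rightarrow> 'a \<Rightarrow>\<^sub>L 'a" where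
  "grad_x f x p = Blinfun (frechet_derivative (\<lambda>x'. f (x', p)) (at x))"

definition smooth_lipschitz_base ::
    "('a::real_inner \<times> 'p::metric_space \<Rightarrow> 'a) \<Rightarrow> 'a \<Rightarrow> 'p \<Rightarrow> bool" where
  "smooth_lipschitz_base f x0 p0 \<longleftrightarrow>
     (\<exists>U Q. x0 \<in> interior U \<and> p0 \<in> interior Q \<and>
        (\<forall>x\<in>U. \<forall>p\<in>Q. (\<lambda>x'. f (x', p)) differentiable (at x))) \<and>
     isCont (\<lambda>(x, p). grad_x f x p) (x0, p0) \<and>
     (\<exists>U Q L. x0 \<in> interior U \<and> p0 \<in> interior Q \<and> L > 0 \<and>
        (\<forall>x\<in>U. \<forall>p1\<in>Q. \<forall>p2\<in>Q. norm (f (x, p1) - f (x, p2)) \<le> L * dist p1 p2))"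

definition param_cont_prox_regular ::
    "('a::real_inner \<times> 'p::metric_space \<Rightarrow> ereal) \<Rightarrow> 'a \<Rightarrow> 'p \<Rightarrow> 'a \<Rightarrow> bool" where
  "param_cont_prox_regular g x0 p0 v0 \<longleftrightarrow>
     (\<exists>U V Q \<epsilon> r. x0 \<in> interior U \<and> v0 \<in> interior V \<and> p0 \<in> interior Q \<and>
        (\<epsilon>::real) > 0 \<and> (r::real) > 0 \<and>
        (\<forall>u\<in>U. \<forall>p\<in>Q. \<forall>v \<in> subdiff_x g u p \<inter> V. g (u, p) \<le> g (x0, p0) + ereal \<epsilon> \<longrightarrow>
           (\<forall>x\<in>U. g (x, p) \<ge> g (u, p) + ereal (inner v (x - u)) - ereal (r / 2 * (norm (x - u))\<^sup>2)))) \<and>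
     continuous (at (x0, p0, v0) within gph_subdiff_x g) (\<lambda>(x, p, v). g (x, p))"

end

theory Submission
  imports Defs
begin

text \<open>
  Write \<open>T\<^sub>p = \<partial>\<^sub>x g(\<cdot>, p)\<close>. Lipschitzian full stability says that near \<open>(xbar, vbar)\<close> the mappings
  \<open>f(\<cdot>, p) + T\<^sub>p\<close> are strongly monotone with a common modulus, and that they have single-valued
  inverses on a common neighbourhood, which depend on \<open>p\<close> in a Lipschitz way. The inequality
  \<open>norm (d - c *\<^sub>R D) \<le> norm d\<close> that encodes this is just \<open>c * (norm D)\<^sup>2 \<le> 2 * inner D d\<close>
  (\<open>norm_diff_scaleR_le_iff\<close>), so "strongly monotone" and "a shifted inverse is nonexpansive" are
  interchangeable; the proof moves between the two.

  Conditions (a) and (b) follow from full stability by differentiation and by transport along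
  the localization. A regular normal to the graph of \<open>T\<^sub>p\<close> tested along the curve
  \<open>t \<mapsto> \<theta>(y + t e, p)\<close>, with \<open>e\<close> arbitrary, yields \<open>norm (z' - 2\<kappa> w) \<le> norm z'\<close> for
  \<open>z' = z + \<nabla>\<^sub>x f\<^sup>* w\<close>, hence (a) by continuity of the gradient (\<open>coderivative_bound_from_lipschitz_inverse\<close>). For (b), a point
  of the graph of \<open>T\<^sub>p\<close> is a solution for some \<open>v\<close>, and the solution for the same \<open>v\<close> and another
  parameter \<open>q\<close> gives the required nearby point of the graph of \<open>T\<^sub>q\<close>.

  The converse has to turn a pointwise inequality on normals into monotonicity. Fix \<open>p\<close>.
  Prox-regularity makes \<open>T\<^sub>p + r I\<close> locally monotone, and minimizing \<open>g(\<cdot>, p)\<close> plus a quadratic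
  shows that \<open>T\<^sub>p + \<sigma> I\<close> is locally onto for \<open>\<sigma> > r\<close> (\<open>local_resolvent_onto\<close>). Adding
  \<open>f(\<cdot>, p)\<close>, whose Lipschitz constant is absorbed by enlarging \<open>\<sigma>\<close>, is a contraction argument
  (\<open>perturbed_equation_solvable\<close>). So \<open>J = (f(\<cdot>, p) + T\<^sub>p + \<sigma> I)\<^sup>-\<^sup>1\<close> is single-valued and
  Lipschitz on a ball. A proximal subgradient of a scalarization of \<open>2(\<kappa> + \<sigma>) J - I\<close> is a regular
  normal to the graph of \<open>T\<^sub>p\<close> in disguise, and (a) bounds it by the norm of the scalarizing vector.
  A mean value theorem for proximal subgradients
  (\<open>lipschitz_if_proximal_subgradients_bounded\<close>) then makes \<open>2(\<kappa> + \<sigma>) J - I\<close> nonexpansive,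
  that is, \<open>f(\<cdot>, p) + T\<^sub>p\<close> strongly monotone with modulus \<open>\<kappa>\<close>
  (\<open>coderivative_bound_imp_strong_monotonicity\<close>). Now \<open>J\<close> has the Lipschitz constant
  \<open>1 / (\<kappa> + \<sigma>) < 1 / \<sigma>\<close>, so removing \<open>\<sigma> I\<close> is once more a contraction argument. All radii depend
  on the common constants only; (b) supplies, for each \<open>p\<close> near \<open>pbar\<close>, a point of the graph of
  \<open>T\<^sub>p\<close> to start from, and the Lipschitz dependence on \<open>p\<close>.

  Closed balls of a Hilbert space need not be compact, so minimizers come from a variational
  principle with quadratic perturbations (\<open>smooth_variational_principle\<close>). It serves three times:
  for the resolvent, for the mean value theorem, and for the Riesz representation theorem, which
  provides adjoints.
\<close>

section \<open>A variational principle with quadratic perturbations\<close>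

lemma Cauchy_if_geometric_steps:
  fixes s :: "nat \<Rightarrow> 'a::metric_space"
  assumes step: "\<And>n. dist (s n) (s (Suc n)) \<le> C * (1/2)^n"
  shows "Cauchy s"
proof -
  have tail: "dist (s m) (s (m + k)) \<le> 2 * C * ((1/2)^m - (1/2)^(m + k))" for m k
  proof (induction k)
    case (Suc k)
    have "dist (s m) (s (m + Suc k)) \<le> dist (s m) (s (m + k)) + dist (s (m + k)) (s (Suc (m + k)))"
      by (simp add: dist_triangle)
    also have "\<dots> \<le> 2 * C * ((1/2)^m - (1/2)^(m + k)) + C * (1/2)^(m + k)"
      using Suc step[of "m + k"] by simp
    finally show ?case by (simp add: algebra_simps)
  qed simp
  have C: "C \<ge> 0" using step[of 0] zero_le_dist[of "s 0" "s (Suc 0)"] by (simp del: zero_le_dist)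
  have "(\<lambda>m. 2 * C * (1/2::real)^m) \<longlonglongrightarrow> 2 * C * 0"
    by (intro tendsto_intros LIMSEQ_realpow_zero) auto
  then have lim: "(\<lambda>m. 2 * C * (1/2::real)^m) \<longlonglongrightarrow> 0" by simp
  show ?thesis
  proof (rule metric_CauchyI)
    fix e :: real assume "e > 0"
    then obtain M where M: "\<And>m. m \<ge> M \<Longrightarrow> 2 * C * (1/2)^m < e / 2"
      using order_tendstoD(2)[OF lim, of "e / 2"] by (auto simp: eventually_sequentially)
    have near: "dist (s M) (s m) < e / 2" if Mm: "m \<ge> M" for m
    proof -
      obtain k where "m = M + k" using le_Suc_ex[OF Mm] by blast
      then have "dist (s M) (s m) \<le> 2 * C * ((1/2)^M - (1/2)^(M + k))" using tail by simp
      also have "\<dots> \<le> 2 * C * (1/2)^M" using C by (simp add: mult_left_mono)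
      finally show ?thesis using M[of M] by simp
    qed
    show "\<exists>M. \<forall>m\<ge>M. \<forall>n\<ge>M. dist (s m) (s n) < e"
      using near dist_triangle_half_r[of "s M" _ e] by blast
  qed
qed

lemma near_minimizer_exists:
  fixes F :: "'a \<Rightarrow> real"
  assumes bdd: "\<And>x. x \<in> D \<Longrightarrow> m \<le> F x" and b: "b \<in> D" and "\<delta> > 0"
  obtains x where "x \<in> D" "F x \<le> F b" "\<And>y. y \<in> D \<Longrightarrow> F x \<le> F y + \<delta>"
proof -
  have bb: "bdd_below (F ` D)" using bdd by (rule bdd_belowI2)
  have "\<exists>x0\<in>D. F x0 < Inf (F ` D) + \<delta>"
    using cInf_lessD[of "F ` D" "Inf (F ` D) + \<delta>"] b \<open>\<delta> > 0\<close> by auto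
  then obtain x0 where x0: "x0 \<in> D" "F x0 < Inf (F ` D) + \<delta>" by blast
  have inf: "Inf (F ` D) \<le> F y" if "y \<in> D" for y using cINF_lower[OF bb that] .
  show thesis
  proof (cases "F x0 \<le> F b")
    case True
    show thesis by (rule that[of x0]) (use True x0 inf in fastforce)+
  next
    case False
    show thesis by (rule that[of b]) (use False x0 inf b in fastforce)+
  qed
qed

text \<open>
  A lower semicontinuous function on a bounded set need not attain its infimum, but it does after
  an arbitrarily small quadratic perturbation. This is the Borwein-Preiss construction: add
  \<open>\<mu> / 2^k * (norm (y - s k))\<^sup>2\<close> one after the other, each \<open>s (Suc k)\<close> being a near-minimizer of the
  function perturbed so far. The penalty centred at \<open>s k\<close> is weighted so much more heavily than
  the tolerance at stage \<open>k\<close> that the near-minimizers converge, and the limit minimizes \<open>h\<close> plus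
  the whole series. Expanding the squares around the limit leaves a linear term \<open>\<zeta>\<close> and one
  multiple of \<open>(norm (x - xs))\<^sup>2\<close>. Closed sublevel sets within \<open>D\<close> are required instead of a
  closed \<open>D\<close>, so that \<open>D\<close> may be the effective domain of an extended-valued function.
\<close>

theorem smooth_variational_principle:
  fixes h :: "'a::{real_inner, complete_space} \<Rightarrow> real"
  assumes closed: "\<And>\<alpha>. closed {x \<in> D. h x \<le> \<alpha>}"
    and bdd: "\<And>x. x \<in> D \<Longrightarrow> m \<le> h x"
    and "bounded D" and b: "b \<in> D" and \<epsilon>: "\<epsilon> > 0"
  obtains xs \<zeta> where "xs \<in> D" "h xs \<le> h b" "norm \<zeta> \<le> \<epsilon>"
    "\<And>x. x \<in> D \<Longrightarrow> h x \<ge> h xs + inner \<zeta> (x - xs) - \<epsilon> * (norm (x - xs))\<^sup>2"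
proof -
  obtain R where R: "\<And>x y. x \<in> D \<Longrightarrow> y \<in> D \<Longrightarrow> norm (x - y) \<le> R" and "R \<ge> 0"
  proof -
    obtain e where e: "\<And>x. x \<in> D \<Longrightarrow> norm x \<le> e" using \<open>bounded D\<close> by (auto simp: bounded_iff)
    have "norm (x - y) \<le> \<bar>2 * e\<bar>" if "x \<in> D" "y \<in> D" for x y
      using norm_triangle_ineq4[of x y] e[OF that(1)] e[OF that(2)] by linarith
    then show thesis using that by (meson abs_ge_zero)
  qed
  define \<mu> where "\<mu> = \<epsilon> / (4 * (R + 1))"
  have \<mu>: "\<mu> > 0" using \<epsilon> \<open>R \<ge> 0\<close> by (simp add: \<mu>_def)
  have \<mu>R: "4 * \<mu> * R \<le> \<epsilon>" and \<mu>1: "2 * \<mu> \<le> \<epsilon>"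
    using \<epsilon> \<open>R \<ge> 0\<close> by (auto simp: \<mu>_def field_simps)
  \<comment> \<open>A state is the current near-minimizer together with the accumulated penalty. The tolerance
    \<open>\<mu> / 8^n\<close> against the weight \<open>\<mu> / 2^n\<close> gives steps of length at most \<open>1 / 2^n\<close>.\<close>
  define P where "P n xq \<longleftrightarrow> fst xq \<in> D \<and> (\<forall>y. 0 \<le> snd xq y)
      \<and> (\<forall>y\<in>D. h (fst xq) + snd xq (fst xq) \<le> h y + snd xq y + \<mu> / 8^n)" for n :: nat and xq :: "'a \<times> ('a \<Rightarrow> real)"
  define Q where "Q n xq xq' \<longleftrightarrow> snd xq' = (\<lambda>y. snd xq y + \<mu> / 2^n * (norm (y - fst xq))\<^sup>2)
      \<and> h (fst xq') + snd xq' (fst xq') \<le> h (fst xq) + snd xq' (fst xq)" for n :: nat and xq xq' :: "'a \<times> ('a \<Rightarrow> real)"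
  have "\<exists>f. \<forall>n. (P n (f n) \<and> (n = 0 \<longrightarrow> h (fst (f n)) \<le> h b \<and> snd (f n) = (\<lambda>_. 0))) \<and> Q n (f n) (f (Suc n))"
  proof (rule dependent_nat_choice)
    obtain x where "x \<in> D" "h x \<le> h b" "\<And>y. y \<in> D \<Longrightarrow> h x \<le> h y + \<mu>"
      using near_minimizer_exists[of D m h b \<mu>] bdd b \<mu> by metis
    then show "\<exists>xq. P 0 xq \<and> (0 = (0::nat) \<longrightarrow> h (fst xq) \<le> h b \<and> snd xq = (\<lambda>_. 0))"
      by (intro exI[of _ "(x, \<lambda>_. 0)"]) (simp add: P_def)
  next
    fix xq and n :: nat
    assume "P n xq \<and> (n = 0 \<longrightarrow> h (fst xq) \<le> h b \<and> snd xq = (\<lambda>_. 0))"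
    then have P: "P n xq" by simp
    define q where "q = (\<lambda>y. snd xq y + \<mu> / 2^n * (norm (y - fst xq))\<^sup>2)"
    have q: "0 \<le> q y" for y using P \<mu> by (simp add: q_def P_def)
    obtain x where "x \<in> D" "h x + q x \<le> h (fst xq) + q (fst xq)"
      "\<And>y. y \<in> D \<Longrightarrow> h x + q x \<le> h y + q y + \<mu> / 8^Suc n"
    proof (rule near_minimizer_exists[of D m "\<lambda>x. h x + q x" "fst xq" "\<mu> / 8^Suc n"])
      show "m \<le> h x + q x" if "x \<in> D" for x using bdd[OF that] q[of x] by linarith
    qed (use P \<mu> in \<open>auto simp: P_def\<close>)
    then show "\<exists>xq'. (P (Suc n) xq' \<and> (Suc n = 0 \<longrightarrow> h (fst xq') \<le> h b \<and> snd xq' = (\<lambda>_. 0))) \<and> Q n xq xq'"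
      using q by (intro exI[of _ "(x, q)"]) (simp add: P_def Q_def q_def)
  qed
  then obtain f where f: "\<And>n. P n (f n)" "\<And>n. Q n (f n) (f (Suc n))"
    "h (fst (f 0)) \<le> h b" "snd (f 0) = (\<lambda>_. 0)" by blast
  define s where "s n = fst (f n)" for n
  define q where "q n = snd (f n)" for n
  have sD: "s n \<in> D" and near_min: "\<And>y. y \<in> D \<Longrightarrow> h (s n) + q n (s n) \<le> h y + q n y + \<mu> / 8^n" for n
    using f(1)[of n] by (auto simp: P_def s_def q_def)
  have q_Suc: "q (Suc n) y = q n y + \<mu> / 2^n * (norm (y - s n))\<^sup>2"
    and descent: "h (s (Suc n)) + q (Suc n) (s (Suc n)) \<le> h (s n) + q (Suc n) (s n)" for n y
    using f(2)[of n] by (auto simp: Q_def s_def q_def)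
  have q_sum: "q n y = (\<Sum>k<n. \<mu> / 2^k * (norm (y - s k))\<^sup>2)" for n y
    by (induction n) (simp_all add: q_Suc, simp add: q_def f(4))
  have "dist (s n) (s (Suc n)) \<le> 1 * (1/2)^n" for n
  proof -
    have "\<mu> / 2^n * (norm (s (Suc n) - s n))\<^sup>2 \<le> \<mu> / 8^n"
      using descent[of n] near_min[OF sD[of "Suc n"], of n] by (simp add: q_Suc)
    then have "(norm (s (Suc n) - s n))\<^sup>2 \<le> 2^n / 8^n"
      using \<mu> by (simp add: field_simps)
    also have "(2::real)^n / 8^n = ((1/2)^n)\<^sup>2"
    proof -
      have "((1/2)^n)\<^sup>2 = (1/4::real)^n" by (simp add: power2_eq_square flip: power_mult_distrib)
      then show ?thesis by (simp flip: power_divide)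
    qed
    finally have "norm (s (Suc n) - s n) \<le> (1/2)^n" by (rule power2_le_imp_le) simp
    then show ?thesis by (simp add: dist_norm norm_minus_commute)
  qed
  then have "Cauchy s" by (rule Cauchy_if_geometric_steps)
  then obtain xs where lim: "s \<longlonglongrightarrow> xs" using Cauchy_convergent convergent_def by blast
  \<comment> \<open>The perturbed values decrease along the sequence, and the closed sublevel sets carry this
    over to the limit.\<close>
  have limit_value: "xs \<in> D \<and> h xs + q n xs \<le> h (s n) + q n (s n)" for n
  proof -
    have mono: "h (s (n + k)) + q n (s (n + k)) \<le> h (s n) + q n (s n)" for k
    proof -
      have "h (s (n + k)) + q (n + k) (s (n + k)) \<le> h (s n) + q n (s n)"
        using descent by (induction k) (simp, use q_Suc[of _ "s _"] in \<open>simp, meson order_trans\<close>)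
      moreover have "q n y \<le> q (n + k) y" for y
        using \<mu> by (induction k) (simp, simp add: q_Suc add_increasing2)
      ultimately show ?thesis by (meson add_left_mono order_trans)
    qed
    have "(\<lambda>k. q n (s (n + k))) \<longlonglongrightarrow> q n xs"
      unfolding q_sum using LIMSEQ_ignore_initial_segment[OF lim, of n]
      by (intro tendsto_intros) (simp add: add.commute)
    then have ql: "\<forall>\<^sub>F k in sequentially. q n xs - e < q n (s (n + k))" if "e > 0" for e
      using that by (intro order_tendstoD(1)) auto
    have "xs \<in> {x \<in> D. h x \<le> h (s n) + q n (s n) - q n xs + e}" if "e > 0" for e
    proof (rule Lim_in_closed_set[OF closed])
      show "\<forall>\<^sub>F k in sequentially. s (n + k) \<in> {x \<in> D. h x \<le> h (s n) + q n (s n) - q n xs + e}"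
        using ql[OF that] by eventually_elim (use sD mono in \<open>auto, smt (verit)\<close>)
      show "(\<lambda>k. s (n + k)) \<longlonglongrightarrow> xs"
        using LIMSEQ_ignore_initial_segment[OF lim, of n] by (simp add: add.commute)
    qed simp
    then have "xs \<in> D" "\<And>e. e > 0 \<Longrightarrow> h xs \<le> h (s n) + q n (s n) - q n xs + e"
      by (auto intro: zero_less_one)
    then show ?thesis by (smt (verit) field_le_epsilon)
  qed
  \<comment> \<open>Half the gradient at \<open>xs\<close> of the penalty accumulated up to stage \<open>n\<close>.\<close>
  define d where "d n = (\<Sum>k<n. (\<mu> / 2^k) *\<^sub>R (xs - s k))" for n
  have "dist (d n) (d (Suc n)) \<le> (\<mu> * R) * (1/2)^n" for n
    using R[of xs "s n"] limit_value[of 0] sD[of n] \<mu>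
    by (simp add: d_def dist_norm power_divide divide_right_mono)
  then have "Cauchy d" by (rule Cauchy_if_geometric_steps)
  then obtain d' where d': "d \<longlonglongrightarrow> d'" using Cauchy_convergent convergent_def by blast
  have geom: "(\<Sum>k<n. \<mu> / 2^k) \<le> 2 * \<mu>" for n
  proof -
    have "(\<Sum>k<n. \<mu> / 2^k) = 2 * \<mu> * (1 - (1/2)^n)" by (induction n) (simp_all add: power_one_over algebra_simps)
    then show ?thesis using \<mu> by simp
  qed
  have "norm (d n) \<le> 2 * \<mu> * R" for n
  proof -
    have "norm (d n) \<le> (\<Sum>k<n. \<mu> / 2^k * R)"
      unfolding d_def using \<mu> R[of xs "s _"] limit_value[of 0] sD
      by (intro sum_norm_le) (auto simp: divide_right_mono)
    also have "\<dots> = (\<Sum>k<n. \<mu> / 2^k) * R" by (simp only: sum_distrib_right)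
    also have "\<dots> \<le> 2 * \<mu> * R" using geom[of n] \<open>R \<ge> 0\<close> by (rule mult_right_mono)
    finally show ?thesis .
  qed
  then have d'_le: "norm d' \<le> 2 * \<mu> * R"
    using LIMSEQ_le_const2[OF tendsto_norm[OF d']] by blast
  show thesis
  proof (rule that[of xs "- 2 *\<^sub>R d'"])
    show "xs \<in> D" using limit_value by blast
    show "h xs \<le> h b" using limit_value[of 0] f(3) by (simp add: q_sum s_def)
    show "norm (- 2 *\<^sub>R d') \<le> \<epsilon>" using d'_le \<mu>R by simp
    fix x assume "x \<in> D"
    have "h xs - 2 * inner (d n) (x - xs) - \<epsilon> * (norm (x - xs))\<^sup>2 - \<mu> * (1/8)^n \<le> h x" for n
    proof -
      have expand: "(norm (x - s k))\<^sup>2 = (norm (xs - s k))\<^sup>2 + 2 * inner (xs - s k) (x - xs) + (norm (x - xs))\<^sup>2" for k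
        by (simp add: power2_norm_eq_inner algebra_simps inner_commute)
      have "q n x = (\<Sum>k<n. \<mu> / 2^k * (norm (xs - s k))\<^sup>2 + 2 * inner ((\<mu> / 2^k) *\<^sub>R (xs - s k)) (x - xs)
          + \<mu> / 2^k * (norm (x - xs))\<^sup>2)"
        unfolding q_sum expand by (intro sum.cong) (simp_all add: distrib_left)
      also have "\<dots> = q n xs + 2 * inner (d n) (x - xs) + (\<Sum>k<n. \<mu> / 2^k) * (norm (x - xs))\<^sup>2"
        unfolding q_sum d_def by (simp add: sum.distrib sum_distrib_left sum_distrib_right inner_sum_left)
      also have "\<dots> \<le> q n xs + 2 * inner (d n) (x - xs) + \<epsilon> * (norm (x - xs))\<^sup>2"
        using geom[of n] \<mu>1 by (simp add: mult_right_mono)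
      finally show ?thesis
        using near_min[OF \<open>x \<in> D\<close>, of n] limit_value[of n] by (simp add: power_divide)
    qed
    moreover have "(\<lambda>n. h xs - 2 * inner (d n) (x - xs) - \<epsilon> * (norm (x - xs))\<^sup>2 - \<mu> * (1/8)^n)
        \<longlonglongrightarrow> h xs - 2 * inner d' (x - xs) - \<epsilon> * (norm (x - xs))\<^sup>2 - \<mu> * 0"
      by (intro tendsto_intros d' LIMSEQ_realpow_zero) auto
    ultimately have "h xs - 2 * inner d' (x - xs) - \<epsilon> * (norm (x - xs))\<^sup>2 - \<mu> * 0 \<le> h x"
      by (intro LIMSEQ_le_const2) auto
    then show "h x \<ge> h xs + inner (- 2 *\<^sub>R d') (x - xs) - \<epsilon> * (norm (x - xs))\<^sup>2" by simp
  qed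
qed

section \<open>Riesz representation and adjoint vectors\<close>

lemma zero_if_quadratically_small:
  fixes a :: real
  assumes "t0 > 0" and small: "\<And>t. 0 < t \<Longrightarrow> t < t0 \<Longrightarrow> t * a \<le> K * t\<^sup>2"
  shows "a \<le> 0"
proof (rule ccontr)
  assume "\<not> a \<le> 0"
  then have "a > 0" by simp
  define t where "t = min (t0 / 2) (a / (2 * (\<bar>K\<bar> + 1)))"
  have t: "0 < t" "t < t0" using \<open>t0 > 0\<close> \<open>a > 0\<close> by (auto simp: t_def)
  have "t * (2 * (\<bar>K\<bar> + 1)) \<le> a"
    unfolding t_def by (subst pos_le_divide_eq[symmetric]) auto
  moreover have "a \<le> K * t" using small[OF t] t by (simp add: power2_eq_square)
  moreover have "K * t \<le> \<bar>K\<bar> * t" using t by (intro mult_right_mono) auto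
  ultimately have "2 * (\<bar>K\<bar> * t) + 2 * t \<le> \<bar>K\<bar> * t" by (simp add: algebra_simps)
  moreover have "\<bar>K\<bar> * t \<ge> 0" using t by simp
  ultimately show False using t by linarith
qed

text \<open>
  The representing vector minimizes \<open>(norm x)\<^sup>2 / 2 - \<phi> x\<close>. The variational principle yields a
  minimizer of a perturbed function, but the perturbation is itself quadratic with a known
  gradient \<open>\<zeta>\<close>, so its stationarity condition already represents \<open>\<phi>\<close>.
\<close>

theorem Riesz_representation:
  fixes \<phi> :: "'a::{real_inner, complete_space} \<Rightarrow> real"
  assumes "bounded_linear \<phi>"
  obtains z where "\<And>h. \<phi> h = inner z h"
proof -
  interpret bounded_linear \<phi> by fact
  obtain N where N: "N > 0" "\<And>x. \<bar>\<phi> x\<bar> \<le> norm x * N" using pos_bounded by auto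
  define D where "D = cball (0::'a) (2 * N + 1)"
  define h where "h x = (norm x)\<^sup>2 / 2 - \<phi> x" for x
  have cont: "continuous_on UNIV h"
    unfolding h_def by (intro continuous_intros linear_continuous_on[OF assms]) auto
  have closed: "closed {x \<in> D. h x \<le> \<alpha>}" for \<alpha>
  proof -
    have "{x \<in> D. h x \<le> \<alpha>} = D \<inter> h -` {..\<alpha>}" by auto
    moreover have "closed (h -` {..\<alpha>})"
      using cont by (intro closed_vimage) (auto simp: continuous_on_eq_continuous_at)
    ultimately show ?thesis by (simp add: D_def closed_Int)
  qed
  have lower: "norm x * (norm x - 2 * N) / 2 \<le> h x" for x
    using N(2)[of x]
    by (simp add: h_def power2_eq_square right_diff_distrib diff_divide_distrib abs_le_iff)
  have bdd: "- (N * N) \<le> h x" if "x \<in> D" for x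
  proof -
    have "- (N * N) \<le> norm x * (norm x - 2 * N) / 2"
    proof -
      have "norm x * (norm x - 2 * N) = (norm x - N)\<^sup>2 - N * N"
        by (simp add: power2_eq_square algebra_simps)
      moreover have "(norm x - N)\<^sup>2 \<ge> 0" "N * N \<ge> 0" by simp_all
      ultimately show ?thesis by linarith
    qed
    then show ?thesis using lower[of x] by linarith
  qed
  obtain xs \<zeta> where xs: "xs \<in> D" "h xs \<le> h 0"
    "\<And>x. x \<in> D \<Longrightarrow> h x \<ge> h xs + inner \<zeta> (x - xs) - 1 * (norm (x - xs))\<^sup>2"
  proof (rule smooth_variational_principle[of D h "- (N * N)" 0 1, OF closed bdd])
    show "bounded D" "0 \<in> D" using N(1) by (auto simp: D_def)
  qed auto
  have "h 0 = 0" by (simp add: h_def)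
  then have "norm xs * (norm xs - 2 * N) \<le> 0" using lower[of xs] xs(2) by linarith
  then have inner_pt: "norm xs \<le> 2 * N" using N(1) by (auto simp: mult_le_0_iff)
  \<comment> \<open>Stationarity: \<open>xs\<close> is interior, so every direction \<open>e\<close> can be tested.\<close>
  have le: "inner \<zeta> e + \<phi> e - inner xs e \<le> 0" for e
  proof (rule zero_if_quadratically_small[of "1 / (norm e + 1)" _ "3 / 2 * (norm e)\<^sup>2"])
    fix t :: real assume t: "0 < t" "t < 1 / (norm e + 1)"
    have "norm e + 1 > 0" using norm_ge_zero[of e] by linarith
    then have "t * (norm e + 1) < 1" using t(2) by (simp only: pos_less_divide_eq)
    then have "t * norm e \<le> 1" using t(1) by (simp add: algebra_simps)
    then have "norm (xs + t *\<^sub>R e) \<le> 2 * N + 1"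
      using norm_triangle_ineq[of xs "t *\<^sub>R e"] inner_pt t by simp
    then have "xs + t *\<^sub>R e \<in> D" by (simp add: D_def)
    from xs(3)[OF this] show "t * (inner \<zeta> e + \<phi> e - inner xs e) \<le> 3 / 2 * (norm e)\<^sup>2 * t\<^sup>2"
      unfolding h_def power2_norm_eq_inner
      by (simp add: add scaleR algebra_simps inner_commute power2_eq_square)
  qed (auto intro: add_nonneg_pos)
  show thesis
  proof (rule that[of "xs - \<zeta>"])
    fix e
    have "inner \<zeta> e + \<phi> e - inner xs e = 0"
      using le[of e] le[of "- e"] scaleR[of "-1" e] by simp
    then show "\<phi> e = inner (xs - \<zeta>) e" by (simp add: inner_diff_left)
  qed
qed

corollary adjoint_vector_exists:
  fixes B :: "'a::{real_inner, complete_space} \<Rightarrow> 'b::real_inner"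
  assumes "bounded_linear B"
  obtains z where "\<And>h. inner z h = inner w (B h)"
  using Riesz_representation[of "\<lambda>h. inner w (B h)"]
    bounded_linear_compose[OF bounded_linear_inner_right assms, of w] by (metis (full_types))

section \<open>A mean value theorem for proximal subgradients\<close>

text \<open>
  A norm is bounded above by a quadratic that touches it at a given point: by Young's inequality,
  \<open>2 t norm (y - a) \<le> (norm (y - a))\<^sup>2 + t\<^sup>2\<close> with equality where \<open>norm (y - a) = t\<close>. Hence adding a
  norm to a function changes proximal subgradients in the expected way.
\<close>

lemma norm_secant_majorant:
  fixes a :: "'a::real_inner"
  assumes "x \<noteq> a"
  shows "norm (y - a) \<le> norm (x - a) + inner ((1 / norm (x - a)) *\<^sub>R (x - a)) (y - x)
      + (norm (y - x))\<^sup>2 / (2 * norm (x - a))"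
proof -
  define t where "t = norm (x - a)"
  have t: "t > 0" using assms by (simp add: t_def)
  have "0 \<le> (norm (y - a) - t)\<^sup>2" by simp
  then have "2 * t * norm (y - a) \<le> (norm (y - a))\<^sup>2 + t\<^sup>2" by (simp add: power2_diff algebra_simps)
  also have "(norm (y - a))\<^sup>2 = t\<^sup>2 + 2 * inner (x - a) (y - x) + (norm (y - x))\<^sup>2"
    by (simp add: t_def power2_norm_eq_inner algebra_simps inner_commute)
  finally have "2 * t * norm (y - a)
      \<le> 2 * t * (t + inner (x - a) (y - x) / t + (norm (y - x))\<^sup>2 / (2 * t))"
    using t by (simp add: distrib_left power2_eq_square)
  then show ?thesis using t by (simp add: t_def[symmetric])
qed

text \<open>
  If \<open>\<phi>\<close> dropped too fast from \<open>a\<close> to \<open>b\<close>, then \<open>\<phi> y + M' norm (y - a) + (L / R) (norm (y - a))\<^sup>2\<close>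
  with a suitable \<open>M' > M\<close> would be smaller at \<open>b\<close> than at \<open>a\<close>. The quadratic term makes it too large
  on the sphere of radius \<open>R\<close>, so an approximate minimizer lies strictly between the centre and the
  sphere, where the penalty has slope at least \<open>M'\<close>; this forces a proximal subgradient of \<open>\<phi>\<close> of
  norm greater than \<open>M\<close>.
\<close>

lemma proximal_subgradient_decrease:
  fixes \<phi> :: "'a::{real_inner, complete_space} \<Rightarrow> real"
  assumes lip: "L-lipschitz_on (cball a R) \<phi>" and R: "R > 0" and M: "M \<ge> 0"
    and prox: "\<And>y \<zeta> K e. e > 0 \<Longrightarrow> ball y e \<subseteq> cball a R \<Longrightarrow>
      (\<And>y'. y' \<in> ball y e \<Longrightarrow> \<phi> y' \<ge> \<phi> y + inner \<zeta> (y' - y) - K * (norm (y' - y))\<^sup>2) \<Longrightarrow> norm \<zeta> \<le> M"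
    and b: "norm (b - a) \<le> R"
  shows "\<phi> b \<ge> \<phi> a - M * norm (b - a) - L / R * (norm (b - a))\<^sup>2"
proof (rule ccontr)
  assume neg: "\<not> ?thesis"
  define gap where "gap = \<phi> a - M * norm (b - a) - L / R * (norm (b - a))\<^sup>2 - \<phi> b"
  have gap: "gap > 0" using neg by (simp add: gap_def)
  have L: "L \<ge> 0" using lip by (rule lipschitz_on_nonneg)
  define M' where "M' = M + gap / (norm (b - a) + 1)"
  define \<epsilon> where "\<epsilon> = (M' - M) / 2"
  have "norm (b - a) * gap < (norm (b - a) + 1) * gap" using gap by simp
  then have M': "M' > M" "(M' - M) * norm (b - a) < gap"
    using gap by (auto simp: M'_def add_nonneg_pos pos_divide_less_eq mult.commute)
  have \<epsilon>: "\<epsilon> > 0" using M' by (simp add: \<epsilon>_def)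
  define h where "h y = \<phi> y + M' * norm (y - a) + L / R * (norm (y - a))\<^sup>2" for y
  have \<phi>_le: "\<bar>\<phi> y - \<phi> a\<bar> \<le> L * norm (y - a)" if "y \<in> cball a R" for y
    using lipschitz_onD[OF lip that, of a] R by (simp add: dist_norm)
  have "continuous_on (cball a R) h"
    unfolding h_def by (intro continuous_intros lipschitz_on_continuous_on[OF lip])
  then have "closed (cball a R \<inter> h -` {..\<alpha>})" for \<alpha>
    by (rule continuous_closed_preimage) auto
  moreover have "{x \<in> cball a R. h x \<le> \<alpha>} = cball a R \<inter> h -` {..\<alpha>}" for \<alpha> by auto
  ultimately have closed: "closed {x \<in> cball a R. h x \<le> \<alpha>}" for \<alpha> by presburger
  have bdd: "\<phi> a - L * R \<le> h x" if "x \<in> cball a R" for x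
  proof -
    have "L * norm (x - a) \<le> L * R"
      using that L by (intro mult_left_mono) (auto simp: dist_norm norm_minus_commute)
    moreover have "0 \<le> M' * norm (x - a) + L / R * (norm (x - a))\<^sup>2" using M' M L R by simp
    ultimately show ?thesis using \<phi>_le[OF that] unfolding h_def by linarith
  qed
  have bD: "b \<in> cball a R" using b by (simp add: dist_norm norm_minus_commute)
  obtain ys \<zeta> where ys: "ys \<in> cball a R" "h ys \<le> h b" and \<zeta>: "norm \<zeta> \<le> \<epsilon>"
    and min: "\<And>y. y \<in> cball a R \<Longrightarrow> h y \<ge> h ys + inner \<zeta> (y - ys) - \<epsilon> * (norm (y - ys))\<^sup>2"
    using smooth_variational_principle[OF closed bdd bounded_cball bD \<epsilon>] by blast
  have hb: "h b < \<phi> a"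
    using M'(2) by (simp add: h_def gap_def algebra_simps)
  define t where "t = norm (ys - a)"
  have "ys \<noteq> a" using ys(2) hb by (auto simp: h_def)
  then have t: "t > 0" by (simp add: t_def)
  have "t < R"
  proof (rule ccontr)
    assume "\<not> t < R"
    then have "t = R" using ys(1) by (simp add: t_def dist_norm norm_minus_commute)
    then have "h ys \<ge> \<phi> a - L * R + M' * R + L * R"
      using \<phi>_le[OF ys(1)] R by (simp add: h_def t_def[symmetric] power2_eq_square)
    moreover have "M' * R \<ge> 0" using M' M R by simp
    ultimately show False using ys(2) hb by linarith
  qed
  \<comment> \<open>Minus the gradient of the penalty at \<open>ys\<close>, up to the small perturbation \<open>\<zeta>\<close>.\<close>
  define \<zeta>' where "\<zeta>' = \<zeta> - (M' / t + 2 * (L / R)) *\<^sub>R (ys - a)"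
  have "norm \<zeta>' \<le> M"
  proof (rule prox)
    show "R - t > 0" using \<open>t < R\<close> by simp
    show sub: "ball ys (R - t) \<subseteq> cball a R"
    proof
      fix y assume "y \<in> ball ys (R - t)"
      then show "y \<in> cball a R"
        using dist_triangle[of a y ys] by (simp add: t_def dist_norm norm_minus_commute)
    qed
    fix y assume "y \<in> ball ys (R - t)"
    then have "y \<in> cball a R" using sub by blast
    define I where "I = inner (ys - a) (y - ys)"
    define q where "q = (norm (y - ys))\<^sup>2"
    have "M' * norm (y - a) \<le> M' * (t + inner ((1 / t) *\<^sub>R (ys - a)) (y - ys) + q / (2 * t))"
      using norm_secant_majorant[OF \<open>ys \<noteq> a\<close>, of y] M M' unfolding t_def[symmetric] q_def
      by (intro mult_left_mono) auto
    also have "\<dots> = M' * t + M' / t * I + M' / (2 * t) * q"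
      by (simp add: I_def distrib_left inner_diff_left diff_divide_distrib right_diff_distrib)
    finally have 1: "M' * norm (y - a) \<le> M' * t + M' / t * I + M' / (2 * t) * q" .
    have "(norm (y - a))\<^sup>2 = t\<^sup>2 + 2 * I + q"
      by (simp add: t_def I_def q_def power2_norm_eq_inner algebra_simps inner_commute)
    then have 2: "L / R * (norm (y - a))\<^sup>2 = L / R * t\<^sup>2 + 2 * (L / R) * I + L / R * q"
      by (simp add: distrib_left)
    have 3: "inner \<zeta>' (y - ys) = inner \<zeta> (y - ys) - M' / t * I - 2 * (L / R) * I"
      unfolding \<zeta>'_def I_def inner_diff_left[of \<zeta>] inner_scaleR_left by (simp add: distrib_right)
    have 4: "(\<epsilon> + M' / (2 * t) + L / R) * q = \<epsilon> * q + M' / (2 * t) * q + L / R * q"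
      by (simp add: distrib_right)
    show "\<phi> y \<ge> \<phi> ys + inner \<zeta>' (y - ys) - (\<epsilon> + M' / (2 * t) + L / R) * (norm (y - ys))\<^sup>2"
      using min[OF \<open>y \<in> cball a R\<close>] 1 2 3 4 unfolding h_def t_def[symmetric] q_def[symmetric]
      by linarith
  qed
  moreover have "norm \<zeta>' \<ge> M' - \<epsilon>"
  proof -
    have "norm \<zeta>' \<ge> norm ((M' / t + 2 * (L / R)) *\<^sub>R (ys - a)) - norm \<zeta>"
      unfolding \<zeta>'_def by (metis norm_minus_commute norm_triangle_ineq2)
    moreover have "norm ((M' / t + 2 * (L / R)) *\<^sub>R (ys - a)) = M' + 2 * (L / R) * t"
      using M M' t L R by (simp add: t_def[symmetric] distrib_right)
    moreover have "2 * (L / R) * t \<ge> 0" using L R t by simp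
    ultimately show ?thesis using \<zeta> by linarith
  qed
  ultimately show False using M' by (simp add: \<epsilon>_def field_simps)
qed

text \<open>
  The quadratic error term of the preceding lemma disappears under repeated bisection of the
  segment: each bisection halves it.
\<close>

theorem lipschitz_if_proximal_subgradients_bounded:
  fixes \<phi> :: "'a::{real_inner, complete_space} \<Rightarrow> real"
  assumes lip: "L-lipschitz_on D \<phi>" and R: "R > 0" and M: "M \<ge> 0"
    and "convex S" and nbhd: "\<And>a. a \<in> S \<Longrightarrow> cball a R \<subseteq> D"
    and prox: "\<And>y \<zeta> K e. e > 0 \<Longrightarrow> ball y e \<subseteq> D \<Longrightarrow>
      (\<And>y'. y' \<in> ball y e \<Longrightarrow> \<phi> y' \<ge> \<phi> y + inner \<zeta> (y' - y) - K * (norm (y' - y))\<^sup>2) \<Longrightarrow> norm \<zeta> \<le> M"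
    and "a \<in> S" "b \<in> S"
  shows "\<bar>\<phi> b - \<phi> a\<bar> \<le> M * norm (b - a)"
proof -
  have L: "L \<ge> 0" using lip by (rule lipschitz_on_nonneg)
  have SD: "S \<subseteq> D" using nbhd R by force
  have one_sided: "\<phi> b \<ge> \<phi> a - M * norm (b - a) - L / R * (norm (b - a))\<^sup>2" if "a \<in> S" "b \<in> S" for a b
  proof (cases "norm (b - a) \<le> R")
    case True
    show ?thesis
    proof (rule proximal_subgradient_decrease[OF _ R M _ True])
      show "L-lipschitz_on (cball a R) \<phi>" using lip nbhd[OF that(1)] by (rule lipschitz_on_subset)
    qed (use prox nbhd[OF that(1)] in blast)
  next
    case False
    have "L * R * norm (b - a) \<le> L * norm (b - a) * norm (b - a)"
      using False L by (simp add: mult.assoc mult_left_mono mult_right_mono)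
    then have "L * norm (b - a) \<le> L / R * (norm (b - a))\<^sup>2"
      using R by (simp add: field_simps power2_eq_square)
    moreover have "\<bar>\<phi> b - \<phi> a\<bar> \<le> L * norm (b - a)"
      using lipschitz_onD[OF lip, of b a] that SD by (auto simp: dist_norm)
    moreover have "M * norm (b - a) \<ge> 0" using M by simp
    ultimately show ?thesis by linarith
  qed
  have two_sided: "\<bar>\<phi> b - \<phi> a\<bar> \<le> M * norm (b - a) + L / R * (norm (b - a))\<^sup>2 * (1/2)^n"
    if "a \<in> S" "b \<in> S" for a b n
    using that
  proof (induction n arbitrary: a b)
    case 0
    then show ?case using one_sided[of a b] one_sided[of b a] by (simp add: norm_minus_commute abs_le_iff)
  next
    case (Suc n)
    define c where "c = midpoint a b"
    have "c \<in> S"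
      using \<open>convex S\<close> Suc.prems by (metis c_def closed_segment_subset midpoint_in_closed_segment subsetD)
    have half: "norm (c - a) = norm (b - a) / 2" "norm (b - c) = norm (b - a) / 2"
      unfolding c_def by (metis dist_midpoint(1) dist_norm norm_minus_commute)
        (metis dist_midpoint(4) dist_norm norm_minus_commute)
    have "\<bar>\<phi> b - \<phi> a\<bar> \<le> \<bar>\<phi> c - \<phi> a\<bar> + \<bar>\<phi> b - \<phi> c\<bar>" by linarith
    also have "\<dots> \<le> 2 * (M * (norm (b - a) / 2) + L / R * (norm (b - a) / 2)\<^sup>2 * (1/2)^n)"
      using Suc.IH[OF Suc.prems(1) \<open>c \<in> S\<close>] Suc.IH[OF \<open>c \<in> S\<close> Suc.prems(2)]
      unfolding half mult_2 by (rule add_mono)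
    also have "\<dots> = M * norm (b - a) + L / R * (norm (b - a))\<^sup>2 * (1/2)^Suc n"
      by (simp add: power_divide)
    finally show ?case .
  qed
  have "(\<lambda>n. M * norm (b - a) + L / R * (norm (b - a))\<^sup>2 * (1/2)^n)
      \<longlonglongrightarrow> M * norm (b - a) + L / R * (norm (b - a))\<^sup>2 * 0"
    by (intro tendsto_intros LIMSEQ_realpow_zero) auto
  then have "\<bar>\<phi> b - \<phi> a\<bar> \<le> M * norm (b - a) + L / R * (norm (b - a))\<^sup>2 * 0"
    by (rule LIMSEQ_le_const) (use two_sided[OF \<open>a \<in> S\<close> \<open>b \<in> S\<close>] in blast)
  then show ?thesis by simp
qed

section \<open>Subdifferentials, normals and monotonicity\<close>

text \<open>
  Every subgradient constructed below comes from a quadratic minorant, because the variational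
  principle perturbs by quadratics.
\<close>

lemma reg_subdiffI_proximal:
  fixes \<phi> :: "'a::real_inner \<Rightarrow> ereal"
  assumes fin: "\<bar>\<phi> x0\<bar> \<noteq> \<infinity>" and e: "e > 0"
    and prox: "\<And>x. x \<in> ball x0 e \<Longrightarrow> \<phi> x \<ge> \<phi> x0 + ereal (inner v (x - x0) - K * (norm (x - x0))\<^sup>2)"
  shows "v \<in> reg_subdiff \<phi> x0"
proof -
  obtain a where a: "\<phi> x0 = ereal a" using fin by (cases "\<phi> x0") auto
  have quot: "ereal (- \<bar>K\<bar> * norm (x - x0))
      \<le> (\<phi> x - \<phi> x0 - ereal (inner v (x - x0))) / ereal (norm (x - x0))"
    if "x \<in> ball x0 e" "x \<noteq> x0" for x
  proof (cases "\<phi> x")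
    case (real b)
    have n: "norm (x - x0) > 0" using that by simp
    have "b \<ge> a + (inner v (x - x0) - K * (norm (x - x0))\<^sup>2)"
      using prox[OF that(1)] by (simp add: a real)
    moreover have "K * (norm (x - x0))\<^sup>2 \<le> \<bar>K\<bar> * (norm (x - x0))\<^sup>2" by (intro mult_right_mono) auto
    ultimately have "- \<bar>K\<bar> * norm (x - x0) * norm (x - x0) \<le> b - a - inner v (x - x0)"
      by (simp add: power2_eq_square)
    then have "- \<bar>K\<bar> * norm (x - x0) \<le> (b - a - inner v (x - x0)) / norm (x - x0)"
      using n by (simp only: pos_le_divide_eq)
    then show ?thesis using n by (simp add: a real)
  next
    case PInf
    then show ?thesis using that by (simp add: a)
  next
    case MInf
    then show ?thesis using prox[OF that(1)] by (simp add: a)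
  qed
  have "\<forall>\<^sub>F x in at x0. y < (\<phi> x - \<phi> x0 - ereal (inner v (x - x0))) / ereal (norm (x - x0))"
    if "y < 0" for y :: ereal
  proof -
    have "((\<lambda>x. ereal (- \<bar>K\<bar> * norm (x - x0))) \<longlongrightarrow> ereal (- \<bar>K\<bar> * norm (x0 - x0))) (at x0)"
      by (intro tendsto_intros)
    then have "\<forall>\<^sub>F x in at x0. y < ereal (- \<bar>K\<bar> * norm (x - x0))"
      using that by (intro order_tendstoD(1)) (auto simp: zero_ereal_def)
    moreover have "\<forall>\<^sub>F x in at x0. x \<in> ball x0 e \<and> x \<noteq> x0"
      using e by (auto simp: eventually_at dist_commute intro!: exI[of _ e])
    ultimately show ?thesis
      by eventually_elim (use quot less_le_trans in blast)
  qed
  then show ?thesis using fin unfolding reg_subdiff_def le_Liminf_iff by simp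
qed

lemma reg_subdiff_subset_lim_subdiff: "reg_subdiff \<phi> x \<subseteq> lim_subdiff \<phi> x"
proof
  fix v assume v: "v \<in> reg_subdiff \<phi> x"
  then have "\<bar>\<phi> x\<bar> \<noteq> \<infinity>" by (simp add: reg_subdiff_def)
  moreover have "\<exists>xs vs. xs \<longlonglongrightarrow> x \<and> (\<lambda>k. \<phi> (xs k)) \<longlonglongrightarrow> \<phi> x \<and>
      (\<forall>k. vs k \<in> reg_subdiff \<phi> (xs k)) \<and> weakly_tendsto vs v"
    by (rule exI[of _ "\<lambda>_. x"], rule exI[of _ "\<lambda>_. v"]) (simp add: v weakly_tendsto_def)
  ultimately show "v \<in> lim_subdiff \<phi> x" by (simp add: lim_subdiff_def)
qed

lemma lim_subdiff_finite: "v \<in> lim_subdiff \<phi> x \<Longrightarrow> \<bar>\<phi> x\<bar> \<noteq> \<infinity>"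
  by (simp add: lim_subdiff_def)

lemma reg_normal_iff:
  "\<zeta> \<in> reg_normal \<Omega> z0 \<longleftrightarrow> z0 \<in> \<Omega> \<and>
    (\<forall>\<epsilon>>0. \<exists>\<delta>>0. \<forall>z\<in>\<Omega>. norm (z - z0) < \<delta> \<longrightarrow> inner \<zeta> (z - z0) \<le> \<epsilon> * norm (z - z0))"
  (is "_ \<longleftrightarrow> _ \<and> ?R")
proof -
  let ?q = "\<lambda>z. inner \<zeta> (z - z0) / norm (z - z0)"
  have "Limsup (at z0 within \<Omega>) (\<lambda>z. ereal (?q z)) \<le> 0 \<longleftrightarrow> ?R"
  proof
    assume *: "Limsup (at z0 within \<Omega>) (\<lambda>z. ereal (?q z)) \<le> 0"
    show ?R
    proof (intro allI impI)
      fix \<epsilon> :: real assume "\<epsilon> > 0"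
      then have "\<forall>\<^sub>F z in at z0 within \<Omega>. ereal (?q z) < ereal \<epsilon>"
        using *[unfolded Limsup_le_iff, rule_format, of "ereal \<epsilon>"] by simp
      then obtain d where d: "d > 0" "\<And>z. z \<in> \<Omega> \<Longrightarrow> z \<noteq> z0 \<Longrightarrow> dist z z0 < d \<Longrightarrow> ?q z < \<epsilon>"
        by (auto simp: eventually_at)
      have "inner \<zeta> (z - z0) \<le> \<epsilon> * norm (z - z0)" if "z \<in> \<Omega>" "norm (z - z0) < d" for z
        using d(2)[of z] that by (cases "z = z0") (auto simp: dist_norm pos_divide_less_eq less_imp_le)
      then show "\<exists>\<delta>>0. \<forall>z\<in>\<Omega>. norm (z - z0) < \<delta> \<longrightarrow> inner \<zeta> (z - z0) \<le> \<epsilon> * norm (z - z0)"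
        using d(1) by blast
    qed
  next
    assume R: ?R
    show "Limsup (at z0 within \<Omega>) (\<lambda>z. ereal (?q z)) \<le> 0"
      unfolding Limsup_le_iff
    proof (intro allI impI)
      fix y :: ereal assume "y > 0"
      then obtain \<epsilon> where \<epsilon>: "\<epsilon> > 0" "ereal \<epsilon> < y" by (metis ereal_dense2 ereal_less(2))
      obtain \<delta> where \<delta>: "\<delta> > 0" "\<And>z. z \<in> \<Omega> \<Longrightarrow> norm (z - z0) < \<delta> \<Longrightarrow> inner \<zeta> (z - z0) \<le> \<epsilon> * norm (z - z0)"
        using R \<epsilon>(1) by blast
      have "ereal (?q z) < y" if "z \<in> \<Omega>" "z \<noteq> z0" "dist z z0 < \<delta>" for z
      proof -
        have "?q z \<le> \<epsilon>" using \<delta>(2)[of z] that by (simp add: dist_norm pos_divide_le_eq)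
        then show ?thesis using \<epsilon>(2) by (meson ereal_less_eq(3) le_less_trans)
      qed
      then show "\<forall>\<^sub>F z in at z0 within \<Omega>. ereal (?q z) < y"
        using \<delta>(1) by (auto simp: eventually_at)
    qed
  qed
  then show ?thesis by (simp add: reg_normal_def)
qed

lemma lsc_slice:
  fixes g :: "'a::topological_space \<times> 'b::topological_space \<Rightarrow> ereal"
  assumes "lsc g"
  shows "lsc (\<lambda>x. g (x, p))"
  unfolding lsc_def le_Liminf_iff
proof (intro allI impI)
  fix x y assume "y < g (x, p)"
  then have "\<forall>\<^sub>F z in nhds (x, p). y < g z"
    using assms unfolding lsc_def le_Liminf_iff by blast
  moreover have "filterlim (\<lambda>x. (x, p)) (nhds (x, p)) (nhds x)"
    by (intro tendsto_Pair tendsto_const) (rule filterlim_ident)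
  ultimately show "\<forall>\<^sub>F x in nhds x. y < g (x, p)" by (rule eventually_compose_filterlim)
qed

lemma closed_sublevel_lsc_plus_continuous:
  fixes \<phi> :: "'a::metric_space \<Rightarrow> ereal"
  assumes "lsc \<phi>" and c: "continuous_on UNIV c"
  shows "closed {x. \<phi> x \<le> ereal (\<alpha> - c x)}"
  unfolding closed_sequential_limits
proof (intro allI impI)
  fix s l assume *: "(\<forall>n. s n \<in> {x. \<phi> x \<le> ereal (\<alpha> - c x)}) \<and> s \<longlonglongrightarrow> l"
  have cl: "(\<lambda>n. c (s n)) \<longlonglongrightarrow> c l"
    using * by (intro continuous_on_tendsto_compose[OF c]) auto
  have "\<phi> l \<le> ereal (\<alpha> - c l)"
  proof (rule ccontr)
    assume "\<not> ?thesis"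
    then obtain b where b: "\<alpha> - c l < b" "ereal b < \<phi> l"
      using ereal_dense2[of "ereal (\<alpha> - c l)" "\<phi> l"] by (auto simp: not_le)
    have "\<forall>\<^sub>F x in nhds l. ereal b < \<phi> x"
      using assms(1) b(2) unfolding lsc_def le_Liminf_iff by blast
    then have "\<forall>\<^sub>F n in sequentially. ereal b < \<phi> (s n)"
      using * by (auto intro: eventually_compose_filterlim)
    moreover have "\<forall>\<^sub>F n in sequentially. \<alpha> - c (s n) < b"
      using b(1) by (intro order_tendstoD(2)[of _ "\<alpha> - c l"] tendsto_intros cl)
    ultimately have "\<forall>\<^sub>F n in sequentially. False"
    proof eventually_elim
      case (elim n)
      have "\<phi> (s n) \<le> ereal (\<alpha> - c (s n))" using * by auto
      also have "\<dots> < ereal b" using elim(2) by simp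
      finally show False using elim(1) by simp
    qed
    then show False by simp
  qed
  then show "l \<in> {x. \<phi> x \<le> ereal (\<alpha> - c x)}" by simp
qed

text \<open>
  The bridge between strong monotonicity and nonexpansiveness: with \<open>D\<close> a difference of solutions
  and \<open>d\<close> the difference of the right-hand sides, the left side is the estimate in the definition
  of full stability (for equal parameters) and the right side is strong monotonicity.
\<close>

lemma norm_diff_scaleR_le_iff:
  fixes d D :: "'a::real_inner"
  assumes "c > 0"
  shows "norm (d - c *\<^sub>R D) \<le> norm d \<longleftrightarrow> c * (norm D)\<^sup>2 \<le> 2 * inner D d"
proof -
  have "norm (d - c *\<^sub>R D) \<le> norm d \<longleftrightarrow> (norm (d - c *\<^sub>R D))\<^sup>2 \<le> (norm d)\<^sup>2"
    by (simp add: power_mono_iff)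
  also have "(norm (d - c *\<^sub>R D))\<^sup>2 = (norm d)\<^sup>2 + c * (c * (norm D)\<^sup>2 - 2 * inner D d)"
    by (simp add: power2_norm_eq_inner algebra_simps inner_commute)
  also have "\<dots> \<le> (norm d)\<^sup>2 \<longleftrightarrow> c * (norm D)\<^sup>2 \<le> 2 * inner D d"
    using assms by (simp add: mult_le_0_iff)
  finally show ?thesis .
qed

text \<open>
  Add the two prox-regularity inequalities for the pairs \<open>(u1, u2)\<close> and \<open>(u2, u1)\<close>; the function
  values cancel because they are finite wherever there is a subgradient.
\<close>

lemma subgradients_hypomonotone:
  fixes \<phi> :: "'a::real_inner \<Rightarrow> ereal"
  assumes prox: "\<And>u v x. u \<in> U \<Longrightarrow> v \<in> V \<Longrightarrow> v \<in> lim_subdiff \<phi> u \<Longrightarrow> x \<in> U \<Longrightarrow>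
      \<phi> x \<ge> \<phi> u + ereal (inner v (x - u) - r / 2 * (norm (x - u))\<^sup>2)"
    and u1: "u1 \<in> U" "v1 \<in> V" "v1 \<in> lim_subdiff \<phi> u1" and u2: "u2 \<in> U" "v2 \<in> V" "v2 \<in> lim_subdiff \<phi> u2"
  shows "- r * (norm (u1 - u2))\<^sup>2 \<le> inner (v1 - v2) (u1 - u2)"
proof -
  obtain a1 a2 where a: "\<phi> u1 = ereal a1" "\<phi> u2 = ereal a2"
    using lim_subdiff_finite[OF u1(3)] lim_subdiff_finite[OF u2(3)] by (cases "\<phi> u1"; cases "\<phi> u2") auto
  have "a2 \<ge> a1 + (inner v1 (u2 - u1) - r / 2 * (norm (u2 - u1))\<^sup>2)"
    using prox[OF u1 u2(1)] by (simp add: a)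
  moreover have "a1 \<ge> a2 + (inner v2 (u1 - u2) - r / 2 * (norm (u1 - u2))\<^sup>2)"
    using prox[OF u2 u1(1)] by (simp add: a)
  ultimately show ?thesis by (simp add: norm_minus_commute[of u2] algebra_simps)
qed

section \<open>Local solvability\<close>

text \<open>
  The solution \<open>x\<close> minimizes \<open>H = \<phi> + \<sigma> / 2 (norm (x - x0))\<^sup>2 - inner (v0 + d) (x - x0)\<close>, where \<open>d\<close> is the
  displacement of \<open>y\<close> from \<open>v0 + \<sigma> x0\<close>. Prox-regularity at \<open>(x0, v0)\<close> gives \<open>H\<close> quadratic growth,
  which keeps its sublevel set at \<open>x0\<close> away from the boundary of the ball. Prox-regularity is
  used a second time for the existence of the minimizer: approximate minimizers from the variational
  principle carry subgradients of \<open>\<phi>\<close>, and hypomonotonicity of these makes them a Cauchy sequence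
  as the perturbation tends to zero.
\<close>

theorem local_resolvent_onto:
  fixes \<phi> :: "'a::{real_inner, complete_space} \<Rightarrow> ereal"
  assumes lsc: "lsc \<phi>" and proper: "\<And>x. \<phi> x \<noteq> - \<infinity>"
    and v0: "v0 \<in> lim_subdiff \<phi> x0"
    and prox: "\<And>u v x. u \<in> cball x0 \<delta> \<Longrightarrow> v \<in> cball v0 \<delta> \<Longrightarrow> v \<in> lim_subdiff \<phi> u \<Longrightarrow> x \<in> cball x0 \<delta> \<Longrightarrow>
      \<phi> x \<ge> \<phi> u + ereal (inner v (x - u) - r / 2 * (norm (x - u))\<^sup>2)"
    and r: "r \<ge> 0" and \<sigma>: "r + 1 \<le> \<sigma>" and \<beta>: "\<beta> > 0" "(2 + 2 * \<sigma>) * \<beta> < \<delta>"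
    and y: "y \<in> cball (v0 + \<sigma> *\<^sub>R x0) \<beta>"
  obtains x where "x \<in> ball x0 \<delta>" "y - \<sigma> *\<^sub>R x \<in> ball v0 \<delta>" "y - \<sigma> *\<^sub>R x \<in> lim_subdiff \<phi> x"
proof -
  have \<beta>\<delta>: "2 * \<beta> < \<delta>" "\<beta> + \<sigma> * (2 * \<beta>) + \<beta> < \<delta>" "\<delta> > 0"
  proof -
    have "0 \<le> 2 * \<sigma> * \<beta>" using r \<sigma> \<beta> by simp
    then show "2 * \<beta> < \<delta>" "\<beta> + \<sigma> * (2 * \<beta>) + \<beta> < \<delta>" "\<delta> > 0"
      using \<beta> by (auto simp: algebra_simps)
  qed
  define d where "d = y - \<sigma> *\<^sub>R x0 - v0"
  have d: "norm d \<le> \<beta>"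
    using y by (simp add: d_def dist_norm norm_minus_commute diff_diff_eq add.commute)
  define c where "c x = \<sigma> / 2 * (norm (x - x0))\<^sup>2 - inner (v0 + d) (x - x0)" for x
  \<comment> \<open>On \<open>D\<close> the function is real-valued; outside \<open>D\<close> every inequality for \<open>\<phi>\<close> from below is trivial.\<close>
  define D where "D = {x \<in> cball x0 \<delta>. \<phi> x < \<infinity>}"
  define H where "H x = real_of_ereal (\<phi> x) + c x" for x
  have real: "\<phi> x = ereal (real_of_ereal (\<phi> x))" if "x \<in> D" for x
    using that proper[of x] by (cases "\<phi> x") (auto simp: D_def)
  have x0D: "x0 \<in> D" using lim_subdiff_finite[OF v0] \<beta>\<delta> by (cases "\<phi> x0") (auto simp: D_def)
  have Hx0: "H x0 = real_of_ereal (\<phi> x0)" by (simp add: H_def c_def)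
  have growth: "H x0 + norm (x - x0) * (norm (x - x0) / 2 - \<beta>) \<le> H x" if "x \<in> D" for x
  proof -
    have "\<phi> x \<ge> \<phi> x0 + ereal (inner v0 (x - x0) - r / 2 * (norm (x - x0))\<^sup>2)"
      using that \<beta>\<delta> v0 by (intro prox) (auto simp: D_def)
    then have "real_of_ereal (\<phi> x) \<ge> real_of_ereal (\<phi> x0) + (inner v0 (x - x0) - r / 2 * (norm (x - x0))\<^sup>2)"
      using real[OF that] real[OF x0D] by (metis ereal_less_eq(3) plus_ereal.simps(1))
    moreover have "(r + 1) / 2 * (norm (x - x0))\<^sup>2 \<le> \<sigma> / 2 * (norm (x - x0))\<^sup>2"
      using \<sigma> by (intro mult_right_mono) auto
    moreover have "inner d (x - x0) \<le> \<beta> * norm (x - x0)"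
      using norm_cauchy_schwarz[of d "x - x0"] mult_right_mono[OF d norm_ge_zero[of "x - x0"]] by linarith
    ultimately show ?thesis
      unfolding H_def[of x] Hx0 c_def by (simp add: inner_add_left algebra_simps power2_eq_square)
  qed
  have near: "norm (x - x0) \<le> 2 * \<beta>" if "x \<in> D" "H x \<le> H x0" for x
  proof -
    have "norm (x - x0) * (norm (x - x0) / 2 - \<beta>) \<le> 0" using growth[OF that(1)] that(2) by linarith
    then show ?thesis using \<beta> by (auto simp: mult_le_0_iff)
  qed
  have closed: "closed {x \<in> D. H x \<le> \<alpha>}" for \<alpha>
  proof -
    have "{x \<in> D. H x \<le> \<alpha>} = cball x0 \<delta> \<inter> {x. \<phi> x \<le> ereal (\<alpha> - c x)}"
    proof (intro equalityI subsetI)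
      fix x assume x: "x \<in> {x \<in> D. H x \<le> \<alpha>}"
      then have "\<phi> x = ereal (real_of_ereal (\<phi> x))" using real by blast
      moreover have "real_of_ereal (\<phi> x) \<le> \<alpha> - c x" using x by (simp add: H_def)
      ultimately have "\<phi> x \<le> ereal (\<alpha> - c x)" by (metis ereal_less_eq(3))
      then show "x \<in> cball x0 \<delta> \<inter> {x. \<phi> x \<le> ereal (\<alpha> - c x)}" using x by (simp add: D_def)
    next
      fix x assume x: "x \<in> cball x0 \<delta> \<inter> {x. \<phi> x \<le> ereal (\<alpha> - c x)}"
      then show "x \<in> {x \<in> D. H x \<le> \<alpha>}" using proper[of x] by (cases "\<phi> x") (auto simp: D_def H_def)
    qed
    moreover have "continuous_on UNIV c" unfolding c_def by (intro continuous_intros) auto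
    ultimately show ?thesis using closed_sublevel_lsc_plus_continuous[OF lsc] by (simp add: closed_Int)
  qed
  have bdd: "H x0 - \<beta> * \<delta> \<le> H x" if "x \<in> D" for x
  proof -
    have "norm (x - x0) \<le> \<delta>" using that by (simp add: D_def dist_norm norm_minus_commute)
    then have "norm (x - x0) * \<beta> \<le> \<beta> * \<delta>" using \<beta> by (simp add: mult.commute)
    moreover have "0 \<le> norm (x - x0) * (norm (x - x0) / 2)" by simp
    ultimately show ?thesis using growth[OF that] unfolding right_diff_distrib by linarith
  qed
  have bounded: "bounded D" unfolding D_def by (rule bounded_subset[OF bounded_cball]) auto
  \<comment> \<open>Expanding the quadratic part of \<open>H\<close> around \<open>x\<close> turns approximate minimality into a proximal
    subgradient inequality for \<open>\<phi>\<close>.\<close>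
  have stationary: "v0 + d - \<sigma> *\<^sub>R (x - x0) + \<zeta> \<in> lim_subdiff \<phi> x"
    if xD: "x \<in> D" and xH: "H x \<le> H x0"
      and min: "\<And>x'. x' \<in> D \<Longrightarrow> H x' \<ge> H x + inner \<zeta> (x' - x) - \<epsilon> * (norm (x' - x))\<^sup>2" for x \<zeta> \<epsilon>
  proof -
    have "v0 + d - \<sigma> *\<^sub>R (x - x0) + \<zeta> \<in> reg_subdiff \<phi> x"
    proof (rule reg_subdiffI_proximal)
      show "\<bar>\<phi> x\<bar> \<noteq> \<infinity>" using real[OF xD] by (cases "\<phi> x") auto
      show "\<delta> - 2 * \<beta> > 0" using \<beta>\<delta> by simp
      fix x' assume "x' \<in> ball x (\<delta> - 2 * \<beta>)"
      then have x': "x' \<in> cball x0 \<delta>"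
        using near[OF xD xH] dist_triangle[of x0 x' x] by (simp add: dist_norm norm_minus_commute)
      show "\<phi> x' \<ge> \<phi> x + ereal (inner (v0 + d - \<sigma> *\<^sub>R (x - x0) + \<zeta>) (x' - x)
          - (\<epsilon> + \<sigma> / 2) * (norm (x' - x))\<^sup>2)"
      proof (cases "\<phi> x' = \<infinity>")
        case False
        then have x'D: "x' \<in> D" using x' by (simp add: D_def)
        have "c x' = c x + \<sigma> * inner (x - x0) (x' - x) + \<sigma> / 2 * (norm (x' - x))\<^sup>2 - inner (v0 + d) (x' - x)"
        proof -
          have "(norm (x' - x0))\<^sup>2 = (norm (x - x0))\<^sup>2 + 2 * inner (x - x0) (x' - x) + (norm (x' - x))\<^sup>2"
            by (simp add: power2_norm_eq_inner algebra_simps inner_commute)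
          then have "\<sigma> / 2 * (norm (x' - x0))\<^sup>2
              = \<sigma> / 2 * (norm (x - x0))\<^sup>2 + \<sigma> * inner (x - x0) (x' - x) + \<sigma> / 2 * (norm (x' - x))\<^sup>2"
            by (simp add: distrib_left)
          moreover have "inner (v0 + d) (x' - x0) = inner (v0 + d) (x - x0) + inner (v0 + d) (x' - x)"
            by (simp add: inner_diff_right)
          ultimately show ?thesis by (simp add: c_def)
        qed
        moreover have "inner (v0 + d - \<sigma> *\<^sub>R (x - x0) + \<zeta>) (x' - x)
            = inner (v0 + d) (x' - x) - \<sigma> * inner (x - x0) (x' - x) + inner \<zeta> (x' - x)"
          by (simp only: inner_add_left inner_diff_left inner_scaleR_left)
        moreover have "(\<epsilon> + \<sigma> / 2) * (norm (x' - x))\<^sup>2 = \<epsilon> * (norm (x' - x))\<^sup>2 + \<sigma> / 2 * (norm (x' - x))\<^sup>2"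
          by (rule distrib_right)
        ultimately have "real_of_ereal (\<phi> x') \<ge> real_of_ereal (\<phi> x)
            + (inner (v0 + d - \<sigma> *\<^sub>R (x - x0) + \<zeta>) (x' - x) - (\<epsilon> + \<sigma> / 2) * (norm (x' - x))\<^sup>2)"
          using min[OF x'D] unfolding H_def by linarith
        then show ?thesis
          using real[OF xD] real[OF x'D] by (metis ereal_less_eq(3) plus_ereal.simps(1))
      qed simp
    qed
    then show ?thesis using reg_subdiff_subset_lim_subdiff by blast
  qed
  have value_near: "v0 + d - \<sigma> *\<^sub>R (x - x0) + \<zeta> \<in> ball v0 \<delta>"
    if "x \<in> D" "H x \<le> H x0" "norm \<zeta> \<le> \<beta>" for x \<zeta>
  proof -
    have "norm (v0 + d - \<sigma> *\<^sub>R (x - x0) + \<zeta> - v0) = norm (d - \<sigma> *\<^sub>R (x - x0) + \<zeta>)"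
      by (simp add: algebra_simps)
    also have "\<dots> \<le> norm d + norm (\<sigma> *\<^sub>R (x - x0)) + norm \<zeta>"
      by (meson add_right_mono norm_triangle_ineq norm_triangle_ineq4 order_trans)
    also have "\<dots> \<le> \<beta> + \<sigma> * (2 * \<beta>) + \<beta>"
      using d near[OF that(1,2)] that(3) r \<sigma> by (intro add_mono) (auto intro: mult_left_mono)
    finally show ?thesis using \<beta>\<delta> unfolding mem_ball dist_norm norm_minus_commute[of v0 "v0 + d - _ + _"] by linarith
  qed
  define \<epsilon> where "\<epsilon> n = \<beta> * inverse (real (Suc n))" for n
  have \<epsilon>: "0 < \<epsilon> n" "\<epsilon> n \<le> \<beta>" for n
    using \<beta> by (auto simp: \<epsilon>_def field_simps)
  have \<epsilon>_lim: "\<epsilon> \<longlonglongrightarrow> 0"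
    unfolding \<epsilon>_def using tendsto_mult_left[OF LIMSEQ_inverse_real_of_nat, of \<beta>] by simp
  have "\<exists>x \<zeta>. x \<in> D \<and> H x \<le> H x0 \<and> norm \<zeta> \<le> \<epsilon> n \<and>
      (\<forall>x'\<in>D. H x' \<ge> H x + inner \<zeta> (x' - x) - \<epsilon> n * (norm (x' - x))\<^sup>2)" for n
    using smooth_variational_principle[OF closed bdd bounded x0D \<epsilon>(1)] by metis
  then obtain X Z where XD: "\<And>n. X n \<in> D" and XH: "\<And>n. H (X n) \<le> H x0" and Z: "\<And>n. norm (Z n) \<le> \<epsilon> n"
    and Xmin: "\<And>n x'. x' \<in> D \<Longrightarrow> H x' \<ge> H (X n) + inner (Z n) (x' - X n) - \<epsilon> n * (norm (x' - X n))\<^sup>2"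
    by metis
  \<comment> \<open>The subgradients at \<open>X n\<close> and \<open>X m\<close> differ by \<open>Z n - Z m\<close> minus \<open>\<sigma>\<close> times \<open>X n - X m\<close>, and
    \<open>\<sigma>\<close> exceeds the hypomonotonicity constant by at least one.\<close>
  have gap: "norm (X n - X m) \<le> \<epsilon> n + \<epsilon> m" for n m
  proof -
    let ?V = "\<lambda>n. v0 + d - \<sigma> *\<^sub>R (X n - x0) + Z n"
    have V: "?V n \<in> lim_subdiff \<phi> (X n)" "?V n \<in> cball v0 \<delta>" "X n \<in> cball x0 \<delta>" for n
      using stationary[OF XD XH Xmin] 
        subsetD[OF ball_subset_cball value_near[OF XD XH order_trans[OF Z \<epsilon>(2)]]] XD[of n]
      by (auto simp: D_def)
    have "- r * (norm (X n - X m))\<^sup>2 \<le> inner (?V n - ?V m) (X n - X m)"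
      using subgradients_hypomonotone[of "cball x0 \<delta>" "cball v0 \<delta>" \<phi> r, OF prox] V by blast
    also have "?V n - ?V m = (Z n - Z m) - \<sigma> *\<^sub>R (X n - X m)" by (simp add: algebra_simps)
    also have "inner \<dots> (X n - X m) = inner (Z n - Z m) (X n - X m) - \<sigma> * (norm (X n - X m))\<^sup>2"
      by (simp add: inner_diff_left power2_norm_eq_inner)
    finally have "(\<sigma> - r) * (norm (X n - X m))\<^sup>2 \<le> inner (Z n - Z m) (X n - X m)"
      by (simp add: algebra_simps)
    moreover have "1 * (norm (X n - X m))\<^sup>2 \<le> (\<sigma> - r) * (norm (X n - X m))\<^sup>2"
      using \<sigma> by (intro mult_right_mono) auto
    moreover have "inner (Z n - Z m) (X n - X m) \<le> norm (Z n - Z m) * norm (X n - X m)"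
      by (rule norm_cauchy_schwarz)
    ultimately have "norm (X n - X m) * norm (X n - X m) \<le> norm (Z n - Z m) * norm (X n - X m)"
      by (simp add: power2_eq_square)
    then have "norm (X n - X m) \<le> norm (Z n - Z m)"
      by (cases "X n = X m") auto
    also have "\<dots> \<le> \<epsilon> n + \<epsilon> m" using norm_triangle_ineq4[of "Z n" "Z m"] Z[of n] Z[of m] by linarith
    finally show ?thesis .
  qed
  have "Cauchy X"
  proof (rule metric_CauchyI)
    fix e :: real assume "e > 0"
    then obtain M where M: "\<And>n. n \<ge> M \<Longrightarrow> \<epsilon> n < e / 2"
      using order_tendstoD(2)[OF \<epsilon>_lim, of "e / 2"] by (auto simp: eventually_sequentially)
    have "dist (X m) (X n) < e" if "m \<ge> M" "n \<ge> M" for m n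
      using gap[of m n] M[OF that(1)] M[OF that(2)] by (simp add: dist_norm)
    then show "\<exists>M. \<forall>m\<ge>M. \<forall>n\<ge>M. dist (X m) (X n) < e" by blast
  qed
  then obtain xs where lim: "X \<longlonglongrightarrow> xs" using Cauchy_convergent convergent_def by blast
  have xs_le: "xs \<in> {x \<in> D. H x \<le> H x0}"
    using closed_sequentially[OF closed _ lim] XD XH by blast
  have xs_min: "H xs \<le> H x" if "x \<in> D" for x
  proof (rule field_le_epsilon)
    fix e :: real assume "e > 0"
    have "\<forall>\<^sub>F n in sequentially. \<epsilon> n * (2 * \<delta> + (2 * \<delta>)\<^sup>2) < e"
      using \<open>e > 0\<close> tendsto_mult_right[OF \<epsilon>_lim, of "2 * \<delta> + (2 * \<delta>)\<^sup>2"] by (intro order_tendstoD) auto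
    then have "\<forall>\<^sub>F n in sequentially. X n \<in> {z \<in> D. H z \<le> H x + e}"
    proof eventually_elim
      case (elim n)
      have n: "norm (x - X n) \<le> 2 * \<delta>"
        using that XD[of n] dist_triangle[of x "X n" x0] by (auto simp: D_def dist_norm norm_minus_commute)
      have "- inner (Z n) (x - X n) \<le> norm (Z n) * norm (x - X n)"
        using norm_cauchy_schwarz[of "- Z n" "x - X n"] by simp
      also have "\<dots> \<le> \<epsilon> n * (2 * \<delta>)" using n Z[of n] \<epsilon>[of n] by (intro mult_mono) auto
      finally have "- inner (Z n) (x - X n) \<le> \<epsilon> n * (2 * \<delta>)" .
      moreover have "\<epsilon> n * (norm (x - X n))\<^sup>2 \<le> \<epsilon> n * (2 * \<delta>)\<^sup>2"
        using n \<epsilon>(1)[of n] by (intro mult_left_mono power_mono) auto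
      ultimately show ?case using Xmin[OF that, of n] elim XD[of n] by (simp add: distrib_left)
    qed
    then have "xs \<in> {z \<in> D. H z \<le> H x + e}"
      using Lim_in_closed_set[OF closed _ _ lim] by simp
    then show "H xs \<le> H x + e" by simp
  qed
  have "v0 + d - \<sigma> *\<^sub>R (xs - x0) + 0 \<in> lim_subdiff \<phi> xs"
    using stationary[of xs 0 0] xs_le xs_min by simp
  moreover have "v0 + d - \<sigma> *\<^sub>R (xs - x0) + 0 = y - \<sigma> *\<^sub>R xs" by (simp add: d_def algebra_simps)
  moreover have "v0 + d - \<sigma> *\<^sub>R (xs - x0) + 0 \<in> ball v0 \<delta>"
    using value_near[of xs 0] xs_le \<beta> by simp
  moreover have "xs \<in> ball x0 \<delta>" using near[of xs] xs_le \<beta>\<delta> by (simp add: dist_norm norm_minus_commute)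
  ultimately show thesis using that[of xs] by simp
qed

text \<open>
  Read \<open>(x, y) \<in> G\<close> as \<open>x\<close> being the solution for the right-hand side \<open>y\<close>. Solving the equation
  perturbed by \<open>h\<close> means finding a fixed point of \<open>x \<mapsto> G\<^sup>-\<^sup>1(y - h x)\<close>, which is a contraction of a
  small ball around \<open>x0\<close> as soon as \<open>C * q < 1\<close>. The radii appear explicitly because they have to be the
  same for all parameters.
\<close>

lemma perturbed_equation_solvable:
  fixes G :: "('a::complete_space \<times> 'b::real_normed_vector) set" and h :: "'a \<Rightarrow> 'b"
  assumes inv_lip: "\<And>x1 y1 x2 y2. (x1, y1) \<in> G \<Longrightarrow> (x2, y2) \<in> G \<Longrightarrow> dist x1 x2 \<le> C * norm (y1 - y2)"
    and onto: "\<And>y. y \<in> cball y0 \<rho> \<Longrightarrow> \<exists>x. (x, y) \<in> G"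
    and base: "(x0, y0) \<in> G"
    and h: "\<And>x x'. x \<in> cball x0 t \<Longrightarrow> x' \<in> cball x0 t \<Longrightarrow> norm (h x - h x') \<le> q * dist x x'"
    and C: "0 \<le> C" and q: "0 \<le> q" "C * q < 1" and t: "0 \<le> t"
    and \<beta>: "C * \<beta> \<le> (1 - C * q) * t" "\<beta> + q * t \<le> \<rho>"
    and y: "y \<in> cball (y0 + h x0) \<beta>"
  obtains x where "x \<in> cball x0 t" "(x, y - h x) \<in> G"
proof -
  define \<Phi> where "\<Phi> x = (SOME x'. (x', y - h x) \<in> G)" for x
  have dist_y: "norm (y - h x - y0) \<le> \<beta> + q * dist x x0" if "x \<in> cball x0 t" for x
  proof -
    have "norm (y - h x - y0) \<le> norm (y - (y0 + h x0)) + norm (h x0 - h x)"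
      using norm_triangle_ineq[of "y - (y0 + h x0)" "h x0 - h x"] by (simp add: algebra_simps)
    moreover have "norm (h x0 - h x) \<le> q * dist x x0" using h[of x0 x] that t by (simp add: dist_commute)
    ultimately show ?thesis using y by (simp add: dist_norm norm_minus_commute)
  qed
  have qt: "q * dist x x0 \<le> q * t" if "x \<in> cball x0 t" for x
    using that q by (intro mult_left_mono) (auto simp: dist_commute)
  have \<Phi>: "(\<Phi> x, y - h x) \<in> G" if "x \<in> cball x0 t" for x
  proof -
    have "y - h x \<in> cball y0 \<rho>"
      using dist_y[OF that] qt[OF that] \<beta>(2) by (simp add: dist_norm norm_minus_commute)
    then show ?thesis unfolding \<Phi>_def using someI_ex[OF onto] by blast
  qed
  have "\<exists>!x\<in>cball x0 t. \<Phi> x = x"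
  proof (rule Banach_fix)
    show "complete (cball x0 t)" by (intro complete_eq_closed[THEN iffD2]) auto
    show "cball x0 t \<noteq> {}" using t by auto
    show "0 \<le> C * q" "C * q < 1" using C q by auto
    show "\<Phi> ` cball x0 t \<subseteq> cball x0 t"
    proof
      fix z assume "z \<in> \<Phi> ` cball x0 t"
      then obtain x where x: "x \<in> cball x0 t" "z = \<Phi> x" by blast
      have "dist (\<Phi> x) x0 \<le> C * norm (y - h x - y0)" by (rule inv_lip[OF \<Phi>[OF x(1)] base])
      also have "\<dots> \<le> C * (\<beta> + q * t)"
        using dist_y[OF x(1)] qt[OF x(1)] C by (intro mult_left_mono) auto
      also have "\<dots> \<le> t" using \<beta>(1) by (simp add: algebra_simps)
      finally show "z \<in> cball x0 t" by (simp add: x dist_commute)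
    qed
    show "dist (\<Phi> x) (\<Phi> x') \<le> C * q * dist x x'" if "x \<in> cball x0 t" "x' \<in> cball x0 t" for x x'
    proof -
      have "dist (\<Phi> x) (\<Phi> x') \<le> C * norm (y - h x - (y - h x'))"
        by (rule inv_lip[OF \<Phi>[OF that(1)] \<Phi>[OF that(2)]])
      also have "\<dots> \<le> C * (q * dist x x')"
        using h[OF that] C by (intro mult_left_mono) (auto simp: norm_minus_commute)
      finally show ?thesis by (simp add: mult.assoc)
    qed
  qed
  then show thesis using that \<Phi> by metis
qed

section \<open>From the coderivative to strong monotonicity\<close>

lemma norm_le_if_coercive:
  fixes d D :: "'a::real_inner"
  assumes "c > 0" and "c * (norm D)\<^sup>2 \<le> inner D d"
  shows "norm D \<le> 1 / c * norm d"
proof (cases "D = 0")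
  case False
  have "norm D * (c * norm D) \<le> norm D * norm d"
    using assms(2) norm_cauchy_schwarz[of D d] by (simp add: power2_eq_square algebra_simps)
  then have "c * norm D \<le> norm d" using False by simp
  then show ?thesis using assms(1) by (simp add: field_simps)
qed (use assms in simp)

text \<open>
  Let \<open>J\<close> be the inverse of the localization of \<open>T + f + \<sigma> I\<close> with graph \<open>G\<close>. The claim is that \<open>c J - I\<close> is nonexpansive for \<open>c = 2 (\<kappa> + \<sigma>)\<close>. By the mean value theorem it is
  enough to bound proximal subgradients \<open>\<zeta>\<close> of \<open>y \<mapsto> inner \<xi> (c J y - y)\<close> by \<open>norm \<xi>\<close>. For
  \<open>w = (\<zeta> + \<xi>) / c\<close>, the linear change of variables \<open>(x, v) \<mapsto> (x, v + B x + \<sigma> x)\<close> turns the subgradient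
  inequality into \<open>z \<in> reg_coderiv T (x, v) (- w)\<close> with \<open>z = - \<xi> + \<sigma> w + B\<^sup>* w\<close>. The
  hypothesis on the coderivative then reads \<open>(\<kappa> + \<sigma>) (norm w)\<^sup>2 \<le> inner w \<xi>\<close>, the terms with \<open>B\<close>
  cancelling, and this is \<open>norm (c w - \<xi>) \<le> norm \<xi>\<close>.
\<close>

theorem coderivative_bound_imp_strong_monotonicity:
  fixes T :: "'a::{real_inner, complete_space} \<Rightarrow> 'a set" and f :: "'a \<Rightarrow> 'a"
  assumes G: "G = {(x, y). x \<in> ball x0 \<delta> \<and> y - f x - \<sigma> *\<^sub>R x \<in> ball v0 \<delta> \<and> y - f x - \<sigma> *\<^sub>R x \<in> T x}"
    and inv_lip: "\<And>x1 y1 x2 y2. (x1, y1) \<in> G \<Longrightarrow> (x2, y2) \<in> G \<Longrightarrow> norm (x1 - x2) \<le> norm (y1 - y2)"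
    and onto: "\<And>y. y \<in> cball y0 (2 * \<rho>) \<Longrightarrow> \<exists>x. (x, y) \<in> G"
    and der: "\<And>x. x \<in> ball x0 \<delta> \<Longrightarrow> (f has_derivative B x) (at x)"
    and cod: "\<And>x v w z. x \<in> ball x0 \<delta> \<Longrightarrow> v \<in> ball v0 \<delta> \<Longrightarrow> v \<in> T x \<Longrightarrow> z \<in> reg_coderiv T (x, v) w \<Longrightarrow>
      \<kappa> * (norm w)\<^sup>2 \<le> inner (B x w) w + inner z w"
    and \<kappa>: "\<kappa> > 0" and \<sigma>: "\<sigma> \<ge> 0" and \<rho>: "\<rho> > 0"
    and G1: "(x1, y1) \<in> G" "y1 \<in> cball y0 \<rho>" and G2: "(x2, y2) \<in> G" "y2 \<in> cball y0 \<rho>"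
  shows "(\<kappa> + \<sigma>) * (norm (x1 - x2))\<^sup>2 \<le> inner (x1 - x2) (y1 - y2)"
proof -
  define c where "c = 2 * (\<kappa> + \<sigma>)"
  have c: "c > 0" using \<kappa> \<sigma> by (simp add: c_def)
  define J where "J y = (SOME x. (x, y) \<in> G)" for y
  have J: "(J y, y) \<in> G" if "y \<in> cball y0 (2 * \<rho>)" for y
    unfolding J_def using someI_ex[OF onto[OF that]] .
  have J_eq: "J y = x" if "(x, y) \<in> G" "y \<in> cball y0 (2 * \<rho>)" for x y
    using inv_lip[OF J[OF that(2)] that(1)] by simp
  have normal: "norm \<zeta> \<le> norm \<xi>"
    if e: "e > 0" "ball y e \<subseteq> cball y0 (2 * \<rho>)"
      and prox: "\<And>y'. y' \<in> ball y e \<Longrightarrow> inner \<xi> (c *\<^sub>R J y' - y')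
        \<ge> inner \<xi> (c *\<^sub>R J y - y) + inner \<zeta> (y' - y) - K * (norm (y' - y))\<^sup>2"
    for \<xi> \<zeta> y e K
  proof -
    define w where "w = (1 / c) *\<^sub>R (\<zeta> + \<xi>)"
    define x where "x = J y"
    define v where "v = y - f x - \<sigma> *\<^sub>R x"
    have yD: "y \<in> cball y0 (2 * \<rho>)" using e centre_in_ball[of y e] by blast
    have x: "x \<in> ball x0 \<delta>" "v \<in> ball v0 \<delta>" "v \<in> T x"
      using J[OF yD] by (auto simp: G x_def v_def)
    \<comment> \<open>The same subgradient inequality, rewritten for \<open>inner \<xi> \<circ> J\<close>.\<close>
    have prox_J: "inner w (y' - y) - inner \<xi> (J y' - x) \<le> \<bar>K\<bar> / c * (norm (y' - y))\<^sup>2"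
      if "y' \<in> ball y e" for y'
    proof -
      have "inner \<xi> (y' - y) + inner \<zeta> (y' - y) - K * (norm (y' - y))\<^sup>2 \<le> c * inner \<xi> (J y' - x)"
        using prox[OF that] by (simp add: x_def inner_diff_right algebra_simps)
      moreover have "inner \<xi> (y' - y) + inner \<zeta> (y' - y) = c * inner w (y' - y)"
        using c by (simp add: w_def inner_add_left)
      moreover have "K * (norm (y' - y))\<^sup>2 \<le> \<bar>K\<bar> * (norm (y' - y))\<^sup>2" by (intro mult_right_mono) auto
      ultimately have "c * (inner w (y' - y) - inner \<xi> (J y' - x)) \<le> \<bar>K\<bar> * (norm (y' - y))\<^sup>2"
        by (simp add: right_diff_distrib)
      then show ?thesis using c by (simp add: pos_le_divide_eq mult.commute)
    qed
    interpret B: bounded_linear "B x" using der[OF x(1)] by (rule has_derivative_bounded_linear)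
    obtain N where N: "N > 0" "\<And>h. norm (B x h) \<le> norm h * N" using B.pos_bounded by blast
    obtain a where a: "\<And>h. inner a h = inner w (B x h)"
      using adjoint_vector_exists[OF B.bounded_linear_axioms, of w] by blast
    define z where "z = - \<xi> + \<sigma> *\<^sub>R w + a"
    have "(z, w) \<in> reg_normal (gph T) (x, v)"
      unfolding reg_normal_iff
    proof (intro conjI allI impI)
      show "(x, v) \<in> gph T" using x by (simp add: gph_def)
      fix \<epsilon> :: real assume "\<epsilon> > 0"
      define \<epsilon>1 where "\<epsilon>1 = \<epsilon> / 2 / (norm w + 1)"
      have \<epsilon>1: "\<epsilon>1 > 0" "norm w * \<epsilon>1 \<le> \<epsilon> / 2"
      proof -
        have pos: "norm w + 1 > 0" using norm_ge_zero[of w] by linarith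
        then show "\<epsilon>1 > 0" unfolding \<epsilon>1_def using \<open>\<epsilon> > 0\<close> by (intro divide_pos_pos) auto
        then have "norm w * \<epsilon>1 \<le> (norm w + 1) * \<epsilon>1" by simp
        also have "\<dots> = \<epsilon> / 2" 
          using pos unfolding \<epsilon>1_def by (subst times_divide_eq_right, intro nonzero_mult_div_cancel_left) simp
        finally show "norm w * \<epsilon>1 \<le> \<epsilon> / 2" .
      qed
      obtain d1 where d1: "d1 > 0"
        "\<And>x'. norm (x' - x) < d1 \<Longrightarrow> norm (f x' - f x - B x (x' - x)) \<le> \<epsilon>1 * norm (x' - x)"
        using der[OF x(1)] \<epsilon>1(1) unfolding has_derivative_at_alt by blast
      define C where "C = 1 + \<sigma> + N + \<epsilon>1"
      have C: "C > 0" using \<sigma> N \<epsilon>1 by (simp add: C_def)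
      define A where "A = \<bar>K\<bar> / c * C\<^sup>2"
      have A: "A \<ge> 0" using c by (simp add: A_def)
      \<comment> \<open>Small enough for the linearization of \<open>f\<close>, for staying in the box where \<open>J\<close> inverts, for the
        subgradient inequality, and for its quadratic error to be at most \<open>\<epsilon> / 2\<close> times the distance.\<close>
      define \<delta>' where "\<delta>' = Min {d1, \<delta> - norm (x - x0), \<delta> - norm (v - v0), e / C, \<epsilon> / (2 * (A + 1))}"
      have "\<delta>' > 0"
        unfolding \<delta>'_def using d1 x e C A \<open>\<epsilon> > 0\<close>
        by (simp add: dist_norm norm_minus_commute)
      have \<delta>': "\<delta>' \<le> d1" "\<delta>' \<le> \<delta> - norm (x - x0)" "\<delta>' \<le> \<delta> - norm (v - v0)" "\<delta>' \<le> e / C"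
        "\<delta>' \<le> \<epsilon> / (2 * (A + 1))"
        by (auto simp: \<delta>'_def)
      show "\<exists>\<delta>>0. \<forall>p\<in>gph T. norm (p - (x, v)) < \<delta> \<longrightarrow> inner (z, w) (p - (x, v)) \<le> \<epsilon> * norm (p - (x, v))"
      proof (intro exI conjI ballI impI)
        show "\<delta>' > 0" by fact
        fix p assume p: "p \<in> gph T" "norm (p - (x, v)) < \<delta>'"
        obtain x' v' where p_eq: "p = (x', v')" by (cases p)
        define n where "n = norm (p - (x, v))"
        have n: "0 \<le> n" "n < \<delta>'" using p by (auto simp: n_def)
        have nx: "norm (x' - x) \<le> n" and nv: "norm (v' - v) \<le> n"
          unfolding n_def p_eq diff_Pair by (rule norm_fst_le, rule norm_snd_le)
        define y' where "y' = v' + f x' + \<sigma> *\<^sub>R x'"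
        have y'_y: "y' - y = (v' - v) + (f x' - f x - B x (x' - x)) + B x (x' - x) + \<sigma> *\<^sub>R (x' - x)"
          by (simp add: y'_def v_def algebra_simps)
        have rem: "norm (f x' - f x - B x (x' - x)) \<le> \<epsilon>1 * n"
          using d1(2)[of x'] nx n \<delta>'(1) \<epsilon>1(1) by (smt (verit) mult_left_mono)
        have "norm (y' - y) \<le> norm (v' - v) + norm (f x' - f x - B x (x' - x)) + norm (B x (x' - x))
            + norm (\<sigma> *\<^sub>R (x' - x))"
          unfolding y'_y by (meson add_right_mono norm_triangle_ineq order_trans)
        also have "\<dots> \<le> n + \<epsilon>1 * n + n * N + \<sigma> * n"
          using nv rem nx \<sigma> order_trans[OF N(2)[of "x' - x"] mult_right_mono[OF nx, of N]] N(1)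
          by (intro add_mono) (auto intro: mult_left_mono)
        also have "\<dots> = C * n" by (simp add: C_def algebra_simps)
        finally have Cn: "norm (y' - y) \<le> C * n" .
        also have "C * n < C * \<delta>'" using n(2) C by simp
        also have "C * \<delta>' \<le> e" using \<delta>'(4) C by (simp add: field_simps)
        finally have y'e: "y' \<in> ball y e" by (simp add: dist_norm norm_minus_commute)
        have "x' \<in> ball x0 \<delta>" "v' \<in> ball v0 \<delta>"
          using nx nv n \<delta>'(2,3) dist_triangle[of x0 x' x] dist_triangle[of v0 v' v]
          by (auto simp: dist_norm norm_minus_commute)
        then have "(x', y') \<in> G" using p(1) by (simp add: G y'_def p_eq gph_def)
        then have "J y' = x'" using J_eq y'e e(2) by blast
        have "inner (z, w) (p - (x, v)) = inner z (x' - x) + inner w (v' - v)"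
          by (simp add: p_eq inner_prod_def)
        also have "\<dots> = inner w (y' - y) - inner \<xi> (J y' - x) - inner w (f x' - f x - B x (x' - x))"
          unfolding y'_y z_def \<open>J y' = x'\<close> inner_add_left inner_add_right a
          by (simp add: inner_diff_right algebra_simps)
        also have "\<dots> \<le> \<bar>K\<bar> / c * (norm (y' - y))\<^sup>2 + norm w * norm (f x' - f x - B x (x' - x))"
          using prox_J[OF y'e] norm_cauchy_schwarz[of "- w" "f x' - f x - B x (x' - x)"] by simp
        also have "\<dots> \<le> \<bar>K\<bar> / c * (C * n)\<^sup>2 + norm w * (\<epsilon>1 * n)"
          using Cn rem c by (intro add_mono mult_left_mono power_mono) auto
        also have "\<dots> \<le> \<epsilon> / 2 * n + \<epsilon> / 2 * n"
        proof (rule add_mono)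
          have "(A + 1) * n \<le> (A + 1) * \<delta>'" using n A by (intro mult_left_mono) auto
          also have "\<dots> \<le> \<epsilon> / 2" using \<delta>'(5) A by (simp add: field_simps)
          finally have "A * n \<le> \<epsilon> / 2" using n by (simp add: distrib_right)
          then have "A * n * n \<le> \<epsilon> / 2 * n" using n by (intro mult_right_mono) auto
          then show "\<bar>K\<bar> / c * (C * n)\<^sup>2 \<le> \<epsilon> / 2 * n"
            by (simp add: A_def power2_eq_square mult_ac)
          show "norm w * (\<epsilon>1 * n) \<le> \<epsilon> / 2 * n"
            using mult_right_mono[OF \<epsilon>1(2) n(1)] by (simp add: mult.assoc)
        qed
        finally show "inner (z, w) (p - (x, v)) \<le> \<epsilon> * norm (p - (x, v))"
          by (simp add: n_def)
      qed
    qed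
    then have "z \<in> reg_coderiv T (x, v) (- w)" by (simp add: reg_coderiv_def)
    from cod[OF x this] have "(\<kappa> + \<sigma>) * (norm w)\<^sup>2 \<le> inner w \<xi>"
      using a[of w] B.scaleR[of "-1" w]
      by (simp add: z_def inner_add_left inner_commute power2_norm_eq_inner algebra_simps)
    then have "c * (norm w)\<^sup>2 \<le> 2 * inner w \<xi>" unfolding c_def mult.assoc by linarith
    then have "norm (\<xi> - c *\<^sub>R w) \<le> norm \<xi>" using norm_diff_scaleR_le_iff[OF c] by blast
    moreover have "\<xi> - c *\<^sub>R w = - \<zeta>" using c by (simp add: w_def)
    ultimately show ?thesis by simp
  qed
  have lip: "(norm \<xi> * (c + 1))-lipschitz_on (cball y0 (2 * \<rho>)) (\<lambda>y. inner \<xi> (c *\<^sub>R J y - y))" for \<xi>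
  proof (rule lipschitz_onI)
    fix y y' assume y: "y \<in> cball y0 (2 * \<rho>)" "y' \<in> cball y0 (2 * \<rho>)"
    have "\<bar>inner \<xi> (c *\<^sub>R J y - y) - inner \<xi> (c *\<^sub>R J y' - y')\<bar> = \<bar>inner \<xi> (c *\<^sub>R (J y - J y') - (y - y'))\<bar>"
      by (simp add: inner_diff_right algebra_simps)
    also have "\<dots> \<le> norm \<xi> * norm (c *\<^sub>R (J y - J y') - (y - y'))" by (rule Cauchy_Schwarz_ineq2)
    also have "\<dots> \<le> norm \<xi> * (c * norm (y - y') + norm (y - y'))"
    proof (intro mult_left_mono)
      have "norm (c *\<^sub>R (J y - J y') - (y - y')) \<le> c * norm (J y - J y') + norm (y - y')"
        using norm_triangle_ineq4[of "c *\<^sub>R (J y - J y')" "y - y'"] c by simp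
      also have "c * norm (J y - J y') \<le> c * norm (y - y')"
        using inv_lip[OF J[OF y(1)] J[OF y(2)]] c by simp
      finally show "norm (c *\<^sub>R (J y - J y') - (y - y')) \<le> c * norm (y - y') + norm (y - y')" by simp
    qed simp
    finally show "dist (inner \<xi> (c *\<^sub>R J y - y)) (inner \<xi> (c *\<^sub>R J y' - y')) \<le> norm \<xi> * (c + 1) * dist y y'"
      by (simp add: dist_norm algebra_simps)
  qed (use c in auto)
  \<comment> \<open>The mean value theorem is applied with the scalarizing vector \<open>- D\<close>, \<open>D\<close> being the very
    difference to be estimated; it then reads \<open>(norm D)\<^sup>2 \<le> norm D * norm (y2 - y1)\<close>.\<close>
  define D where "D = (y2 - y1) - c *\<^sub>R (x2 - x1)"
  have J12: "J y1 = x1" "J y2 = x2" using J_eq G1 G2 \<rho> by auto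
  have "\<bar>inner (- D) (c *\<^sub>R J y2 - y2) - inner (- D) (c *\<^sub>R J y1 - y1)\<bar> \<le> norm (- D) * norm (y2 - y1)"
  proof (rule lipschitz_if_proximal_subgradients_bounded[OF lip \<rho> _ convex_cball _ _ G1(2) G2(2)])
    show "cball a \<rho> \<subseteq> cball y0 (2 * \<rho>)" if "a \<in> cball y0 \<rho>" for a
      using that by (auto simp: subset_eq) (smt (verit) dist_triangle)
    show "norm \<zeta> \<le> norm (- D)"
      if "e > 0" "ball y e \<subseteq> cball y0 (2 * \<rho>)"
        "\<And>y'. y' \<in> ball y e \<Longrightarrow> inner (- D) (c *\<^sub>R J y' - y')
          \<ge> inner (- D) (c *\<^sub>R J y - y) + inner \<zeta> (y' - y) - K * (norm (y' - y))\<^sup>2" for y \<zeta> K e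
      using normal[OF that(1,2), of "- D" \<zeta> K] that(3) by blast
  qed simp
  then have "\<bar>inner D D\<bar> \<le> norm D * norm (y2 - y1)"
  proof -
    have "(c *\<^sub>R x2 - y2) - (c *\<^sub>R x1 - y1) = - D" by (simp add: D_def algebra_simps)
    then have "inner (- D) (c *\<^sub>R J y2 - y2) - inner (- D) (c *\<^sub>R J y1 - y1) = inner D D"
      unfolding J12 inner_diff_right[symmetric] by simp
    then show ?thesis
      using \<open>\<bar>inner (- D) (c *\<^sub>R J y2 - y2) - inner (- D) (c *\<^sub>R J y1 - y1)\<bar> \<le> _\<close> by simp
  qed
  then have "norm D * norm D \<le> norm D * norm (y2 - y1)"
    by (simp add: power2_norm_eq_inner[symmetric] power2_eq_square)
  then have "norm D \<le> norm (y2 - y1)" by (cases "D = 0") auto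
  then have "c * (norm (x2 - x1))\<^sup>2 \<le> 2 * inner (x2 - x1) (y2 - y1)"
    unfolding D_def by (simp only: norm_diff_scaleR_le_iff[OF c])
  then show ?thesis
    by (simp add: c_def norm_minus_commute[of x2] inner_diff_left inner_diff_right algebra_simps)
qed

text \<open>
  The situation at one fixed parameter, around a point \<open>(x0, v0)\<close> of the graph of the
  subdifferential. Solvability is transferred twice: from \<open>T + \<sigma> I\<close> (graph \<open>G0\<close>, resolvent constant
  \<open>1 / (l + 1)\<close>) to \<open>T + f + \<sigma> I\<close> (graph \<open>G\<close>) by adding \<open>f\<close>, and, once strong monotonicity has improved
  the resolvent constant of \<open>G\<close> from \<open>1\<close> to \<open>1 / (\<kappa> + \<sigma>)\<close>, from there to \<open>T + f\<close> by adding \<open>- \<sigma> I\<close>.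
  The requirements on the radii \<open>\<gamma>\<close>, \<open>\<tau>\<close> and \<open>t\<close> involve \<open>\<delta>\<close>, \<open>r\<close>, \<open>l\<close> and \<open>\<kappa>\<close> only, so that one choice
  serves all parameters.
\<close>

theorem
  fixes \<phi> :: "'a::{real_inner, complete_space} \<Rightarrow> ereal" and f :: "'a \<Rightarrow> 'a"
  assumes lsc: "lsc \<phi>" and proper: "\<And>x. \<phi> x \<noteq> - \<infinity>"
    and v0: "v0 \<in> lim_subdiff \<phi> x0"
    and prox: "\<And>u v x. u \<in> cball x0 \<delta> \<Longrightarrow> v \<in> cball v0 \<delta> \<Longrightarrow> v \<in> lim_subdiff \<phi> u \<Longrightarrow> x \<in> cball x0 \<delta> \<Longrightarrow>
      \<phi> x \<ge> \<phi> u + ereal (inner v (x - u) - r / 2 * (norm (x - u))\<^sup>2)"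
    and f_lip: "\<And>x x'. x \<in> cball x0 \<delta> \<Longrightarrow> x' \<in> cball x0 \<delta> \<Longrightarrow> norm (f x - f x') \<le> l * norm (x - x')"
    and der: "\<And>x. x \<in> ball x0 \<delta> \<Longrightarrow> (f has_derivative B x) (at x)"
    and cod: "\<And>x v w z. x \<in> ball x0 \<delta> \<Longrightarrow> v \<in> ball v0 \<delta> \<Longrightarrow> v \<in> lim_subdiff \<phi> x \<Longrightarrow>
      z \<in> reg_coderiv (lim_subdiff \<phi>) (x, v) w \<Longrightarrow> \<kappa> * (norm w)\<^sup>2 \<le> inner (B x w) w + inner z w"
    and r: "r \<ge> 0" and l: "l \<ge> 0" and \<kappa>: "\<kappa> > 0" and \<sigma>: "\<sigma> = r + l + 1"
    and \<gamma>: "\<gamma> > 0" "(2 + 2 * \<sigma>) * (2 * (l + 1) * \<gamma>) < \<delta>"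
  shows variational_sum_strongly_monotone:
      "\<And>x1 v1 x2 v2 \<tau>. (1 + \<sigma> + l) * \<tau> \<le> \<gamma> \<Longrightarrow>
        x1 \<in> cball x0 \<tau> \<Longrightarrow> v1 \<in> cball v0 \<tau> \<Longrightarrow> v1 \<in> lim_subdiff \<phi> x1 \<Longrightarrow>
        x2 \<in> cball x0 \<tau> \<Longrightarrow> v2 \<in> cball v0 \<tau> \<Longrightarrow> v2 \<in> lim_subdiff \<phi> x2 \<Longrightarrow>
        \<kappa> * (norm (x1 - x2))\<^sup>2 \<le> inner (x1 - x2) ((v1 + f x1) - (v2 + f x2))"
    and variational_sum_onto:
      "\<And>t y. 0 \<le> t \<Longrightarrow> (\<kappa> + \<sigma>) * t \<le> \<gamma> \<Longrightarrow> y \<in> cball (v0 + f x0) (\<kappa> * t) \<Longrightarrow>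
        \<exists>x\<in>cball x0 t. y - f x \<in> lim_subdiff \<phi> x"
proof -
  let ?T = "lim_subdiff \<phi>"
  define G0 where "G0 = {(x, y). x \<in> ball x0 \<delta> \<and> y - \<sigma> *\<^sub>R x \<in> ball v0 \<delta> \<and> y - \<sigma> *\<^sub>R x \<in> ?T x}"
  define G where "G = {(x, y). x \<in> ball x0 \<delta> \<and> y - f x - \<sigma> *\<^sub>R x \<in> ball v0 \<delta> \<and> y - f x - \<sigma> *\<^sub>R x \<in> ?T x}"
  define y0 where "y0 = v0 + \<sigma> *\<^sub>R x0"
  define y1 where "y1 = y0 + f x0"
  have \<sigma>0: "\<sigma> \<ge> 1" "r + 1 \<le> \<sigma>" using r l \<sigma> by auto
  have \<gamma>\<delta>: "4 * \<gamma> < \<delta>" "0 < \<delta>"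
  proof -
    have "2 * (2 * 1 * \<gamma>) \<le> (2 + 2 * \<sigma>) * (2 * (l + 1) * \<gamma>)"
      using l \<gamma>(1) \<sigma>0 by (intro mult_mono mult_right_mono) auto
    then show "4 * \<gamma> < \<delta>" using \<gamma>(2) by simp
    then show "0 < \<delta>" using \<gamma> by simp
  qed
  have mono0: "(l + 1) * (norm (x - x'))\<^sup>2 \<le> inner (x - x') (y - y')"
    if "(x, y) \<in> G0" "(x', y') \<in> G0" for x y x' y'
  proof -
    have "- r * (norm (x - x'))\<^sup>2 \<le> inner ((y - \<sigma> *\<^sub>R x) - (y' - \<sigma> *\<^sub>R x')) (x - x')"
    proof (rule subgradients_hypomonotone[of "cball x0 \<delta>" "cball v0 \<delta>" \<phi>, OF prox])
    qed (use that in \<open>auto simp: G0_def\<close>)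
    also have "\<dots> = inner (x - x') (y - y') - \<sigma> * (norm (x - x'))\<^sup>2"
      by (simp add: power2_norm_eq_inner algebra_simps inner_commute)
    finally show ?thesis by (simp add: \<sigma> algebra_simps)
  qed
  have base0: "(x0, y0) \<in> G0" using v0 \<gamma>\<delta> by (simp add: G0_def y0_def)
  have onto0: "\<exists>x. (x, y) \<in> G0" if yB: "y \<in> cball y0 (2 * (l + 1) * \<gamma>)" for y
  proof -
    have "2 * (l + 1) * \<gamma> > 0" using l \<gamma> by simp
    then obtain x where "x \<in> ball x0 \<delta>" "y - \<sigma> *\<^sub>R x \<in> ball v0 \<delta>" "y - \<sigma> *\<^sub>R x \<in> ?T x"
      using local_resolvent_onto[OF lsc proper v0 prox r \<sigma>0(2) _ \<gamma>(2) yB[unfolded y0_def]] by blast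
    then show ?thesis by (auto simp: G0_def)
  qed
  have G_iff: "(x, y) \<in> G \<longleftrightarrow> (x, y - f x) \<in> G0" for x y
    by (simp add: G_def G0_def)
  have onto: "\<exists>x. (x, y) \<in> G" if "y \<in> cball y1 (2 * \<gamma>)" for y
  proof (rule perturbed_equation_solvable[of G0 "1 / (l + 1)" y0 "2 * (l + 1) * \<gamma>" x0 "2 * \<gamma>" f l "2 * \<gamma>" y])
    show "dist x x' \<le> 1 / (l + 1) * norm (y - y')" if "(x, y) \<in> G0" "(x', y') \<in> G0" for x y x' y'
      using norm_le_if_coercive[OF _ mono0[OF that]] l by (simp add: dist_norm)
    show "norm (f x - f x') \<le> l * dist x x'" if "x \<in> cball x0 (2 * \<gamma>)" "x' \<in> cball x0 (2 * \<gamma>)" for x x'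
      unfolding dist_norm using that \<gamma>\<delta> \<gamma>(1) by (intro f_lip) auto
    show "y \<in> cball (y0 + f x0) (2 * \<gamma>)" using that by (simp add: y1_def)
    show "1 / (l + 1) * (2 * \<gamma>) \<le> (1 - 1 / (l + 1) * l) * (2 * \<gamma>)"
      using l by (intro mult_right_mono) (use \<gamma> in \<open>auto simp: field_simps\<close>)
    show "2 * \<gamma> + l * (2 * \<gamma>) \<le> 2 * (l + 1) * \<gamma>" by (simp add: algebra_simps)
  qed (use base0 onto0 l \<gamma> G_iff in auto)
  have inv_lip: "norm (x - x') \<le> norm (y - y')" if "(x, y) \<in> G" "(x', y') \<in> G" for x y x' y'
  proof -
    have x: "x \<in> cball x0 \<delta>" "x' \<in> cball x0 \<delta>" using that by (auto simp: G_def)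
    have "(l + 1) * (norm (x - x'))\<^sup>2 \<le> inner (x - x') ((y - f x) - (y' - f x'))"
      using mono0 that unfolding G_iff by blast
    moreover have "inner (x - x') ((y - f x) - (y' - f x')) = inner (x - x') (y - y') + inner (x - x') (- (f x - f x'))"
      by (simp add: inner_diff_right inner_minus_right)
    moreover have "inner (x - x') (- (f x - f x')) \<le> l * (norm (x - x'))\<^sup>2"
    proof -
      have "inner (x - x') (- (f x - f x')) \<le> norm (x - x') * norm (f x - f x')"
        using norm_cauchy_schwarz[of "x - x'" "- (f x - f x')"] unfolding norm_minus_cancel .
      also have "\<dots> \<le> norm (x - x') * (l * norm (x - x'))"
        using f_lip[OF x] by (intro mult_left_mono) auto
      finally show ?thesis by (simp add: power2_eq_square mult_ac)
    qed
    moreover have "(l + 1) * (norm (x - x'))\<^sup>2 = l * (norm (x - x'))\<^sup>2 + (norm (x - x'))\<^sup>2"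
      by (simp add: distrib_right)
    ultimately have "1 * (norm (x - x'))\<^sup>2 \<le> inner (x - x') (y - y')" by linarith
    then show ?thesis using norm_le_if_coercive[of 1 "x - x'" "y - y'"] by simp
  qed
  have mono: "(\<kappa> + \<sigma>) * (norm (x - x'))\<^sup>2 \<le> inner (x - x') (y - y')"
    if "(x, y) \<in> G" "y \<in> cball y1 \<gamma>" "(x', y') \<in> G" "y' \<in> cball y1 \<gamma>" for x y x' y'
    by (rule coderivative_bound_imp_strong_monotonicity[OF G_def inv_lip onto der cod \<kappa> _ \<gamma>(1) that])
      (use \<sigma>0 in auto)
  show "\<kappa> * (norm (u1 - u2))\<^sup>2 \<le> inner (u1 - u2) ((v1 + f u1) - (v2 + f u2))"
    if \<tau>: "(1 + \<sigma> + l) * \<tau> \<le> \<gamma>"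
      and u1: "u1 \<in> cball x0 \<tau>" "v1 \<in> cball v0 \<tau>" "v1 \<in> ?T u1"
      and u2: "u2 \<in> cball x0 \<tau>" "v2 \<in> cball v0 \<tau>" "v2 \<in> ?T u2"
    for u1 v1 u2 v2 \<tau>
  proof -
    have "\<tau> \<ge> 0" using u1(1) zero_le_dist[of x0 u1] by (simp del: zero_le_dist)
    have "1 * \<tau> \<le> (1 + \<sigma> + l) * \<tau>" using \<sigma>0 l \<open>\<tau> \<ge> 0\<close> by (intro mult_right_mono) auto
    then have "\<tau> < \<delta>" using \<tau> \<gamma>\<delta> \<gamma> by simp
    have mem: "(u, v + f u + \<sigma> *\<^sub>R u) \<in> G \<and> v + f u + \<sigma> *\<^sub>R u \<in> cball y1 \<gamma>"
      if "u \<in> cball x0 \<tau>" "v \<in> cball v0 \<tau>" "v \<in> ?T u" for u v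
    proof
      show "(u, v + f u + \<sigma> *\<^sub>R u) \<in> G" using that \<open>\<tau> < \<delta>\<close> by (simp add: G_def)
      have u: "norm (u - x0) \<le> \<tau>" "norm (v - v0) \<le> \<tau>" using that by (auto simp: dist_norm norm_minus_commute)
      have "norm (f u - f x0) \<le> l * norm (u - x0)"
        using that(1) \<open>\<tau> < \<delta>\<close> \<gamma>\<delta> by (intro f_lip) auto
      also have "\<dots> \<le> l * \<tau>" using u l by (intro mult_left_mono)
      finally have "norm (f u - f x0) \<le> l * \<tau>" .
      moreover have "norm (\<sigma> *\<^sub>R (u - x0)) \<le> \<sigma> * \<tau>" using u \<sigma>0 by (simp add: mult_left_mono)
      moreover have "norm ((v - v0) + (f u - f x0) + \<sigma> *\<^sub>R (u - x0))
          \<le> norm (v - v0) + norm (f u - f x0) + norm (\<sigma> *\<^sub>R (u - x0))"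
        by (meson add_right_mono norm_triangle_ineq order_trans)
      moreover have eq: "(v + f u + \<sigma> *\<^sub>R u) - y1 = (v - v0) + (f u - f x0) + \<sigma> *\<^sub>R (u - x0)"
        by (simp add: y1_def y0_def algebra_simps)
      moreover have "\<tau> + l * \<tau> + \<sigma> * \<tau> \<le> \<gamma>" using \<tau> by (simp add: algebra_simps)
      ultimately have "norm ((v + f u + \<sigma> *\<^sub>R u) - y1) \<le> \<gamma>" using u(2) unfolding eq by linarith
      then show "v + f u + \<sigma> *\<^sub>R u \<in> cball y1 \<gamma>"
        by (simp only: mem_cball dist_norm norm_minus_commute[of y1])
    qed
    have "(\<kappa> + \<sigma>) * (norm (u1 - u2))\<^sup>2
        \<le> inner (u1 - u2) ((v1 + f u1 + \<sigma> *\<^sub>R u1) - (v2 + f u2 + \<sigma> *\<^sub>R u2))"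
      using mono mem[OF u1] mem[OF u2] by blast
    also have "(v1 + f u1 + \<sigma> *\<^sub>R u1) - (v2 + f u2 + \<sigma> *\<^sub>R u2) = ((v1 + f u1) - (v2 + f u2)) + \<sigma> *\<^sub>R (u1 - u2)"
      by (simp add: algebra_simps)
    also have "inner (u1 - u2) \<dots> = inner (u1 - u2) ((v1 + f u1) - (v2 + f u2)) + \<sigma> * (norm (u1 - u2))\<^sup>2"
      by (simp only: inner_add_right inner_scaleR_right power2_norm_eq_inner)
    finally show ?thesis by (simp add: distrib_right)
  qed
  show "\<exists>x\<in>cball x0 t. y - f x \<in> ?T x"
    if t: "0 \<le> t" "(\<kappa> + \<sigma>) * t \<le> \<gamma>" and y: "y \<in> cball (v0 + f x0) (\<kappa> * t)" for t y
  proof -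
    have \<kappa>\<sigma>: "\<kappa> + \<sigma> > 0" using \<kappa> \<sigma>0 by simp
    obtain x where "x \<in> cball x0 t" "(x, y - (- \<sigma> *\<^sub>R x)) \<in> G \<inter> UNIV \<times> cball y1 \<gamma>"
    proof (rule perturbed_equation_solvable[of "G \<inter> UNIV \<times> cball y1 \<gamma>" "1 / (\<kappa> + \<sigma>)" y1 \<gamma> x0 t
          "\<lambda>x. - \<sigma> *\<^sub>R x" \<sigma> "\<kappa> * t" y])
      show "dist x x' \<le> 1 / (\<kappa> + \<sigma>) * norm (y - y')"
        if "(x, y) \<in> G \<inter> UNIV \<times> cball y1 \<gamma>" "(x', y') \<in> G \<inter> UNIV \<times> cball y1 \<gamma>" for x y x' y'
        unfolding dist_norm using that by (intro norm_le_if_coercive[OF \<kappa>\<sigma>] mono) auto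
      show "\<exists>x. (x, y) \<in> G \<inter> UNIV \<times> cball y1 \<gamma>" if "y \<in> cball y1 \<gamma>" for y
        using onto[of y] that \<gamma>(1) by auto
      show "(x0, y1) \<in> G \<inter> UNIV \<times> cball y1 \<gamma>"
        using base0 \<gamma>(1) by (simp add: G_iff y1_def)
      show "norm (- \<sigma> *\<^sub>R x - - \<sigma> *\<^sub>R x') \<le> \<sigma> * dist x x'" for x x'
        using \<sigma>0 by (simp add: dist_norm norm_minus_commute flip: scaleR_diff_right)
      have "1 / (\<kappa> + \<sigma>) * \<kappa> = 1 - 1 / (\<kappa> + \<sigma>) * \<sigma>" using \<kappa>\<sigma> by (simp add: field_simps)
      then show "1 / (\<kappa> + \<sigma>) * (\<kappa> * t) \<le> (1 - 1 / (\<kappa> + \<sigma>) * \<sigma>) * t"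
        by (metis mult.assoc order_refl)
      show "\<kappa> * t + \<sigma> * t \<le> \<gamma>" using t(2) by (simp add: distrib_right)
      show "y \<in> cball (y1 + - \<sigma> *\<^sub>R x0) (\<kappa> * t)"
        using y by (simp add: y1_def y0_def)
    qed (use \<kappa> \<kappa>\<sigma> \<sigma>0 t in auto)
    then show ?thesis by (auto simp: G_def intro!: bexI[of _ x])
  qed
qed

section \<open>Local forms of the assumptions\<close>

lemma solution_map_iff: "x \<in> solution_map f g (v, p) \<longleftrightarrow> v - f (x, p) \<in> subdiff_x g x p"
  by (auto simp: solution_map_def image_iff algebra_simps intro: bexI[of _ "v - f (x, p)"])

text \<open>
  The form in which the property is derived and used: the smaller of two radii replaces the
  neighbourhoods, and a distance estimate replaces the scaled unit ball, which degenerates to a point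
  for equal parameters.
\<close>

lemma lipschitz_like_iff:
  fixes F :: "'p::metric_space \<Rightarrow> 'y::real_normed_vector set"
  shows "lipschitz_like F p0 y0 \<longleftrightarrow> y0 \<in> F p0 \<and>
    (\<exists>\<rho>>0. \<exists>l>0. \<forall>p\<in>cball p0 \<rho>. \<forall>q\<in>cball p0 \<rho>. \<forall>y\<in>F p \<inter> cball y0 \<rho>. \<exists>y'\<in>F q. norm (y - y') \<le> l * dist p q)"
proof -
  have ball_iff: "y \<in> {y' + (l * dist p q) *\<^sub>R b | y' b. y' \<in> F q \<and> b \<in> cball 0 1}
      \<longleftrightarrow> (\<exists>y'\<in>F q. norm (y - y') \<le> l * dist p q)" (is "?L \<longleftrightarrow> ?R") if "l > 0" for l p q y
  proof
    assume ?L
    then obtain y' b where "y' \<in> F q" "norm b \<le> 1" "y = y' + (l * dist p q) *\<^sub>R b" by auto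
    moreover from this(2) have "l * dist p q * norm b \<le> l * dist p q"
      using that by (simp add: mult_left_le)
    ultimately show ?R using that by (intro bexI[of _ y']) (auto simp: abs_mult)
  next
    assume ?R
    then obtain y' where y': "y' \<in> F q" "norm (y - y') \<le> l * dist p q" by blast
    show ?L
    proof (cases "dist p q = 0")
      case True
      then have "y = y' + (l * dist p q) *\<^sub>R 0" using y' by simp
      then show ?thesis using y' by force
    next
      case False
      then have "l * dist p q > 0" using that by simp
      define b where "b = (1 / (l * dist p q)) *\<^sub>R (y - y')"
      have "norm b = norm (y - y') / (l * dist p q)"
        using that by (simp add: b_def abs_mult)
      then have "b \<in> cball 0 1" using y'(2) \<open>l * dist p q > 0\<close> by (simp add: pos_divide_le_eq)
      moreover have "y = y' + (l * dist p q) *\<^sub>R b"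
        using that False by (simp add: b_def)
      ultimately show ?thesis using y' by blast
    qed
  qed
  show ?thesis
  proof
    assume "lipschitz_like F p0 y0"
    then obtain Q W l where y0: "y0 \<in> F p0" and Q: "p0 \<in> interior Q" and W: "y0 \<in> interior W" and l: "l > 0"
      and sub: "\<forall>p\<in>Q. \<forall>q\<in>Q. F p \<inter> W \<subseteq> {y + (l * dist p q) *\<^sub>R b | y b. y \<in> F q \<and> b \<in> cball 0 1}"
      unfolding lipschitz_like_def gph_def by blast
    obtain a b where a: "a > 0" "cball p0 a \<subseteq> Q" and b: "b > 0" "cball y0 b \<subseteq> W"
      using Q W unfolding mem_interior_cball by metis
    have "\<exists>y'\<in>F q. norm (y - y') \<le> l * dist p q"
      if "p \<in> cball p0 (min a b)" "q \<in> cball p0 (min a b)" "y \<in> F p \<inter> cball y0 (min a b)" for p q y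
    proof -
      have "p \<in> Q" "q \<in> Q" "y \<in> F p \<inter> W" using that a b by auto
      then show ?thesis using sub ball_iff[OF l] by blast
    qed
    then show "y0 \<in> F p0 \<and> (\<exists>\<rho>>0. \<exists>l>0. \<forall>p\<in>cball p0 \<rho>. \<forall>q\<in>cball p0 \<rho>. \<forall>y\<in>F p \<inter> cball y0 \<rho>.
        \<exists>y'\<in>F q. norm (y - y') \<le> l * dist p q)"
      using y0 l a(1) b(1) by (intro conjI exI[of _ "min a b"] exI[of _ l]) auto
  next
    assume "y0 \<in> F p0 \<and> (\<exists>\<rho>>0. \<exists>l>0. \<forall>p\<in>cball p0 \<rho>. \<forall>q\<in>cball p0 \<rho>. \<forall>y\<in>F p \<inter> cball y0 \<rho>.
        \<exists>y'\<in>F q. norm (y - y') \<le> l * dist p q)"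
    then obtain \<rho> l where y0: "y0 \<in> F p0" and \<rho>: "\<rho> > 0" and l: "l > 0"
      and *: "\<forall>p\<in>cball p0 \<rho>. \<forall>q\<in>cball p0 \<rho>. \<forall>y\<in>F p \<inter> cball y0 \<rho>. \<exists>y'\<in>F q. norm (y - y') \<le> l * dist p q"
      by blast
    have "p0 \<in> interior (cball p0 \<rho>)" "y0 \<in> interior (cball y0 \<rho>)"
      using \<rho> by (auto simp: mem_interior_cball)
    moreover have "\<forall>p\<in>cball p0 \<rho>. \<forall>q\<in>cball p0 \<rho>. F p \<inter> cball y0 \<rho>
        \<subseteq> {y + (l * dist p q) *\<^sub>R b | y b. y \<in> F q \<and> b \<in> cball 0 1}"
      using * ball_iff[OF l] by blast
    ultimately show "lipschitz_like F p0 y0"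
      unfolding lipschitz_like_def gph_def using y0 l by blast
  qed
qed

text \<open>
  Near the reference point \<open>f\<close> is almost linear in \<open>x\<close>: continuity of the gradient bounds
  \<open>\<nabla>\<^sub>x f(x, p) - \<nabla>\<^sub>x f(x0, p0)\<close> by \<open>e\<close>, and the mean value inequality turns this into a uniform Lipschitz
  constant in \<open>x\<close>.
\<close>

lemma smooth_lipschitz_base_local:
  fixes f :: "'a::real_inner \<times> 'p::metric_space \<Rightarrow> 'a"
  assumes "smooth_lipschitz_base f x0 p0" and e: "e > 0"
  obtains \<delta> L where "\<delta> > 0" "L > 0"
    "\<And>x p. x \<in> cball x0 \<delta> \<Longrightarrow> p \<in> cball p0 \<delta> \<Longrightarrow> ((\<lambda>x. f (x, p)) has_derivative grad_x f x p) (at x)"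
    "\<And>x p h. x \<in> cball x0 \<delta> \<Longrightarrow> p \<in> cball p0 \<delta> \<Longrightarrow>
      \<bar>inner (grad_x f x p h) h - inner (grad_x f x0 p0 h) h\<bar> \<le> e * (norm h)\<^sup>2"
    "\<And>x x' p. x \<in> cball x0 \<delta> \<Longrightarrow> x' \<in> cball x0 \<delta> \<Longrightarrow> p \<in> cball p0 \<delta> \<Longrightarrow>
      norm (f (x, p) - f (x', p)) \<le> (norm (grad_x f x0 p0) + e) * norm (x - x')"
    "\<And>x p q. x \<in> cball x0 \<delta> \<Longrightarrow> p \<in> cball p0 \<delta> \<Longrightarrow> q \<in> cball p0 \<delta> \<Longrightarrow>
      norm (f (x, p) - f (x, q)) \<le> L * dist p q"
proof -
  obtain U Q where U: "x0 \<in> interior U" "p0 \<in> interior Q"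
    and diff: "\<And>x p. x \<in> U \<Longrightarrow> p \<in> Q \<Longrightarrow> (\<lambda>x'. f (x', p)) differentiable (at x)"
    using assms(1)[unfolded smooth_lipschitz_base_def, THEN conjunct1] by auto
  obtain U' Q' L where U': "x0 \<in> interior U'" "p0 \<in> interior Q'" and L: "L > 0"
    and lip: "\<And>x p1 p2. x \<in> U' \<Longrightarrow> p1 \<in> Q' \<Longrightarrow> p2 \<in> Q' \<Longrightarrow> norm (f (x, p1) - f (x, p2)) \<le> L * dist p1 p2"
    using assms(1)[unfolded smooth_lipschitz_base_def, THEN conjunct2, THEN conjunct2] by auto
  have cont: "isCont (\<lambda>(x, p). grad_x f x p) (x0, p0)"
    using assms(1) by (simp add: smooth_lipschitz_base_def)
  obtain d where d: "d > 0"
    "\<And>z. dist z (x0, p0) < d \<Longrightarrow> dist ((\<lambda>(x, p). grad_x f x p) z) (grad_x f x0 p0) < e"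
    using cont[unfolded continuous_at_eps_delta, rule_format, OF e] by auto
  obtain a1 a2 a3 a4 where a: "a1 > 0" "cball x0 a1 \<subseteq> U" "a2 > 0" "cball p0 a2 \<subseteq> Q"
    "a3 > 0" "cball x0 a3 \<subseteq> U'" "a4 > 0" "cball p0 a4 \<subseteq> Q'"
    using U U' unfolding mem_interior_cball by metis
  define \<delta> where "\<delta> = Min {a1, a2, a3, a4, d / 3}"
  have \<delta>: "\<delta> > 0" "\<delta> \<le> a1" "\<delta> \<le> a2" "\<delta> \<le> a3" "\<delta> \<le> a4" "\<delta> \<le> d / 3"
    using a d(1) by (auto simp: \<delta>_def)
  have der: "((\<lambda>x. f (x, p)) has_derivative grad_x f x p) (at x)" if "x \<in> cball x0 \<delta>" "p \<in> cball p0 \<delta>" for x p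
  proof -
    have "(\<lambda>x'. f (x', p)) differentiable (at x)" using that \<delta> a by (intro diff) auto
    then have "((\<lambda>x'. f (x', p)) has_derivative frechet_derivative (\<lambda>x'. f (x', p)) (at x)) (at x)"
      by (simp add: frechet_derivative_works)
    moreover from this have "blinfun_apply (grad_x f x p) = frechet_derivative (\<lambda>x'. f (x', p)) (at x)"
      unfolding grad_x_def by (intro bounded_linear_Blinfun_apply has_derivative_bounded_linear)
    ultimately show ?thesis by simp
  qed
  have grad: "norm (grad_x f x p - grad_x f x0 p0) \<le> e" if "x \<in> cball x0 \<delta>" "p \<in> cball p0 \<delta>" for x p
  proof -
    have "dist (x, p) (x0, p0) \<le> dist x x0 + dist p p0"
      unfolding dist_Pair_Pair by (rule sqrt_sum_squares_le_sum) auto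
    also have "\<dots> < d" using that \<delta>(6) d(1) by (auto simp: dist_commute)
    finally show ?thesis using d(2)[of "(x, p)"] by (simp add: dist_norm less_imp_le)
  qed
  show thesis
  proof (rule that[OF \<delta>(1) L der])
    show "\<bar>inner (grad_x f x p h) h - inner (grad_x f x0 p0 h) h\<bar> \<le> e * (norm h)\<^sup>2"
      if "x \<in> cball x0 \<delta>" "p \<in> cball p0 \<delta>" for x p h
    proof -
      have "\<bar>inner ((grad_x f x p - grad_x f x0 p0) h) h\<bar> \<le> norm ((grad_x f x p - grad_x f x0 p0) h) * norm h"
        by (rule Cauchy_Schwarz_ineq2)
      also have "\<dots> \<le> (norm (grad_x f x p - grad_x f x0 p0) * norm h) * norm h"
        by (intro mult_right_mono norm_blinfun) auto
      also have "\<dots> \<le> (e * norm h) * norm h"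
        by (intro mult_right_mono grad that) auto
      finally show ?thesis by (simp add: blinfun.diff_left inner_diff_left power2_eq_square)
    qed
    show "norm (f (x, p) - f (x', p)) \<le> (norm (grad_x f x0 p0) + e) * norm (x - x')"
      if "x \<in> cball x0 \<delta>" "x' \<in> cball x0 \<delta>" "p \<in> cball p0 \<delta>" for x x' p
    proof (rule differentiable_bound[OF convex_cball[of x0 \<delta>] _ _ that(1,2), of "\<lambda>x. f (x, p)" "\<lambda>x. grad_x f x p"])
      show "((\<lambda>x. f (x, p)) has_derivative grad_x f z p) (at z within cball x0 \<delta>)" if "z \<in> cball x0 \<delta>" for z
        using der[OF that \<open>p \<in> cball p0 \<delta>\<close>] by (rule has_derivative_at_withinI)
      show "onorm (grad_x f z p) \<le> norm (grad_x f x0 p0) + e" if "z \<in> cball x0 \<delta>" for z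
        using grad[OF that \<open>p \<in> cball p0 \<delta>\<close>] norm_triangle_ineq2[of "grad_x f z p" "grad_x f x0 p0"]
        unfolding norm_blinfun.rep_eq[symmetric] by linarith
    qed
    show "norm (f (x, p) - f (x, q)) \<le> L * dist p q"
      if "x \<in> cball x0 \<delta>" "p \<in> cball p0 \<delta>" "q \<in> cball p0 \<delta>" for x p q
      using that \<delta> a by (intro lip) auto
  qed auto
qed

text \<open>
  The restriction to small values of \<open>g\<close> in the definition of prox-regularity disappears near the
  reference point, since \<open>g\<close> is continuous along the graph of the subdifferential.
\<close>

lemma param_cont_prox_regular_local:
  fixes g :: "'a::real_inner \<times> 'p::metric_space \<Rightarrow> ereal"
  assumes A2: "param_cont_prox_regular g x0 p0 v0" and v0: "v0 \<in> subdiff_x g x0 p0"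
  obtains \<delta> r where "\<delta> > 0" "r > 0"
    "\<And>u v p x. u \<in> cball x0 \<delta> \<Longrightarrow> p \<in> cball p0 \<delta> \<Longrightarrow> v \<in> cball v0 \<delta> \<Longrightarrow> v \<in> subdiff_x g u p \<Longrightarrow>
      x \<in> cball x0 \<delta> \<Longrightarrow> g (x, p) \<ge> g (u, p) + ereal (inner v (x - u) - r / 2 * (norm (x - u))\<^sup>2)"
proof -
  obtain U V Q \<epsilon> r where UVQ: "x0 \<in> interior U" "v0 \<in> interior V" "p0 \<in> interior Q"
    and \<epsilon>: "(\<epsilon>::real) > 0" and r: "(r::real) > 0"
    and prox: "\<And>u p v x. u \<in> U \<Longrightarrow> p \<in> Q \<Longrightarrow> v \<in> subdiff_x g u p \<Longrightarrow> v \<in> V \<Longrightarrow>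
      g (u, p) \<le> g (x0, p0) + ereal \<epsilon> \<Longrightarrow> x \<in> U \<Longrightarrow>
      g (x, p) \<ge> g (u, p) + ereal (inner v (x - u)) - ereal (r / 2 * (norm (x - u))\<^sup>2)"
    using A2[unfolded param_cont_prox_regular_def, THEN conjunct1] by auto
  have fin: "\<bar>g (x0, p0)\<bar> \<noteq> \<infinity>" using v0 unfolding subdiff_x_def by (rule lim_subdiff_finite)
  have "((\<lambda>(x, p, v). g (x, p)) \<longlongrightarrow> g (x0, p0)) (at (x0, p0, v0) within gph_subdiff_x g)"
    using A2 unfolding param_cont_prox_regular_def continuous_within by simp
  moreover have "g (x0, p0) < g (x0, p0) + ereal \<epsilon>" using fin \<epsilon> by (cases "g (x0, p0)") auto
  ultimately have "\<forall>\<^sub>F z in at (x0, p0, v0) within gph_subdiff_x g. (\<lambda>(x, p, v). g (x, p)) z < g (x0, p0) + ereal \<epsilon>"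
    by (rule order_tendstoD(2))
  then obtain d where d: "d > 0" "\<And>z. z \<in> gph_subdiff_x g \<Longrightarrow> z \<noteq> (x0, p0, v0) \<Longrightarrow> dist z (x0, p0, v0) < d \<Longrightarrow>
      (\<lambda>(x, p, v). g (x, p)) z < g (x0, p0) + ereal \<epsilon>"
    unfolding eventually_at by blast
  obtain a b c where abc: "a > 0" "cball x0 a \<subseteq> U" "b > 0" "cball v0 b \<subseteq> V" "c > 0" "cball p0 c \<subseteq> Q"
    using UVQ unfolding mem_interior_cball by metis
  define \<delta> where "\<delta> = Min {a, b, c, d / 4}"
  have \<delta>: "\<delta> > 0" "\<delta> \<le> a" "\<delta> \<le> b" "\<delta> \<le> c" "\<delta> \<le> d / 4"
    using abc d(1) by (auto simp: \<delta>_def)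
  show thesis
  proof (rule that[OF \<delta>(1) r])
    fix u v p x
    assume *: "u \<in> cball x0 \<delta>" "p \<in> cball p0 \<delta>" "v \<in> cball v0 \<delta>" "v \<in> subdiff_x g u p" "x \<in> cball x0 \<delta>"
    have "dist (u, p, v) (x0, p0, v0) \<le> dist u x0 + dist (p, v) (p0, v0)"
      unfolding dist_Pair_Pair[of u] by (rule sqrt_sum_squares_le_sum) auto
    also have "dist (p, v) (p0, v0) \<le> dist p p0 + dist v v0"
      unfolding dist_Pair_Pair by (rule sqrt_sum_squares_le_sum) auto
    also have "dist u x0 + (dist p p0 + dist v v0) < d" using * \<delta>(5) d(1) by (auto simp: dist_commute)
    finally have "dist (u, p, v) (x0, p0, v0) < d" by simp
    then have "g (u, p) \<le> g (x0, p0) + ereal \<epsilon>"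
      using d(2)[of "(u, p, v)"] *(4) \<open>g (x0, p0) < g (x0, p0) + ereal \<epsilon>\<close>
      by (cases "(u, p, v) = (x0, p0, v0)") (auto simp: gph_subdiff_x_def less_imp_le)
    then have "g (x, p) \<ge> g (u, p) + ereal (inner v (x - u)) - ereal (r / 2 * (norm (x - u))\<^sup>2)"
      using * \<delta> abc by (intro prox) auto
    then show "g (x, p) \<ge> g (u, p) + ereal (inner v (x - u) - r / 2 * (norm (x - u))\<^sup>2)"
      by (cases "g (u, p)"; cases "g (x, p)") (auto simp: algebra_simps)
  qed
qed

section \<open>Necessity\<close>

text \<open>
  Move the right-hand side to \<open>v + f u + t e\<close> and write \<open>x\<close> for the solution. The estimate on \<open>\<theta>\<close> says
  \<open>2 \<kappa> (x - u) = t e - D\<close> with \<open>norm D \<le> t norm e\<close>. In the normal cone inequality for the point of the graph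
  above \<open>x\<close>, linearizing \<open>f\<close> replaces \<open>z\<close> by \<open>z' = z + B\<^sup>* w\<close>, and division by \<open>t \<rightarrow> 0\<close> leaves
  \<open>inner (z' - 2 \<kappa> w) e \<le> norm z' * norm e\<close> for every \<open>e\<close>. Therefore \<open>norm (z' - 2 \<kappa> w) \<le> norm z'\<close>, which
  is the claim.
\<close>

theorem coderivative_bound_from_lipschitz_inverse:
  fixes T :: "'a::{real_inner, complete_space} \<Rightarrow> 'a set" and f :: "'a \<Rightarrow> 'a"
  assumes der: "(f has_derivative B) (at u)" and \<kappa>: "\<kappa> > 0" and \<nu>: "\<nu> > 0"
    and inv: "\<And>y. y \<in> ball (v + f u) \<nu> \<Longrightarrow> y - f (\<theta> y) \<in> T (\<theta> y)"
    and contr: "\<And>y. y \<in> ball (v + f u) \<nu> \<Longrightarrow>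
      norm ((y - (v + f u)) - (2 * \<kappa>) *\<^sub>R (\<theta> y - u)) \<le> norm (y - (v + f u))"
    and z: "z \<in> reg_coderiv T (u, v) w"
  shows "\<kappa> * (norm w)\<^sup>2 \<le> inner (B w) w + inner z w"
proof -
  interpret B: bounded_linear B using der by (rule has_derivative_bounded_linear)
  obtain N where N: "N > 0" "\<And>h. norm (B h) \<le> norm h * N" using B.pos_bounded by blast
  obtain a where a: "\<And>h. inner a h = inner w (B h)"
    using adjoint_vector_exists[OF B.bounded_linear_axioms, of w] by blast
  define z' where "z' = z + a"
  have key: "inner z' e - norm z' * norm e - 2 * \<kappa> * inner w e \<le> 0" for e
  proof (rule field_le_epsilon)
    fix \<epsilon>' :: real assume "\<epsilon>' > 0"
    \<comment> \<open>Bounds the displacement on the graph of \<open>T\<close> by \<open>t * C\<close>: the solution moves by at most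
      \<open>t * (norm e / \<kappa>)\<close>, and \<open>f\<close> has local slope at most \<open>1 + N\<close> at \<open>u\<close>.\<close>
    define C where "C = norm e / \<kappa> + norm e + (1 + N) * (norm e / \<kappa>)"
    have C: "C \<ge> 0" using \<kappa> N by (simp add: C_def)
    define \<epsilon> where "\<epsilon> = min 1 (\<epsilon>' / (2 * \<kappa> * (C + norm w * (norm e / \<kappa>) + 1)))"
    have den: "C + norm w * (norm e / \<kappa>) + 1 > 0"
      using C \<kappa> by (intro add_nonneg_pos add_nonneg_nonneg mult_nonneg_nonneg divide_nonneg_nonneg) auto
    have \<epsilon>: "\<epsilon> > 0" "\<epsilon> \<le> 1" using \<open>\<epsilon>' > 0\<close> den \<kappa> by (auto simp: \<epsilon>_def)
    have "\<epsilon> * (2 * \<kappa> * (C + norm w * (norm e / \<kappa>) + 1)) \<le> \<epsilon>'"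
      unfolding \<epsilon>_def using den \<kappa> by (subst pos_le_divide_eq[symmetric]) auto
    then have \<epsilon>': "2 * \<kappa> * (\<epsilon> * (C + norm w * (norm e / \<kappa>))) \<le> \<epsilon>'"
    proof -
      have "\<epsilon> * (2 * \<kappa> * (C + norm w * (norm e / \<kappa>) + 1))
          = 2 * \<kappa> * (\<epsilon> * (C + norm w * (norm e / \<kappa>))) + 2 * (\<epsilon> * \<kappa>)"
        by (simp only: distrib_left) (simp add: mult_ac)
      then show ?thesis using \<open>_ \<le> \<epsilon>'\<close> mult_pos_pos[OF \<epsilon>(1) \<kappa>] by linarith
    qed
    have "(z, - w) \<in> reg_normal (gph T) (u, v)" using z by (simp add: reg_coderiv_def)
    then obtain d where d: "d > 0" "\<And>p. p \<in> gph T \<Longrightarrow> norm (p - (u, v)) < d \<Longrightarrow>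
        inner (z, - w) (p - (u, v)) \<le> \<epsilon> * norm (p - (u, v))"
      unfolding reg_normal_iff using \<epsilon>(1) by blast
    obtain d1 where d1: "d1 > 0"
      "\<And>x. norm (x - u) < d1 \<Longrightarrow> norm (f x - f u - B (x - u)) \<le> \<epsilon> * norm (x - u)"
      using der \<epsilon>(1) unfolding has_derivative_at_alt by blast
    define t where "t = Min {\<nu> / (2 * (norm e + 1)), d1 / (2 * (norm e / \<kappa> + 1)), d / (2 * (C + 1))}"
    have pos: "norm e + 1 > 0" "norm e / \<kappa> + 1 > 0" "C + 1 > 0"
      using \<kappa> C by (auto intro: add_nonneg_pos)
    have t: "t > 0" unfolding t_def using \<nu> d1 d pos by simp
    have t_le: "t * (2 * (norm e + 1)) \<le> \<nu>" "t * (2 * (norm e / \<kappa> + 1)) \<le> d1" "t * (2 * (C + 1)) \<le> d"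
      using pos by (auto simp: t_def simp flip: pos_le_divide_eq)
    have scale: "t * s < b" if "t * (2 * (s + 1)) \<le> b" "s \<ge> 0" for s b
    proof -
      have "t * (2 * (s + 1)) = 2 * (t * s) + 2 * t" by (simp add: algebra_simps)
      moreover have "t * s \<ge> 0" using t that(2) by simp
      ultimately show ?thesis using that(1) t by linarith
    qed
    define y where "y = v + f u + t *\<^sub>R e"
    define x where "x = \<theta> y"
    have "t * norm e < \<nu>" using scale[OF t_le(1)] by simp
    then have yB: "y \<in> ball (v + f u) \<nu>" using t by (simp add: y_def dist_norm)
    define D where "D = t *\<^sub>R e - (2 * \<kappa>) *\<^sub>R (x - u)"
    have D: "norm D \<le> t * norm e" using contr[OF yB] t by (simp add: D_def x_def y_def)
    have "2 * \<kappa> * norm (x - u) = norm (t *\<^sub>R e - D)" using \<kappa> by (simp add: D_def)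
    also have "\<dots> \<le> 2 * (t * norm e)" using norm_triangle_ineq4[of "t *\<^sub>R e" D] D t by simp
    finally have xu: "norm (x - u) \<le> t * (norm e / \<kappa>)" using \<kappa> by (simp add: field_simps)
    have "t * (norm e / \<kappa>) < d1" using scale[OF t_le(2)] \<kappa> by simp
    then have rem: "norm (f x - f u - B (x - u)) \<le> \<epsilon> * norm (x - u)" using d1(2)[of x] xu by linarith
    define p where "p = (x, y - f x)"
    have "p \<in> gph T" using inv[OF yB] by (simp add: p_def x_def gph_def)
    have snd_p: "y - f x - v = t *\<^sub>R e - (f x - f u - B (x - u)) - B (x - u)" by (simp add: y_def)
    have p_norm: "norm (p - (u, v)) \<le> t * C"
    proof -
      have "norm (p - (u, v)) \<le> norm (x - u) + norm (y - f x - v)"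
        unfolding p_def diff_Pair by (rule norm_Pair_le)
      also have "norm (y - f x - v) \<le> norm (t *\<^sub>R e) + norm (f x - f u - B (x - u)) + norm (B (x - u))"
        unfolding snd_p by (meson add_right_mono norm_triangle_ineq4 order_trans)
      also have "\<dots> \<le> t * norm e + norm (x - u) + norm (x - u) * N"
        using rem \<epsilon> N(2)[of "x - u"] t mult_right_mono[OF \<epsilon>(2) norm_ge_zero[of "x - u"]]
        by (intro add_mono) auto
      finally have "norm (p - (u, v)) \<le> norm (x - u) + (t * norm e + (1 + N) * norm (x - u))"
        by (simp add: algebra_simps)
      also have "\<dots> \<le> t * (norm e / \<kappa>) + (t * norm e + (1 + N) * (t * (norm e / \<kappa>)))"
        using xu N(1) t by (intro add_mono mult_left_mono) auto
      finally show ?thesis by (simp add: C_def algebra_simps)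
    qed
    have "t * C < d" using scale[OF t_le(3) C] .
    then have "inner (z, - w) (p - (u, v)) \<le> \<epsilon> * norm (p - (u, v))"
      using d(2)[OF \<open>p \<in> gph T\<close>] p_norm by linarith
    also have "\<dots> \<le> \<epsilon> * (t * C)" using p_norm \<epsilon> by simp
    also have "inner (z, - w) (p - (u, v)) = inner z (x - u) - inner w (y - f x - v)"
      by (simp add: p_def inner_prod_def)
    also have "\<dots> = inner z' (x - u) - t * inner w e + inner w (f x - f u - B (x - u))"
      unfolding snd_p z'_def inner_add_left a inner_diff_right[of w "t *\<^sub>R e - _"] inner_diff_right[of w "t *\<^sub>R e"]
        inner_scaleR_right by simp
    finally have 1: "inner z' (x - u) - t * inner w e + inner w (f x - f u - B (x - u)) \<le> \<epsilon> * (t * C)" .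
    have "- inner w (f x - f u - B (x - u)) \<le> norm w * norm (f x - f u - B (x - u))"
      using norm_cauchy_schwarz[of w "- (f x - f u - B (x - u))"]
      unfolding inner_minus_right norm_minus_cancel .
    also have "\<dots> \<le> norm w * (\<epsilon> * (t * (norm e / \<kappa>)))"
      using order_trans[OF rem mult_left_mono[OF xu, of \<epsilon>]] \<epsilon> by (intro mult_left_mono) auto
    finally have 2: "inner z' (x - u) - t * inner w e \<le> t * (\<epsilon> * (C + norm w * (norm e / \<kappa>)))"
      using 1 by (simp add: algebra_simps)
    have "t * inner z' e = 2 * \<kappa> * inner z' (x - u) + inner z' D"
      by (simp add: D_def inner_diff_right)
    also have "inner z' D \<le> norm z' * (t * norm e)"
      using norm_cauchy_schwarz[of z' D] mult_left_mono[OF D norm_ge_zero[of z']] by linarith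
    finally have "t * (inner z' e - norm z' * norm e - 2 * \<kappa> * inner w e)
        \<le> 2 * \<kappa> * (inner z' (x - u) - t * inner w e)"
      by (simp add: algebra_simps)
    also have "\<dots> \<le> 2 * \<kappa> * (t * (\<epsilon> * (C + norm w * (norm e / \<kappa>))))"
      using 2 \<kappa> by (intro mult_left_mono) auto
    also have "\<dots> = t * (2 * \<kappa> * (\<epsilon> * (C + norm w * (norm e / \<kappa>))))" by (simp only: mult_ac)
    also have "\<dots> \<le> t * \<epsilon>'" using \<epsilon>' t by (intro mult_left_mono) auto
    finally show "inner z' e - norm z' * norm e - 2 * \<kappa> * inner w e \<le> 0 + \<epsilon>'" using t by simp
  qed
  define q where "q = z' - (2 * \<kappa>) *\<^sub>R w"
  have "inner q q \<le> norm z' * norm q"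
    using key[of q] by (simp add: q_def inner_diff_left)
  then have "norm q * norm q \<le> norm z' * norm q" by (simp add: power2_norm_eq_inner[symmetric] power2_eq_square)
  then have "norm q \<le> norm z'" by (cases "q = 0") auto
  then have "2 * \<kappa> * (norm w)\<^sup>2 \<le> 2 * inner w z'"
    unfolding q_def using norm_diff_scaleR_le_iff[of "2 * \<kappa>" z' w] \<kappa> by simp
  then show ?thesis using a[of w] by (simp add: z'_def inner_add_right inner_commute)
qed

lemma sv_localization_iff:
  assumes "sv_localization S v0 p0 x0 V Q U \<theta>" "v \<in> V" "p \<in> Q"
  shows "x \<in> U \<and> x \<in> S (v, p) \<longleftrightarrow> x = \<theta> (v, p)"
proof -
  have "((v, p), x) \<in> {((v, p), x). (v, p) \<in> V \<times> Q \<and> x = \<theta> (v, p)}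
      \<longleftrightarrow> ((v, p), x) \<in> gph S \<inter> (V \<times> Q) \<times> U"
    using assms(1) unfolding sv_localization_def by metis
  then show ?thesis using assms(2,3) by (auto simp: gph_def)
qed

definition coderivative_positivity ::
    "('a::real_inner \<times> 'p::metric_space \<Rightarrow> 'a) \<Rightarrow> ('a \<times> 'p \<Rightarrow> ereal) \<Rightarrow> 'a \<Rightarrow> 'p \<Rightarrow> 'a \<Rightarrow> real \<Rightarrow> real \<Rightarrow> bool" where
  "coderivative_positivity f g x0 p0 v0 \<eta> \<kappa>0 \<longleftrightarrow> \<eta> > 0 \<and> \<kappa>0 > 0 \<and>
     (\<forall>(u, p, v) \<in> gph_subdiff_x g \<inter> cball x0 \<eta> \<times> cball p0 \<eta> \<times> cball v0 \<eta>.
        \<forall>w. \<forall>z \<in> reg_coderiv (\<lambda>x. subdiff_x g x p) (u, v) w.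
          inner (grad_x f x0 p0 w) w + inner z w \<ge> \<kappa>0 * (norm w)\<^sup>2)"

text \<open>
  At a point near the reference point the previous theorem gives the inequality with \<open>\<kappa>\<close> and the
  gradient at that point; replacing it by the gradient at the reference point costs at most half of the
  modulus.
\<close>

lemma fully_stable_imp_coderivative_positivity:
  fixes f :: "'a::{real_inner, complete_space} \<times> 'p::metric_space \<Rightarrow> 'a"
  assumes A1: "smooth_lipschitz_base f x0 p0"
    and loc: "sv_localization (solution_map f g) v0 p0 x0 V Q U \<theta>"
    and \<kappa>: "\<kappa> > 0"
    and stab: "\<And>v1 p1 v2 p2. v1 \<in> V \<Longrightarrow> p1 \<in> Q \<Longrightarrow> v2 \<in> V \<Longrightarrow> p2 \<in> Q \<Longrightarrow>
      norm ((v1 - v2) - (2 * \<kappa>) *\<^sub>R (\<theta> (v1, p1) - \<theta> (v2, p2))) \<le> norm (v1 - v2) + l * dist p1 p2"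
  obtains \<eta> where "coderivative_positivity f g x0 p0 (v0 - f (x0, p0)) \<eta> (\<kappa> / 2)"
proof -
  define vh where "vh = v0 - f (x0, p0)"
  define lf where "lf = norm (grad_x f x0 p0) + \<kappa> / 2"
  have lf: "lf \<ge> 0" using \<kappa> by (simp add: lf_def)
  obtain \<delta> L where \<delta>: "\<delta> > 0" "L > 0"
    and der: "\<And>x p. x \<in> cball x0 \<delta> \<Longrightarrow> p \<in> cball p0 \<delta> \<Longrightarrow> ((\<lambda>x. f (x, p)) has_derivative grad_x f x p) (at x)"
    and grad: "\<And>x p h. x \<in> cball x0 \<delta> \<Longrightarrow> p \<in> cball p0 \<delta> \<Longrightarrow>
      \<bar>inner (grad_x f x p h) h - inner (grad_x f x0 p0 h) h\<bar> \<le> \<kappa> / 2 * (norm h)\<^sup>2"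
    and f_x: "\<And>x x' p. x \<in> cball x0 \<delta> \<Longrightarrow> x' \<in> cball x0 \<delta> \<Longrightarrow> p \<in> cball p0 \<delta> \<Longrightarrow>
      norm (f (x, p) - f (x', p)) \<le> lf * norm (x - x')"
    and f_p: "\<And>x p q. x \<in> cball x0 \<delta> \<Longrightarrow> p \<in> cball p0 \<delta> \<Longrightarrow> q \<in> cball p0 \<delta> \<Longrightarrow>
      norm (f (x, p) - f (x, q)) \<le> L * dist p q"
  proof (rule smooth_lipschitz_base_local[OF A1, of "\<kappa> / 2", folded lf_def])
    show "\<kappa> / 2 > 0" using \<kappa> by simp
  qed (rule that; assumption)
  obtain a b c where abc: "a > 0" "cball v0 a \<subseteq> V" "b > 0" "cball p0 b \<subseteq> Q" "c > 0" "cball x0 c \<subseteq> U"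
    using loc unfolding sv_localization_def mem_interior_cball by metis
  define \<eta> where "\<eta> = Min {b, c, \<delta>, a / (2 * (1 + lf + L))}"
  have den: "1 + lf + L > 0" using lf \<delta> by simp
  have \<eta>: "\<eta> > 0" "\<eta> \<le> b" "\<eta> \<le> c" "\<eta> \<le> \<delta>" "\<eta> * (2 * (1 + lf + L)) \<le> a"
    using abc \<delta> den by (auto simp: \<eta>_def simp flip: pos_le_divide_eq)
  have "\<kappa> / 2 * (norm w)\<^sup>2 \<le> inner (grad_x f x0 p0 w) w + inner z w"
    if u: "u \<in> cball x0 \<eta>" and p: "p \<in> cball p0 \<eta>" and v: "v \<in> cball vh \<eta>" "v \<in> subdiff_x g u p"
      and z: "z \<in> reg_coderiv (\<lambda>x. subdiff_x g x p) (u, v) w" for u p v w z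
  proof -
    have u\<delta>: "u \<in> cball x0 \<delta>" and p\<delta>: "p \<in> cball p0 \<delta>" using u p \<eta> by auto
    have pQ: "p \<in> Q" using p \<eta> abc by auto
    define y0 where "y0 = v + f (u, p)"
    have "norm (y0 - v0) \<le> norm (v - vh) + norm (f (u, p) - f (x0, p)) + norm (f (x0, p) - f (x0, p0))"
    proof -
      have eq: "y0 - v0 = (v - vh) + (f (u, p) - f (x0, p)) + (f (x0, p) - f (x0, p0))"
        by (simp add: y0_def vh_def)
      show ?thesis unfolding eq by (meson add_right_mono norm_triangle_ineq order_trans)
    qed
    also have "\<dots> \<le> \<eta> + lf * \<eta> + L * \<eta>"
    proof (intro add_mono)
      show "norm (v - vh) \<le> \<eta>" using v by (simp add: dist_norm norm_minus_commute)
      have "norm (f (u, p) - f (x0, p)) \<le> lf * norm (u - x0)" using u\<delta> p\<delta> \<delta> by (intro f_x) auto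
      also have "\<dots> \<le> lf * \<eta>" using u lf by (intro mult_left_mono) (auto simp: dist_norm norm_minus_commute)
      finally show "norm (f (u, p) - f (x0, p)) \<le> lf * \<eta>" .
      have "norm (f (x0, p) - f (x0, p0)) \<le> L * dist p p0" using p\<delta> \<delta> by (intro f_p) auto
      also have "\<dots> \<le> L * \<eta>" using p \<delta> by (intro mult_left_mono) (auto simp: dist_commute)
      finally show "norm (f (x0, p) - f (x0, p0)) \<le> L * \<eta>" .
    qed
    also have "\<dots> \<le> a / 2" using \<eta>(5) by (simp add: algebra_simps)
    finally have y0: "norm (y0 - v0) \<le> a / 2" .
    have ballV: "y \<in> V" if "y \<in> ball y0 (a / 2)" for y
    proof -
      have "dist v0 y \<le> dist v0 y0 + dist y0 y" by (rule dist_triangle)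
      also have "\<dots> \<le> a" using y0 that by (simp add: dist_norm norm_minus_commute)
      finally show ?thesis using abc(2) by auto
    qed
    have "y0 \<in> V" using ballV[of y0] abc(1) by simp
    have "u = \<theta> (y0, p)"
    proof -
      have "u \<in> cball x0 c" using u \<eta>(3) by simp
      then show ?thesis
        using sv_localization_iff[OF loc \<open>y0 \<in> V\<close> pQ, of u] abc(6) v(2)
        by (auto simp: solution_map_iff y0_def)
    qed
    have "\<kappa> * (norm w)\<^sup>2 \<le> inner (grad_x f u p w) w + inner z w"
    proof (rule coderivative_bound_from_lipschitz_inverse[OF der[OF u\<delta> p\<delta>] \<kappa> _ _ _ z])
      show "a / 2 > 0" using abc by simp
      show "y - f (\<theta> (y, p), p) \<in> subdiff_x g (\<theta> (y, p)) p" if "y \<in> ball (v + f (u, p)) (a / 2)" for y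
        using sv_localization_iff[OF loc _ pQ, of y "\<theta> (y, p)"] ballV that by (simp add: solution_map_iff y0_def)
      show "norm (y - (v + f (u, p)) - (2 * \<kappa>) *\<^sub>R (\<theta> (y, p) - u)) \<le> norm (y - (v + f (u, p)))"
        if "y \<in> ball (v + f (u, p)) (a / 2)" for y
        using stab[OF ballV pQ \<open>y0 \<in> V\<close> pQ, of y, folded \<open>u = \<theta> (y0, p)\<close>] that
        unfolding y0_def[symmetric] by simp
    qed
    then show ?thesis using grad[OF u\<delta> p\<delta>, of w] by linarith
  qed
  then have "coderivative_positivity f g x0 p0 vh \<eta> (\<kappa> / 2)"
    using \<eta>(1) \<kappa> by (auto simp: coderivative_positivity_def gph_subdiff_x_def)
  then show thesis using that unfolding vh_def by blast
qed

text \<open>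
  A point \<open>(x, w)\<close> of the graph for \<open>p\<close> satisfies \<open>x = \<theta> (v, p)\<close> for \<open>v = w + f (x, p)\<close>. Its partner
  in the graph for \<open>q\<close> is \<open>x' = \<theta> (v, q)\<close> with \<open>w' = v - f (x', q)\<close>: full stability controls \<open>x - x'\<close>, and the
  Lipschitz continuity of \<open>f\<close> controls \<open>w - w'\<close>.
\<close>

lemma fully_stable_imp_lipschitz_like_subdiff_graph:
  fixes f :: "'a::{real_inner, complete_space} \<times> 'p::metric_space \<Rightarrow> 'a"
  assumes A1: "smooth_lipschitz_base f x0 p0"
    and v0: "v0 - f (x0, p0) \<in> subdiff_x g x0 p0"
    and loc: "sv_localization (solution_map f g) v0 p0 x0 V Q U \<theta>"
    and \<kappa>: "\<kappa> > 0" and l: "l > 0"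
    and stab: "\<And>v1 p1 v2 p2. v1 \<in> V \<Longrightarrow> p1 \<in> Q \<Longrightarrow> v2 \<in> V \<Longrightarrow> p2 \<in> Q \<Longrightarrow>
      norm ((v1 - v2) - (2 * \<kappa>) *\<^sub>R (\<theta> (v1, p1) - \<theta> (v2, p2))) \<le> norm (v1 - v2) + l * dist p1 p2"
  shows "lipschitz_like (\<lambda>p. gph (\<lambda>x. subdiff_x g x p)) p0 (x0, v0 - f (x0, p0))"
proof -
  define vh where "vh = v0 - f (x0, p0)"
  define lf where "lf = norm (grad_x f x0 p0) + 1"
  have lf: "lf \<ge> 0" by (simp add: lf_def)
  obtain \<delta> L where \<delta>: "\<delta> > 0" "L > 0"
    and f_x: "\<And>x x' p. x \<in> cball x0 \<delta> \<Longrightarrow> x' \<in> cball x0 \<delta> \<Longrightarrow> p \<in> cball p0 \<delta> \<Longrightarrow>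
      norm (f (x, p) - f (x', p)) \<le> lf * norm (x - x')"
    and f_p: "\<And>x p q. x \<in> cball x0 \<delta> \<Longrightarrow> p \<in> cball p0 \<delta> \<Longrightarrow> q \<in> cball p0 \<delta> \<Longrightarrow>
      norm (f (x, p) - f (x, q)) \<le> L * dist p q"
    by (rule smooth_lipschitz_base_local[OF A1 zero_less_one, folded lf_def]) (rule that; assumption)
  have f_xp: "norm (f (x, p) - f (x', q)) \<le> lf * norm (x - x') + L * dist p q"
    if "x \<in> cball x0 \<delta>" "x' \<in> cball x0 \<delta>" "p \<in> cball p0 \<delta>" "q \<in> cball p0 \<delta>" for x x' p q
    using norm_triangle_ineq[of "f (x, p) - f (x', p)" "f (x', p) - f (x', q)"] f_x[OF that(1-3)]
      f_p[OF that(2-4)] by simp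
  obtain a b c where abc: "a > 0" "cball v0 a \<subseteq> V" "b > 0" "cball p0 b \<subseteq> Q" "c > 0" "cball x0 c \<subseteq> U"
    using loc unfolding sv_localization_def mem_interior_cball by metis
  define \<mu> where "\<mu> = l / (2 * \<kappa>)"
  have \<mu>: "\<mu> > 0" using l \<kappa> by (simp add: \<mu>_def)
  define \<rho> where "\<rho> = Min {b, c, \<delta> / (1 + 2 * \<mu>), a / (1 + lf + L)}"
  have den: "1 + lf + L > 0" "1 + 2 * \<mu> > 0" using lf \<delta> \<mu> by auto
  have \<rho>: "\<rho> > 0" "\<rho> \<le> b" "\<rho> \<le> c" "\<rho> * (1 + 2 * \<mu>) \<le> \<delta>" "\<rho> * (1 + lf + L) \<le> a"
    using abc \<delta> den by (auto simp: \<rho>_def simp flip: pos_le_divide_eq)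
  have "\<rho> * 1 \<le> \<rho> * (1 + 2 * \<mu>)" using \<rho>(1) \<mu> by (intro mult_left_mono) auto
  then have \<rho>\<delta>: "\<rho> \<le> \<delta>" using \<rho>(4) by simp
  define l' where "l' = \<mu> + (lf * \<mu> + L)"
  have l': "l' > 0" using \<mu> lf \<delta> by (simp add: l'_def add_pos_nonneg)
  have "\<exists>y'\<in>gph (\<lambda>x. subdiff_x g x q). norm (y - y') \<le> l' * dist p q"
    if p: "p \<in> cball p0 \<rho>" and q: "q \<in> cball p0 \<rho>"
      and y: "y \<in> gph (\<lambda>x. subdiff_x g x p) \<inter> cball (x0, vh) \<rho>" for p q y
  proof -
    obtain x w where y_eq: "y = (x, w)" by (cases y)
    have w: "w \<in> subdiff_x g x p" using y by (simp add: y_eq gph_def)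
    have x\<rho>: "norm (x - x0) \<le> \<rho>" and w\<rho>: "norm (w - vh) \<le> \<rho>"
    proof -
      have "dist (x, w) (x0, vh) \<le> \<rho>" using y by (simp add: y_eq dist_commute)
      then have "norm (x - x0, w - vh) \<le> \<rho>" by (simp add: dist_norm)
      then show "norm (x - x0) \<le> \<rho>" "norm (w - vh) \<le> \<rho>"
        using norm_fst_le[of "x - x0" "w - vh"] norm_snd_le[of "w - vh" "x - x0"] by simp_all
    qed
    have x\<delta>: "x \<in> cball x0 \<delta>" using x\<rho> \<rho>\<delta> by (simp add: dist_norm norm_minus_commute)
    have pq: "p \<in> Q" "q \<in> Q" "p \<in> cball p0 \<delta>" "q \<in> cball p0 \<delta>" using p q \<rho> \<rho>\<delta> abc by auto
    define v where "v = w + f (x, p)"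
    have "norm (v - v0) \<le> norm (w - vh) + norm (f (x, p) - f (x0, p0))"
    proof -
      have "v - v0 = (w - vh) + (f (x, p) - f (x0, p0))" by (simp add: v_def vh_def)
      then show ?thesis by (simp only: norm_triangle_ineq)
    qed
    also have "norm (f (x, p) - f (x0, p0)) \<le> lf * norm (x - x0) + L * dist p p0"
      using x\<delta> pq \<delta> by (intro f_xp) auto
    also have "norm (w - vh) + (lf * norm (x - x0) + L * dist p p0) \<le> \<rho> + (lf * \<rho> + L * \<rho>)"
      using w\<rho> x\<rho> p lf \<delta> by (intro add_mono mult_left_mono) (auto simp: dist_commute)
    also have "\<dots> \<le> a" using \<rho>(5) by (simp add: algebra_simps)
    finally have "v \<in> V" using abc(2) by (auto simp: dist_norm norm_minus_commute)
    have x_eq: "x = \<theta> (v, p)"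
    proof -
      have "x \<in> cball x0 c" using x\<rho> \<rho>(3) by (simp add: dist_norm norm_minus_commute)
      then show ?thesis
        using sv_localization_iff[OF loc \<open>v \<in> V\<close> pq(1), of x] abc(6) w
        by (auto simp: solution_map_iff v_def)
    qed
    define x' where "x' = \<theta> (v, q)"
    have w': "v - f (x', q) \<in> subdiff_x g x' q"
      using sv_localization_iff[OF loc \<open>v \<in> V\<close> pq(2), of x'] by (simp add: solution_map_iff x'_def)
    have "2 * \<kappa> * norm (x - x') \<le> l * dist p q"
      using stab[OF \<open>v \<in> V\<close> pq(1) \<open>v \<in> V\<close> pq(2)] \<kappa> by (simp add: x_eq x'_def)
    then have xx': "norm (x - x') \<le> \<mu> * dist p q" using \<kappa> by (simp add: \<mu>_def field_simps)
    have "dist p q \<le> 2 * \<rho>" using dist_triangle[of p q p0] p q by (simp add: dist_commute)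
    then have "\<mu> * dist p q \<le> \<mu> * (2 * \<rho>)" using \<mu> by (intro mult_left_mono) auto
    then have "norm (x' - x0) \<le> \<rho> * (1 + 2 * \<mu>)"
      using norm_triangle_ineq[of "x' - x" "x - x0"] xx' x\<rho> by (simp add: norm_minus_commute algebra_simps)
    then have x'\<delta>: "x' \<in> cball x0 \<delta>" using \<rho>(4) by (simp add: dist_norm norm_minus_commute)
    have "norm (y - (x', v - f (x', q))) \<le> norm (x - x') + norm (f (x, p) - f (x', q))"
    proof -
      have "w - (v - f (x', q)) = - (f (x, p) - f (x', q))" by (simp add: v_def)
      then have "norm (w - (v - f (x', q))) = norm (f (x, p) - f (x', q))" by (simp only: norm_minus_cancel)
      then show ?thesis
        unfolding y_eq diff_Pair using norm_Pair_le[of "x - x'" "w - (v - f (x', q))"] by simp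
    qed
    also have "\<dots> \<le> norm (x - x') + (lf * norm (x - x') + L * dist p q)"
      using f_xp[OF x\<delta> x'\<delta> pq(3,4)] by simp
    also have "\<dots> \<le> \<mu> * dist p q + (lf * (\<mu> * dist p q) + L * dist p q)"
      using xx' lf \<delta>(2) by (intro add_mono mult_left_mono) auto
    also have "\<dots> = l' * dist p q" by (simp add: l'_def algebra_simps)
    finally show ?thesis using w' by (intro bexI[of _ "(x', v - f (x', q))"]) (auto simp: gph_def)
  qed
  moreover have "(x0, vh) \<in> gph (\<lambda>x. subdiff_x g x p0)" using v0 by (simp add: gph_def vh_def)
  ultimately show ?thesis
    unfolding lipschitz_like_iff vh_def[symmetric] using \<rho>(1) l' by blast
qed

lemma fully_stable_localization_lipschitz:
  assumes \<kappa>: "\<kappa> > 0" and l: "l > 0"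
    and stab: "\<And>v1 p1 v2 p2. v1 \<in> V \<Longrightarrow> p1 \<in> Q \<Longrightarrow> v2 \<in> V \<Longrightarrow> p2 \<in> Q \<Longrightarrow>
      norm ((v1 - v2) - (2 * \<kappa>) *\<^sub>R (\<theta> (v1, p1) - \<theta> (v2, p2))) \<le> norm (v1 - v2) + l * dist p1 p2"
  shows "((2 + l) / (2 * \<kappa>))-lipschitz_on (V \<times> Q) (\<theta> :: 'a::real_inner \<times> 'p::metric_space \<Rightarrow> 'a)"
proof (rule lipschitz_onI)
  fix z1 z2 assume z: "z1 \<in> V \<times> Q" "z2 \<in> V \<times> Q"
  obtain v1 p1 v2 p2 where eq: "z1 = (v1, p1)" "z2 = (v2, p2)" by (cases z1; cases z2)
  define D where "D = \<theta> z1 - \<theta> z2"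
  have "2 * \<kappa> * norm D = norm ((v1 - v2) - ((v1 - v2) - (2 * \<kappa>) *\<^sub>R D))" using \<kappa> by simp
  also have "\<dots> \<le> norm (v1 - v2) + norm ((v1 - v2) - (2 * \<kappa>) *\<^sub>R D)" by (rule norm_triangle_ineq4)
  also have "\<dots> \<le> norm (v1 - v2) + (norm (v1 - v2) + l * dist p1 p2)"
    using stab[of v1 p1 v2 p2] z by (simp add: eq D_def)
  also have "\<dots> \<le> dist z1 z2 + (dist z1 z2 + l * dist z1 z2)"
    using l dist_fst_le[of z1 z2] dist_snd_le[of z1 z2]
    by (intro add_mono mult_left_mono) (auto simp: eq dist_norm)
  finally show "dist (\<theta> z1) (\<theta> z2) \<le> (2 + l) / (2 * \<kappa>) * dist z1 z2"
    using \<kappa> by (simp add: D_def dist_norm field_simps)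
qed (use \<kappa> l in auto)

section \<open>Sufficiency\<close>

text \<open>
  For each parameter near \<open>p0\<close> the Lipschitz-like graph has a point near \<open>(x0, vh)\<close>, and the
  results at a fixed parameter apply around that point with common radii. This gives
  solvability and strong monotonicity on a common neighbourhood, hence the localization \<open>\<theta>\<close> and its
  Lipschitz continuity in \<open>v\<close>. For the dependence on the parameter, the Lipschitz-like property moves
  \<open>\<theta> (v, p)\<close> to a point \<open>x'\<close> of the graph for \<open>q\<close>, which solves the inclusion for \<open>q\<close> with a right-hand side
  \<open>y'\<close> close to \<open>v\<close>; strong monotonicity for \<open>q\<close> then compares \<open>x'\<close> with \<open>\<theta> (v, q)\<close>.
\<close>

theorem coderivative_positivity_imp_fully_stable:
  fixes f :: "'a::{real_inner, complete_space} \<times> 'p::metric_space \<Rightarrow> 'a"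
    and g :: "'a \<times> 'p \<Rightarrow> ereal"
  assumes proper: "\<And>z. g z \<noteq> - \<infinity>" and lsc: "lsc g"
    and vh: "vh = v0 - f (x0, p0)" and vh_sub: "vh \<in> subdiff_x g x0 p0"
    and A1: "smooth_lipschitz_base f x0 p0"
    and A2: "param_cont_prox_regular g x0 p0 vh"
    and pos: "coderivative_positivity f g x0 p0 vh \<eta> \<kappa>0"
    and lip: "lipschitz_like (\<lambda>p. gph (\<lambda>x. subdiff_x g x p)) p0 (x0, vh)"
  shows "lipschitzian_fully_stable f g x0 p0 v0"
proof -
  \<comment> \<open>The other half of the modulus pays for the variation of the gradient of \<open>f\<close>.\<close>
  define \<kappa> where "\<kappa> = \<kappa>0 / 2"
  have \<eta>: "\<eta> > 0" and \<kappa>: "\<kappa> > 0" using pos by (auto simp: coderivative_positivity_def \<kappa>_def)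
  define lf where "lf = norm (grad_x f x0 p0) + \<kappa>"
  have lf: "lf \<ge> 0" using \<kappa> by (simp add: lf_def)
  obtain \<delta>1 L where \<delta>1: "\<delta>1 > 0" "L > 0"
    and der: "\<And>x p. x \<in> cball x0 \<delta>1 \<Longrightarrow> p \<in> cball p0 \<delta>1 \<Longrightarrow> ((\<lambda>x. f (x, p)) has_derivative grad_x f x p) (at x)"
    and grad: "\<And>x p h. x \<in> cball x0 \<delta>1 \<Longrightarrow> p \<in> cball p0 \<delta>1 \<Longrightarrow>
      \<bar>inner (grad_x f x p h) h - inner (grad_x f x0 p0 h) h\<bar> \<le> \<kappa> * (norm h)\<^sup>2"
    and f_x: "\<And>x x' p. x \<in> cball x0 \<delta>1 \<Longrightarrow> x' \<in> cball x0 \<delta>1 \<Longrightarrow> p \<in> cball p0 \<delta>1 \<Longrightarrow>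
      norm (f (x, p) - f (x', p)) \<le> lf * norm (x - x')"
    and f_p: "\<And>x p q. x \<in> cball x0 \<delta>1 \<Longrightarrow> p \<in> cball p0 \<delta>1 \<Longrightarrow> q \<in> cball p0 \<delta>1 \<Longrightarrow>
      norm (f (x, p) - f (x, q)) \<le> L * dist p q"
    by (rule smooth_lipschitz_base_local[OF A1 \<kappa>, folded lf_def]) (rule that; assumption)
  obtain \<delta>2 r where \<delta>2: "\<delta>2 > 0" and r: "r > 0"
    and prox: "\<And>u v p x. u \<in> cball x0 \<delta>2 \<Longrightarrow> p \<in> cball p0 \<delta>2 \<Longrightarrow> v \<in> cball vh \<delta>2 \<Longrightarrow> v \<in> subdiff_x g u p \<Longrightarrow>
      x \<in> cball x0 \<delta>2 \<Longrightarrow> g (x, p) \<ge> g (u, p) + ereal (inner v (x - u) - r / 2 * (norm (x - u))\<^sup>2)"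
    by (rule param_cont_prox_regular_local[OF A2 vh_sub]) (rule that; assumption)
  obtain \<omega> lk where \<omega>: "\<omega> > 0" and lk: "lk > 0"
    and graph_lip: "\<forall>p\<in>cball p0 \<omega>. \<forall>q\<in>cball p0 \<omega>. \<forall>y\<in>gph (\<lambda>x. subdiff_x g x p) \<inter> cball (x0, vh) \<omega>.
      \<exists>y'\<in>gph (\<lambda>x. subdiff_x g x q). norm (y - y') \<le> lk * dist p q"
    using lip unfolding lipschitz_like_iff by blast
  have graph_step: "\<exists>x' w'. w' \<in> subdiff_x g x' q \<and> norm (x - x') \<le> lk * dist p q \<and> norm (w - w') \<le> lk * dist p q"
    if h: "p \<in> cball p0 \<omega>" "q \<in> cball p0 \<omega>" "w \<in> subdiff_x g x p"
      "norm (x - x0) \<le> \<omega> / 2" "norm (w - vh) \<le> \<omega> / 2" for x w p q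
  proof -
    have "dist (x, w) (x0, vh) \<le> \<omega>"
      using norm_Pair_le[of "x - x0" "w - vh"] h by (simp add: dist_norm)
    then have "(x, w) \<in> gph (\<lambda>x. subdiff_x g x p) \<inter> cball (x0, vh) \<omega>"
      using h by (simp add: gph_def dist_commute)
    then obtain y' where y': "y' \<in> gph (\<lambda>x. subdiff_x g x q)" "norm ((x, w) - y') \<le> lk * dist p q"
      using graph_lip h(1,2) by blast
    obtain x' w' where "y' = (x', w')" by (cases y')
    then show ?thesis
      using y' norm_fst_le[of "x - x'" "w - w'"] norm_snd_le[of "w - w'" "x - x'"]
      by (intro exI[of _ x'] exI[of _ w']) (auto simp: gph_def)
  qed
  \<comment> \<open>Boxes of radius \<open>\<delta>\<close> around points that are \<open>\<delta>\<close>-close to the reference point stay where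
    all assumptions hold.\<close>
  define \<delta> where "\<delta> = Min {\<delta>1, \<delta>2, \<eta>} / 2"
  have \<delta>: "\<delta> > 0" "2 * \<delta> \<le> \<delta>1" "2 * \<delta> \<le> \<delta>2" "2 * \<delta> \<le> \<eta>"
    using \<delta>1 \<delta>2 \<eta> by (auto simp: \<delta>_def)
  have f_xp: "norm (f (x, p) - f (x', q)) \<le> lf * norm (x - x') + L * dist p q"
    if "x \<in> cball x0 (2 * \<delta>)" "x' \<in> cball x0 (2 * \<delta>)" "p \<in> cball p0 (2 * \<delta>)" "q \<in> cball p0 (2 * \<delta>)" for x x' p q
  proof -
    have "norm (f (x, p) - f (x', p)) \<le> lf * norm (x - x')" using that \<delta> by (intro f_x) auto
    moreover have "norm (f (x', p) - f (x', q)) \<le> L * dist p q" using that \<delta> by (intro f_p) auto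
    ultimately show ?thesis
      using norm_triangle_ineq[of "f (x, p) - f (x', p)" "f (x', p) - f (x', q)"] by simp
  qed
  define \<sigma> where "\<sigma> = r + lf + 1"
  have \<sigma>: "\<sigma> \<ge> 1" using r lf by (simp add: \<sigma>_def)
  define \<gamma> where "\<gamma> = \<delta> / ((3 + 2 * \<sigma>) * (2 * (lf + 1)))"
  have \<gamma>_mult: "(3 + 2 * \<sigma>) * (2 * (lf + 1)) * \<gamma> = \<delta>"
    using \<sigma> lf by (simp add: \<gamma>_def)
  have \<gamma>: "\<gamma> > 0" using \<delta> \<sigma> lf by (simp add: \<gamma>_def)
  have \<gamma>\<delta>: "(2 + 2 * \<sigma>) * (2 * (lf + 1) * \<gamma>) < \<delta>"
  proof -
    have "0 < 2 * (lf + 1) * \<gamma>" using \<gamma> lf by simp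
    then have "(2 + 2 * \<sigma>) * (2 * (lf + 1) * \<gamma>) < (3 + 2 * \<sigma>) * (2 * (lf + 1) * \<gamma>)"
      by (intro mult_strict_right_mono) auto
    then show ?thesis using \<gamma>_mult by (simp only: mult.assoc)
  qed
  define \<tau> where "\<tau> = \<gamma> / (1 + \<sigma> + lf)"
  have \<tau>: "\<tau> > 0" "(1 + \<sigma> + lf) * \<tau> \<le> \<gamma>" using \<gamma> \<sigma> lf by (auto simp: \<tau>_def)
  have \<tau>\<delta>: "\<tau> \<le> \<delta>"
  proof -
    have "1 * \<tau> \<le> (1 + \<sigma> + lf) * \<tau>" using \<tau>(1) \<sigma> lf by (intro mult_right_mono) auto
    moreover have "1 * \<gamma> \<le> (2 + 2 * \<sigma>) * (2 * (lf + 1)) * \<gamma>"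
    proof (intro mult_right_mono)
      have "1 * 1 \<le> (2 + 2 * \<sigma>) * (2 * (lf + 1))" using \<sigma> lf by (intro mult_mono) auto
      then show "1 \<le> (2 + 2 * \<sigma>) * (2 * (lf + 1))" by simp
    qed (use \<gamma> in auto)
    ultimately show ?thesis using \<tau>(2) \<gamma>\<delta> by (simp add: mult.assoc)
  qed
  define \<rho> where "\<rho> = min (\<tau> / 4) (\<omega> / 2)"
  have \<rho>: "\<rho> > 0" "\<rho> \<le> \<tau> / 4" "\<rho> \<le> \<omega> / 2" using \<tau> \<omega> by (auto simp: \<rho>_def)
  define t where "t = min (\<rho> / (6 * (lf + 1))) (\<gamma> / (\<kappa> + \<sigma>))"
  have t: "t > 0" "t * (6 * (lf + 1)) \<le> \<rho>" "t * (\<kappa> + \<sigma>) \<le> \<gamma>"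
  proof -
    have den: "6 * (lf + 1) > 0" "\<kappa> + \<sigma> > 0" using lf \<kappa> \<sigma> by auto
    show "t > 0" using den \<rho> \<gamma> by (simp add: t_def)
    show "t * (6 * (lf + 1)) \<le> \<rho>" using den(1) unfolding pos_le_divide_eq[OF den(1), symmetric] by (simp add: t_def)
    show "t * (\<kappa> + \<sigma>) \<le> \<gamma>" unfolding pos_le_divide_eq[OF den(2), symmetric] by (simp add: t_def)
  qed
  have t\<rho>: "2 * t \<le> \<rho>" "lf * (2 * t) \<le> \<rho> / 3"
  proof -
    have "0 \<le> lf * t" using lf t by simp
    then show "2 * t \<le> \<rho>" "lf * (2 * t) \<le> \<rho> / 3" using t(1,2) by (auto simp: algebra_simps)
  qed
  define \<nu> where "\<nu> = min (\<rho> / 3) (\<kappa> * t / 2)"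
  have \<nu>: "\<nu> > 0" "\<nu> \<le> \<rho> / 3" "\<nu> \<le> \<kappa> * t / 2" using \<rho> \<kappa> t by (auto simp: \<nu>_def)
  \<comment> \<open>The parameter radius \<open>\<pi>\<close> is chosen last: it makes every displacement caused by a change of the
    parameter, that is, \<open>\<pi>\<close> times a coefficient at most \<open>M\<close>, as small as the earlier radii require.\<close>
  define M where "M = 2 * lk + lf * lk + L + 1"
  define m where "m = Min {t, \<tau> / 4, \<delta>, \<kappa> * t / 2, \<rho> / 3}"
  have M: "M > 0" using lk lf \<delta>1 by (simp add: M_def add_pos_nonneg)
  have m: "m > 0" "m \<le> t" "m \<le> \<tau> / 4" "m \<le> \<delta>" "m \<le> \<kappa> * t / 2" "m \<le> \<rho> / 3"
    using t \<tau> \<delta> \<kappa> \<rho> by (auto simp: m_def)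
  define \<pi> where "\<pi> = Min {\<omega>, 2 * \<delta>, m / M}"
  have \<pi>: "\<pi> > 0" "\<pi> \<le> \<omega>" "\<pi> \<le> 2 * \<delta>" "\<pi> * M \<le> m"
    using \<omega> \<delta>(1) m(1) M unfolding pos_le_divide_eq[OF M, symmetric] by (simp_all add: \<pi>_def)
  have \<pi>_le: "c * \<pi> \<le> m" if "c \<le> M" for c
  proof -
    have "c * \<pi> \<le> M * \<pi>" using that \<pi>(1) by (intro mult_right_mono) auto
    also have "\<dots> \<le> m" using \<pi>(4) by (simp only: mult.commute)
    finally show ?thesis .
  qed
  have lf_lk: "0 \<le> lf * lk" using lf lk by simp
  have \<pi>m: "lk * \<pi> \<le> m" "2 * lk * \<pi> \<le> m" "L * \<pi> \<le> m" "(lk + lf * lk + L) * \<pi> \<le> m"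
    using lk lf_lk \<delta>1(2) by (auto intro!: \<pi>_le simp: M_def)
  have anchor: "\<exists>xp vp. vp \<in> subdiff_x g xp p \<and> norm (xp - x0) \<le> lk * \<pi> \<and> norm (vp - vh) \<le> lk * \<pi>"
    if p: "p \<in> cball p0 \<pi>" for p
  proof -
    obtain xp vp where "vp \<in> subdiff_x g xp p" "norm (x0 - xp) \<le> lk * dist p0 p" "norm (vh - vp) \<le> lk * dist p0 p"
      using graph_step[of p0 p vh x0] p \<pi> \<omega> vh_sub by auto
    moreover have "lk * dist p0 p \<le> lk * \<pi>" using p lk by (intro mult_left_mono) auto
    ultimately show ?thesis by (metis norm_minus_commute order_trans)
  qed
  have local_props:
    "(\<forall>x1 v1 x2 v2. norm (x1 - x0) \<le> \<tau> / 2 \<and> norm (v1 - vh) \<le> \<tau> / 2 \<and> v1 \<in> subdiff_x g x1 p \<and>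
        norm (x2 - x0) \<le> \<tau> / 2 \<and> norm (v2 - vh) \<le> \<tau> / 2 \<and> v2 \<in> subdiff_x g x2 p \<longrightarrow>
        \<kappa> * (norm (x1 - x2))\<^sup>2 \<le> inner (x1 - x2) ((v1 + f (x1, p)) - (v2 + f (x2, p)))) \<and>
     (\<forall>y\<in>cball v0 \<nu>. \<exists>x\<in>cball x0 (2 * t). y - f (x, p) \<in> subdiff_x g x p)"
    if p: "p \<in> cball p0 \<pi>" for p
  proof -
    obtain xp vp where vp: "vp \<in> subdiff_x g xp p" and xp_x0: "norm (xp - x0) \<le> lk * \<pi>"
      and vp_vh: "norm (vp - vh) \<le> lk * \<pi>"
      using anchor[OF p] by blast
    have p\<delta>: "p \<in> cball p0 (2 * \<delta>)" using p \<pi> by auto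
    have near_x0: "x \<in> cball x0 (2 * \<delta>)" if "x \<in> cball xp \<delta>" for x
      using that dist_triangle[of x0 x xp] xp_x0 \<pi>m(1) m(4) by (simp add: dist_norm norm_minus_commute)
    have near_vh: "v \<in> cball vh (2 * \<delta>)" if "v \<in> cball vp \<delta>" for v
      using that dist_triangle[of vh v vp] vp_vh \<pi>m(1) m(4) by (simp add: dist_norm norm_minus_commute)
    let ?\<phi> = "\<lambda>x. g (x, p)"
    have prox_p: "?\<phi> x \<ge> ?\<phi> u + ereal (inner v (x - u) - r / 2 * (norm (x - u))\<^sup>2)"
      if "u \<in> cball xp \<delta>" "v \<in> cball vp \<delta>" "v \<in> lim_subdiff ?\<phi> u" "x \<in> cball xp \<delta>" for u v x
    proof (rule prox)
      show "u \<in> cball x0 \<delta>2" "x \<in> cball x0 \<delta>2" "v \<in> cball vh \<delta>2"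
        using near_x0[OF that(1)] near_x0[OF that(4)] near_vh[OF that(2)] \<delta>(3) by auto
      show "p \<in> cball p0 \<delta>2" using p\<delta> \<delta>(3) by auto
      show "v \<in> subdiff_x g u p" using that(3) by (simp add: subdiff_x_def)
    qed
    have f_lip_p: "norm (f (x, p) - f (x', p)) \<le> lf * norm (x - x')"
      if "x \<in> cball xp \<delta>" "x' \<in> cball xp \<delta>" for x x'
      using f_xp[OF near_x0[OF that(1)] near_x0[OF that(2)] p\<delta> p\<delta>] by simp
    have der_p: "((\<lambda>x. f (x, p)) has_derivative grad_x f x p) (at x)" if "x \<in> ball xp \<delta>" for x
      using near_x0[of x] that p\<delta> \<delta>(2) by (intro der) auto
    have cod_p: "\<kappa> * (norm w)\<^sup>2 \<le> inner (grad_x f x p w) w + inner z w"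
      if x: "x \<in> ball xp \<delta>" and v: "v \<in> ball vp \<delta>" "v \<in> lim_subdiff ?\<phi> x"
        and z: "z \<in> reg_coderiv (lim_subdiff ?\<phi>) (x, v) w" for x v w z
    proof -
      have x': "x \<in> cball x0 (2 * \<delta>)" and v': "v \<in> cball vh (2 * \<delta>)" using near_x0[of x] near_vh[of v] x v by auto
      have "(x, p, v) \<in> gph_subdiff_x g \<inter> cball x0 \<eta> \<times> cball p0 \<eta> \<times> cball vh \<eta>"
        using x' v' p\<delta> \<delta>(4) v(2) by (auto simp: gph_subdiff_x_def subdiff_x_def)
      moreover have "z \<in> reg_coderiv (\<lambda>x. subdiff_x g x p) (x, v) w" using z by (simp add: subdiff_x_def)
      ultimately have "\<kappa>0 * (norm w)\<^sup>2 \<le> inner (grad_x f x0 p0 w) w + inner z w"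
        using pos unfolding coderivative_positivity_def by blast
      moreover have "\<bar>inner (grad_x f x p w) w - inner (grad_x f x0 p0 w) w\<bar> \<le> \<kappa> * (norm w)\<^sup>2"
        using x' p\<delta> \<delta>(2) by (intro grad) auto
      moreover have "\<kappa>0 * (norm w)\<^sup>2 = \<kappa> * (norm w)\<^sup>2 + \<kappa> * (norm w)\<^sup>2" by (simp add: \<kappa>_def)
      ultimately show ?thesis by linarith
    qed
    note props = lsc_slice[OF lsc, of p] proper vp[unfolded subdiff_x_def]
      prox_p f_lip_p der_p cod_p less_imp_le[OF r] lf \<kappa> \<sigma>_def \<gamma> \<gamma>\<delta>
    show ?thesis
    proof (intro conjI allI impI ballI)
      fix x1 v1 x2 v2
      assume *: "norm (x1 - x0) \<le> \<tau> / 2 \<and> norm (v1 - vh) \<le> \<tau> / 2 \<and> v1 \<in> subdiff_x g x1 p \<and>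
        norm (x2 - x0) \<le> \<tau> / 2 \<and> norm (v2 - vh) \<le> \<tau> / 2 \<and> v2 \<in> subdiff_x g x2 p"
      have half: "lk * \<pi> \<le> \<tau> / 2" using \<pi>m(1) m(3) \<tau>(1) by linarith
      have x_near: "x \<in> cball xp \<tau>" if "norm (x - x0) \<le> \<tau> / 2" for x
        using that half xp_x0 dist_triangle[of xp x x0] by (simp add: dist_norm norm_minus_commute)
      have v_near: "v \<in> cball vp \<tau>" if "norm (v - vh) \<le> \<tau> / 2" for v
        using that half vp_vh dist_triangle[of vp v vh] by (simp add: dist_norm norm_minus_commute)
      show "\<kappa> * (norm (x1 - x2))\<^sup>2 \<le> inner (x1 - x2) ((v1 + f (x1, p)) - (v2 + f (x2, p)))"
      proof (rule variational_sum_strongly_monotone[where \<phi> = ?\<phi> and f = "\<lambda>x. f (x, p)" and ?x0.0 = xp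
            and ?v0.0 = vp and B = "\<lambda>x. blinfun_apply (grad_x f x p)" and r = r
            and l = lf and \<sigma> = \<sigma> and \<gamma> = \<gamma> and \<tau> = \<tau> and \<delta> = \<delta>
            and \<kappa> = \<kappa> and ?x1.0 = x1 and ?x2.0 = x2 and ?v1.0 = v1 and ?v2.0 = v2])
        show "x1 \<in> cball xp \<tau>" "v1 \<in> cball vp \<tau>" "v1 \<in> lim_subdiff ?\<phi> x1"
          "x2 \<in> cball xp \<tau>" "v2 \<in> cball vp \<tau>" "v2 \<in> lim_subdiff ?\<phi> x2"
          using * x_near v_near by (auto simp: subdiff_x_def)
      qed (fact props \<tau>(2))+
    next
      fix y assume y: "y \<in> cball v0 \<nu>"
      have xp\<delta>: "xp \<in> cball x0 (2 * \<delta>)" using near_x0[of xp] \<delta>(1) by simp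
      have "norm (y - (vp + f (xp, p))) \<le> norm (y - v0) + norm (vp - vh) + norm (f (xp, p) - f (x0, p0))"
      proof -
        have eq: "y - (vp + f (xp, p)) = (y - v0) - (vp - vh) - (f (xp, p) - f (x0, p0))" by (simp add: vh)
        show ?thesis unfolding eq by (meson add_right_mono norm_triangle_ineq4 order_trans)
      qed
      also have "norm (f (xp, p) - f (x0, p0)) \<le> lf * norm (xp - x0) + L * dist p p0"
        using xp\<delta> p\<delta> \<delta>(1) by (intro f_xp) auto
      also have "norm (y - v0) + norm (vp - vh) + (lf * norm (xp - x0) + L * dist p p0)
          \<le> \<nu> + lk * \<pi> + (lf * (lk * \<pi>) + L * \<pi>)"
        using y vp_vh xp_x0 p lf \<delta>1(2)
        by (intro add_mono mult_left_mono) (auto simp: dist_norm norm_minus_commute dist_commute)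
      also have "\<dots> = \<nu> + (lk + lf * lk + L) * \<pi>" by (simp add: algebra_simps)
      also have "\<dots> \<le> \<kappa> * t" using \<pi>m(4) m(5) \<nu>(3) by linarith
      finally have yB: "y \<in> cball (vp + f (xp, p)) (\<kappa> * t)" by (simp add: dist_norm norm_minus_commute)
      have "\<exists>x\<in>cball xp t. y - f (x, p) \<in> lim_subdiff ?\<phi> x"
      proof (rule variational_sum_onto[where \<phi> = ?\<phi> and f = "\<lambda>x. f (x, p)" and ?x0.0 = xp
            and ?v0.0 = vp and B = "\<lambda>x. blinfun_apply (grad_x f x p)" and r = r
            and l = lf and \<sigma> = \<sigma> and \<gamma> = \<gamma> and \<kappa> = \<kappa> and \<delta> = \<delta>
            and t = t and y = y])
        show "0 \<le> t" "(\<kappa> + \<sigma>) * t \<le> \<gamma>" using t by (simp_all add: mult.commute)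
      qed (fact props yB)+
      then obtain x where x: "x \<in> cball xp t" "y - f (x, p) \<in> lim_subdiff ?\<phi> x" by blast
      have "x \<in> cball x0 (2 * t)"
        using x(1) dist_triangle[of x0 x xp] xp_x0 \<pi>m(1) m(2) by (simp add: dist_norm norm_minus_commute)
      then show "\<exists>x\<in>cball x0 (2 * t). y - f (x, p) \<in> subdiff_x g x p"
        using x(2) by (auto simp: subdiff_x_def)
    qed
  qed
  have mono: "\<kappa> * (norm (x1 - x2))\<^sup>2 \<le> inner (x1 - x2) (y1 - y2)"
    if "p \<in> cball p0 \<pi>" "norm (x1 - x0) \<le> \<tau> / 2" "norm (y1 - f (x1, p) - vh) \<le> \<tau> / 2"
      "y1 - f (x1, p) \<in> subdiff_x g x1 p" "norm (x2 - x0) \<le> \<tau> / 2" "norm (y2 - f (x2, p) - vh) \<le> \<tau> / 2"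
      "y2 - f (x2, p) \<in> subdiff_x g x2 p" for p x1 y1 x2 y2
    using local_props[OF that(1), THEN conjunct1, rule_format,
        of x1 "y1 - f (x1, p)" x2 "y2 - f (x2, p)"] that(2-) by simp
  define V where "V = cball v0 \<nu>"
  define Q where "Q = cball p0 \<pi>"
  define U where "U = cball x0 (2 * t)"
  have sol_near: "norm (x - x0) \<le> \<rho> \<and> norm (v - f (x, p) - vh) \<le> \<rho>"
    if "v \<in> V" "p \<in> Q" "x \<in> U" for v p x
  proof
    have xn: "norm (x - x0) \<le> 2 * t" using that(3) by (simp add: U_def dist_norm norm_minus_commute)
    then show "norm (x - x0) \<le> \<rho>" using t\<rho> by simp
    have "x \<in> cball x0 (2 * \<delta>)" "p \<in> cball p0 (2 * \<delta>)"
      using that t\<rho> \<rho>(2) \<tau>\<delta> \<tau>(1) \<pi>(3) by (auto simp: U_def Q_def)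
    then have "norm (f (x, p) - f (x0, p0)) \<le> lf * norm (x - x0) + L * dist p p0"
      using \<delta>(1) by (intro f_xp) auto
    also have "\<dots> \<le> lf * (2 * t) + L * \<pi>"
      using xn that(2) lf \<delta>1(2) by (intro add_mono mult_left_mono) (auto simp: Q_def dist_commute)
    finally have "norm (f (x, p) - f (x0, p0)) \<le> lf * (2 * t) + L * \<pi>" .
    moreover have "norm (v - v0) \<le> \<nu>" using that(1) by (simp add: V_def dist_norm norm_minus_commute)
    moreover have "norm (v - f (x, p) - vh) \<le> norm (v - v0) + norm (f (x, p) - f (x0, p0))"
    proof -
      have eq: "v - f (x, p) - vh = (v - v0) - (f (x, p) - f (x0, p0))" by (simp add: vh)
      show ?thesis unfolding eq by (rule norm_triangle_ineq4)
    qed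
    ultimately show "norm (v - f (x, p) - vh) \<le> \<rho>" using t\<rho>(2) \<pi>m(3) m(6) \<nu>(2) by linarith
  qed
  have \<rho>\<tau>: "\<rho> \<le> \<tau> / 2" using \<rho>(2) \<tau>(1) by simp
  define \<theta> where "\<theta> = (\<lambda>(v, p). SOME x. x \<in> U \<and> v - f (x, p) \<in> subdiff_x g x p)"
  have \<theta>: "\<theta> (v, p) \<in> U" "v - f (\<theta> (v, p), p) \<in> subdiff_x g (\<theta> (v, p)) p" if "v \<in> V" "p \<in> Q" for v p
  proof -
    have "\<exists>x. x \<in> U \<and> v - f (x, p) \<in> subdiff_x g x p"
      using local_props[of p] that unfolding U_def V_def Q_def by blast
    from someI_ex[OF this] show "\<theta> (v, p) \<in> U" "v - f (\<theta> (v, p), p) \<in> subdiff_x g (\<theta> (v, p)) p"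
      by (auto simp: \<theta>_def)
  qed
  have \<theta>_near: "norm (\<theta> (v, p) - x0) \<le> \<rho>" "norm (v - f (\<theta> (v, p), p) - vh) \<le> \<rho>" if "v \<in> V" "p \<in> Q" for v p
    using sol_near[OF that \<theta>(1)[OF that]] by auto
  have \<theta>_unique: "x = \<theta> (v, p)" if "v \<in> V" "p \<in> Q" "x \<in> U" "v - f (x, p) \<in> subdiff_x g x p" for v p x
  proof -
    have "\<kappa> * (norm (x - \<theta> (v, p)))\<^sup>2 \<le> inner (x - \<theta> (v, p)) (v - v)"
      using sol_near[OF that(1-3)] \<theta>_near[OF that(1,2)] \<theta>(2)[OF that(1,2)] that \<rho>\<tau>
      by (intro mono[of p]) (auto simp: Q_def)
    then show ?thesis using \<kappa> by (simp add: mult_le_0_iff)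
  qed
  have loc: "sv_localization (solution_map f g) v0 p0 x0 V Q U \<theta>"
    unfolding sv_localization_def
  proof (intro conjI)
    show "v0 \<in> interior V" "p0 \<in> interior Q" "x0 \<in> interior U"
      using \<nu> \<pi> t by (auto simp: V_def Q_def U_def mem_interior_cball)
    show "\<theta> ` (V \<times> Q) \<subseteq> U" using \<theta>(1) by auto
    show "{((v, p), x). (v, p) \<in> V \<times> Q \<and> x = \<theta> (v, p)} = gph (solution_map f g) \<inter> (V \<times> Q) \<times> U"
      using \<theta> \<theta>_unique by (auto simp: gph_def solution_map_iff)
  qed
  have in_v: "norm ((v1 - v2) - (2 * \<kappa>) *\<^sub>R (\<theta> (v1, p) - \<theta> (v2, p))) \<le> norm (v1 - v2)"
    if "v1 \<in> V" "v2 \<in> V" "p \<in> Q" for v1 v2 p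
  proof -
    have "\<kappa> * (norm (\<theta> (v1, p) - \<theta> (v2, p)))\<^sup>2 \<le> inner (\<theta> (v1, p) - \<theta> (v2, p)) (v1 - v2)"
      using \<theta>_near[OF that(1,3)] \<theta>_near[OF that(2,3)] \<theta>(2)[OF that(1,3)] \<theta>(2)[OF that(2,3)] that \<rho>\<tau>
      by (intro mono[of p]) (auto simp: Q_def)
    then have "2 * \<kappa> * (norm (\<theta> (v1, p) - \<theta> (v2, p)))\<^sup>2 \<le> 2 * inner (\<theta> (v1, p) - \<theta> (v2, p)) (v1 - v2)"
      unfolding mult.assoc by (rule mult_left_mono) simp
    moreover have "2 * \<kappa> > 0" using \<kappa> by simp
    ultimately show ?thesis by (simp only: norm_diff_scaleR_le_iff)
  qed
  define lp where "lp = lk + 1 / \<kappa> * (lk + lf * lk + L)"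
  have lp: "lp > 0" using lk \<kappa> lf_lk \<delta>1(2) by (simp add: lp_def add_pos_nonneg)
  have in_p: "norm (\<theta> (v, p) - \<theta> (v, q)) \<le> lp * dist p q" if v: "v \<in> V" and pq: "p \<in> Q" "q \<in> Q" for v p q
  proof -
    define x where "x = \<theta> (v, p)"
    define w where "w = v - f (x, p)"
    have x: "norm (x - x0) \<le> \<rho>" "norm (w - vh) \<le> \<rho>" "w \<in> subdiff_x g x p"
      using \<theta>_near[OF v pq(1)] \<theta>(2)[OF v pq(1)] by (auto simp: x_def w_def)
    have "p \<in> cball p0 \<omega>" "q \<in> cball p0 \<omega>" using pq \<pi>(2) by (auto simp: Q_def)
    then obtain x' w' where x': "w' \<in> subdiff_x g x' q" "norm (x - x') \<le> lk * dist p q" "norm (w - w') \<le> lk * dist p q"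
      using graph_step[of p q w x] x \<rho>(3) by auto
    have "dist p q \<le> 2 * \<pi>" using dist_triangle[of p q p0] pq by (simp add: Q_def dist_commute)
    then have "lk * dist p q \<le> lk * (2 * \<pi>)" using lk by (intro mult_left_mono) auto
    then have small: "lk * dist p q \<le> \<tau> / 4" using \<pi>m(2) m(3) by (simp add: mult_ac)
    have x'_near: "norm (x' - x0) \<le> \<tau> / 2" "norm (w' - vh) \<le> \<tau> / 2"
      using norm_triangle_ineq[of "x' - x" "x - x0"] norm_triangle_ineq[of "w' - w" "w - vh"]
        x x' small \<rho>(2) by (auto simp: norm_minus_commute)
    have "x \<in> cball x0 (2 * \<delta>)" "x' \<in> cball x0 (2 * \<delta>)" "p \<in> cball p0 (2 * \<delta>)" "q \<in> cball p0 (2 * \<delta>)"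
      using x(1) x'_near(1) \<rho>\<tau> \<tau>(1) \<tau>\<delta> pq \<pi>(3) by (auto simp: Q_def dist_norm norm_minus_commute)
    then have "norm (f (x, p) - f (x', q)) \<le> lf * norm (x - x') + L * dist p q" by (rule f_xp)
    also have "\<dots> \<le> lf * (lk * dist p q) + L * dist p q"
      using x'(2) lf \<delta>1(2) by (intro add_mono mult_left_mono) auto
    finally have f_diff: "norm (f (x, p) - f (x', q)) \<le> lf * (lk * dist p q) + L * dist p q" .
    define y' where "y' = w' + f (x', q)"
    have "\<kappa> * (norm (x' - \<theta> (v, q)))\<^sup>2 \<le> inner (x' - \<theta> (v, q)) (y' - v)"
      using \<theta>_near[OF v pq(2)] \<theta>(2)[OF v pq(2)] x'_near x'(1) pq \<rho>\<tau>
      by (intro mono[of q]) (auto simp: Q_def y'_def)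
    then have "norm (x' - \<theta> (v, q)) \<le> 1 / \<kappa> * norm (y' - v)" by (rule norm_le_if_coercive[OF \<kappa>])
    also have "\<dots> \<le> 1 / \<kappa> * ((lk + lf * lk + L) * dist p q)"
    proof (intro mult_left_mono)
      have "y' - v = - (w - w') - (f (x, p) - f (x', q))" by (simp add: y'_def w_def)
      then have "norm (y' - v) \<le> norm (w - w') + norm (f (x, p) - f (x', q))"
        using norm_triangle_ineq4[of "- (w - w')" "f (x, p) - f (x', q)"] by (simp only: norm_minus_cancel)
      then show "norm (y' - v) \<le> (lk + lf * lk + L) * dist p q"
        using x'(3) f_diff by (simp add: algebra_simps)
    qed (use \<kappa> in auto)
    finally have "norm (x' - \<theta> (v, q)) \<le> 1 / \<kappa> * ((lk + lf * lk + L) * dist p q)" .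
    then have "norm (x - \<theta> (v, q)) \<le> lk * dist p q + 1 / \<kappa> * ((lk + lf * lk + L) * dist p q)"
      using norm_triangle_ineq[of "x - x'" "x' - \<theta> (v, q)"] x'(2) by simp
    then show ?thesis unfolding x_def lp_def by (simp only: distrib_right mult.assoc)
  qed
  have "norm ((v1 - v2) - (2 * \<kappa>) *\<^sub>R (\<theta> (v1, p1) - \<theta> (v2, p2))) \<le> norm (v1 - v2) + (2 * \<kappa> * lp) * dist p1 p2"
    if "v1 \<in> V" "p1 \<in> Q" "v2 \<in> V" "p2 \<in> Q" for v1 p1 v2 p2
  proof -
    have eq: "(v1 - v2) - (2 * \<kappa>) *\<^sub>R (\<theta> (v1, p1) - \<theta> (v2, p2))
        = ((v1 - v2) - (2 * \<kappa>) *\<^sub>R (\<theta> (v1, p1) - \<theta> (v2, p1))) - (2 * \<kappa>) *\<^sub>R (\<theta> (v2, p1) - \<theta> (v2, p2))"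
      by (simp add: algebra_simps)
    have "norm ((2 * \<kappa>) *\<^sub>R (\<theta> (v2, p1) - \<theta> (v2, p2))) \<le> 2 * \<kappa> * (lp * dist p1 p2)"
      using in_p[OF that(3,2,4)] \<kappa> by simp
    then show ?thesis
      unfolding eq using norm_triangle_ineq4 in_v[OF that(1,3,2)] by (smt (verit) mult.assoc)
  qed
  moreover have "2 * \<kappa> * lp > 0" using \<kappa> lp by simp
  moreover have "x0 \<in> solution_map f g (v0, p0)" using vh_sub by (simp add: solution_map_iff vh)
  ultimately show ?thesis
    unfolding lipschitzian_fully_stable_def using loc \<kappa> by blast
qed

theorem theorem4p6:
  fixes f :: "'a::{real_inner, complete_space} \<times> 'p::metric_space \<Rightarrow> 'a"
    and g :: "'a \<times> 'p \<Rightarrow> ereal"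
    and xbar vbar vhat :: 'a
    and pbar :: 'p
  assumes g_proper: "\<And>z. g z \<noteq> - \<infinity>"
    and g_lsc: "lsc g"
    and sol: "xbar \<in> solution_map f g (vbar, pbar)"
    and vhat: "vhat = vbar - f (xbar, pbar)"
    and A1: "smooth_lipschitz_base f xbar pbar"
    and A2: "param_cont_prox_regular g xbar pbar vhat"
    and A3: "lipschitz_like (\<lambda>p. epi (\<lambda>x. g (x, p))) pbar (xbar, real_of_ereal (g (xbar, pbar)))"
  shows "(lipschitzian_fully_stable f g xbar pbar vbar \<longleftrightarrow>
           (\<exists>\<eta> \<kappa>0. \<eta> > 0 \<and> \<kappa>0 > 0 \<and>
              (\<forall>(u, p, v) \<in> gph_subdiff_x g \<inter> cball xbar \<eta> \<times> cball pbar \<eta> \<times> cball vhat \<eta>.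
                 \<forall>w. \<forall>z \<in> reg_coderiv (\<lambda>x. subdiff_x g x p) (u, v) w.
                   inner (grad_x f xbar pbar w) w + inner z w \<ge> \<kappa>0 * (norm w)\<^sup>2)) \<and>
           lipschitz_like (\<lambda>p. gph (\<lambda>x. subdiff_x g x p)) pbar (xbar, vhat)) \<and>
         ((\<exists>\<eta> \<kappa>0. \<eta> > 0 \<and> \<kappa>0 > 0 \<and>
              (\<forall>(u, p, v) \<in> gph_subdiff_x g \<inter> cball xbar \<eta> \<times> cball pbar \<eta> \<times> cball vhat \<eta>.
                 \<forall>w. \<forall>z \<in> reg_coderiv (\<lambda>x. subdiff_x g x p) (u, v) w.
                   inner (grad_x f xbar pbar w) w + inner z w \<ge> \<kappa>0 * (norm w)\<^sup>2)) \<and>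
          lipschitz_like (\<lambda>p. gph (\<lambda>x. subdiff_x g x p)) pbar (xbar, vhat) \<longrightarrow>
          (\<exists>V Q U \<theta> L. sv_localization (solution_map f g) vbar pbar xbar V Q U \<theta> \<and>
             L-lipschitz_on (V \<times> Q) \<theta>))"
  unfolding coderivative_positivity_def[symmetric]
proof -
  let ?a = "\<exists>\<eta> \<kappa>0. coderivative_positivity f g xbar pbar vhat \<eta> \<kappa>0"
  let ?b = "lipschitz_like (\<lambda>p. gph (\<lambda>x. subdiff_x g x p)) pbar (xbar, vhat)"
  have vhat_sub: "vhat \<in> subdiff_x g xbar pbar" using sol by (simp add: solution_map_iff vhat)
  have sufficient: "lipschitzian_fully_stable f g xbar pbar vbar" if ab: "?a \<and> ?b"
    using coderivative_positivity_imp_fully_stable[OF g_proper g_lsc vhat vhat_sub A1 A2] ab by blast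
  have necessary: "(?a \<and> ?b) \<and> (\<exists>V Q U \<theta> L. sv_localization (solution_map f g) vbar pbar xbar V Q U \<theta> \<and>
      L-lipschitz_on (V \<times> Q) \<theta>)"
    if "lipschitzian_fully_stable f g xbar pbar vbar"
  proof -
    from that obtain V Q U \<theta> \<kappa> l where loc: "sv_localization (solution_map f g) vbar pbar xbar V Q U \<theta>"
      and \<kappa>l: "\<kappa> > 0" "l > 0"
      and stab: "\<And>v1 p1 v2 p2. v1 \<in> V \<Longrightarrow> p1 \<in> Q \<Longrightarrow> v2 \<in> V \<Longrightarrow> p2 \<in> Q \<Longrightarrow>
        norm ((v1 - v2) - (2 * \<kappa>) *\<^sub>R (\<theta> (v1, p1) - \<theta> (v2, p2))) \<le> norm (v1 - v2) + l * dist p1 p2"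
      unfolding lipschitzian_fully_stable_def by auto
    obtain \<eta> where "coderivative_positivity f g xbar pbar vhat \<eta> (\<kappa> / 2)"
      using fully_stable_imp_coderivative_positivity[OF A1 loc \<kappa>l(1) stab] unfolding vhat by blast
    moreover have ?b
      using fully_stable_imp_lipschitz_like_subdiff_graph[OF A1 vhat_sub[unfolded vhat] loc \<kappa>l stab]
      unfolding vhat .
    moreover have "((2 + l) / (2 * \<kappa>))-lipschitz_on (V \<times> Q) \<theta>"
      by (rule fully_stable_localization_lipschitz[OF \<kappa>l stab])
    ultimately show ?thesis using loc by blast
  qed
  show "(lipschitzian_fully_stable f g xbar pbar vbar \<longleftrightarrow> ?a \<and> ?b) \<and>
      (?a \<and> ?b \<longrightarrow> (\<exists>V Q U \<theta> L. sv_localization (solution_map f g) vbar pbar xbar V Q U \<theta> \<and>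
        L-lipschitz_on (V \<times> Q) \<theta>))"
    using sufficient necessary by blast
qed

end
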